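(* A finitely generated commutative ring $K$ is finitely separable if and only if every subring of $K$ generated by two elements is finitely separable.
   Context: Rings are associative and are not required to have an identity; subrings and generation are in the sense of rings not necessarily with identity. A ring $K$ is finitely separable if for every $a\in K$ and every subring $A'\subseteq K$ with $a\notin A'$ there exist a finite ring $F$ and a ring homomorphism $\varphi:K\to F$ with $\varphi(a)\notin\varphi(A')$. *)

theory Defs
  imports "HOL-Algebra.Algebra"
begin

text \<open>
  Rings here need not have an identity. They are represented by the ring records of HOL-Algebra;
  the field \<open>one\<close> of such a record is simply never constrained or referred to. The library
  notions \<open>ring\<close>, \<open>subring\<close>, \<open>generate_ring\<close> and \<open>ring_hom\<close> are not used, since they all
  involve the identity.
\<close>

locale rng = abelian_group R for R (structure) +
  assumes rng_m_closed: "\<lbrakk> x \<in> carrier R; y \<in> carrier R \<rbrakk> \<Longrightarrow> x \<otimes> y \<in> carrier R"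
    and rng_m_assoc: "\<lbrakk> x \<in> carrier R; y \<in> carrier R; z \<in> carrier R \<rbrakk>
           \<Longrightarrow> (x \<otimes> y) \<otimes> z = x \<otimes> (y \<otimes> z)"
    and rng_l_distr: "\<lbrakk> x \<in> carrier R; y \<in> carrier R; z \<in> carrier R \<rbrakk>
           \<Longrightarrow> (x \<oplus> y) \<otimes> z = x \<otimes> z \<oplus> y \<otimes> z"
    and rng_r_distr: "\<lbrakk> x \<in> carrier R; y \<in> carrier R; z \<in> carrier R \<rbrakk>
           \<Longrightarrow> z \<otimes> (x \<oplus> y) = z \<otimes> x \<oplus> z \<otimes> y"

locale comm_rng = rng R for R (structure) +
  assumes rng_m_comm: "\<lbrakk> x \<in> carrier R; y \<in> carrier R \<rbrakk> \<Longrightarrow> x \<otimes> y = y \<otimes> x"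

locale subrng = additive_subgroup H R for H and R (structure) +
  assumes subrng_m_closed: "\<lbrakk> x \<in> H; y \<in> H \<rbrakk> \<Longrightarrow> x \<otimes> y \<in> H"

definition generate_rng :: "('a, 'm) ring_scheme \<Rightarrow> 'a set \<Rightarrow> 'a set"
  where "generate_rng R S = \<Inter>{H. subrng H R \<and> S \<subseteq> H}"

definition finitely_generated_rng :: "('a, 'm) ring_scheme \<Rightarrow> bool"
  where "finitely_generated_rng R \<longleftrightarrow>
    (\<exists>S. finite S \<and> S \<subseteq> carrier R \<and> generate_rng R S = carrier R)"

definition rng_hom :: "('a, 'm) ring_scheme \<Rightarrow> ('b, 'n) ring_scheme \<Rightarrow> ('a \<Rightarrow> 'b) set"
  where "rng_hom R S = {h \<in> carrier R \<rightarrow> carrier S.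
    \<forall>x\<in>carrier R. \<forall>y\<in>carrier R.
      h (x \<oplus>\<^bsub>R\<^esub> y) = h x \<oplus>\<^bsub>S\<^esub> h y \<and> h (x \<otimes>\<^bsub>R\<^esub> y) = h x \<otimes>\<^bsub>S\<^esub> h y}"

text \<open>
  HOL cannot quantify existentially over types, so the finite ring in the next definition has its
  elements in \<^typ>\<open>nat\<close>. This is no restriction, as every finite ring is isomorphic to one of
  this form; see \<open>finitely_separableI\<close> below.
\<close>

definition finitely_separable :: "('a, 'm) ring_scheme \<Rightarrow> bool"
  where "finitely_separable K \<longleftrightarrow>
    (\<forall>a\<in>carrier K. \<forall>A. subrng A K \<and> a \<notin> A \<longrightarrow>
      (\<exists>(F :: nat ring) \<phi>. rng F \<and> finite (carrier F) \<and> \<phi> \<in> rng_hom K F \<and> \<phi> a \<notin> \<phi> ` A))"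

lemma (in subrng) rng_restrict:
  assumes "rng R"
  shows "rng (R\<lparr>carrier := H\<rparr>)"
proof -
  interpret R: rng R by fact
  have sub: "x \<in> carrier R" if "x \<in> H" for x using a_subset that by blast
  show ?thesis
  proof (intro rng.intro rng_axioms.intro abelian_groupI)
    fix x assume x: "x \<in> carrier (R\<lparr>carrier := H\<rparr>)"
    then have "\<ominus> x \<in> H" using subgroup.m_inv_closed[OF a_subgroup] by (simp add: a_inv_def)
    moreover have "\<ominus> x \<oplus> x = \<zero>" using x sub by (simp add: R.l_neg)
    ultimately show "\<exists>y\<in>carrier (R\<lparr>carrier := H\<rparr>).
        y \<oplus>\<^bsub>R\<lparr>carrier := H\<rparr>\<^esub> x = \<zero>\<^bsub>R\<lparr>carrier := H\<rparr>\<^esub>" by auto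
  qed (auto simp: sub R.a_ac subrng_m_closed R.rng_m_assoc R.rng_l_distr R.rng_r_distr)
qed

lemma (in rng) subrng_generate_rng:
  assumes "S \<subseteq> carrier R"
  shows "subrng (generate_rng R S) R"
proof -
  have "subrng (carrier R) R"
    by (intro subrng.intro subrng_axioms.intro additive_subgroup.intro)
      (use add.subgroup_self rng_m_closed in auto)
  moreover have "subgroup (\<Inter>{H. subrng H R \<and> S \<subseteq> H}) (add_monoid R)"
    by (rule add.subgroups_Inter)
      (use calculation assms in \<open>auto simp: subrng_def additive_subgroup_def\<close>)
  ultimately show ?thesis
    unfolding generate_rng_def
    by (intro subrng.intro subrng_axioms.intro additive_subgroup.intro)
      (auto intro: subrng.subrng_m_closed)
qed

lemma finitely_separableI:
  fixes K :: "('a, 'm) ring_scheme"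
  assumes "\<And>a A. \<lbrakk> a \<in> carrier K; subrng A K; a \<notin> A \<rbrakk> \<Longrightarrow>
    \<exists>(F :: ('c, 'n) ring_scheme) \<phi>.
      rng F \<and> finite (carrier F) \<and> \<phi> \<in> rng_hom K F \<and> \<phi> a \<notin> \<phi> ` A"
  shows "finitely_separable K"
  unfolding finitely_separable_def
proof (intro ballI allI impI)
  fix a A assume a: "a \<in> carrier K" and A: "subrng A K \<and> a \<notin> A"
  then obtain F :: "('c, 'n) ring_scheme" and \<phi> where F: "rng F" "finite (carrier F)"
    and \<phi>: "\<phi> \<in> rng_hom K F" and sep: "\<phi> a \<notin> \<phi> ` A" using assms by blast
  interpret F: rng F by fact
  have AK: "A \<subseteq> carrier K" using A additive_subgroup.a_subset subrng_def by blast
  obtain f :: "'c \<Rightarrow> nat" where f: "inj_on f (carrier F)"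
    using F(2) finite_imp_inj_to_nat_seg by blast
  define g where "g = inv_into (carrier F) f"
  have g[simp]: "g (f x) = x" if "x \<in> carrier F" for x using f that by (simp add: g_def)
  define G :: "nat ring" where
    "G = \<lparr>carrier = f ` carrier F, monoid.mult = \<lambda>x y. f (g x \<otimes>\<^bsub>F\<^esub> g y), one = 0,
          ring.zero = f \<zero>\<^bsub>F\<^esub>, ring.add = \<lambda>x y. f (g x \<oplus>\<^bsub>F\<^esub> g y)\<rparr>"
  have "rng G"
  proof (intro rng.intro rng_axioms.intro abelian_groupI)
    fix x assume "x \<in> carrier G"
    then obtain y where y: "y \<in> carrier F" "x = f y" by (auto simp: G_def)
    have "f (\<ominus>\<^bsub>F\<^esub> y) \<oplus>\<^bsub>G\<^esub> x = \<zero>\<^bsub>G\<^esub>" using y by (simp add: G_def F.l_neg)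
    then show "\<exists>y\<in>carrier G. y \<oplus>\<^bsub>G\<^esub> x = \<zero>\<^bsub>G\<^esub>" using y by (auto simp: G_def)
  qed (auto simp: G_def F.a_ac F.rng_m_closed F.rng_m_assoc F.rng_l_distr F.rng_r_distr)
  moreover have "finite (carrier G)" using F(2) by (simp add: G_def)
  moreover have "f \<circ> \<phi> \<in> rng_hom K G" using \<phi> by (auto simp: rng_hom_def G_def Pi_iff)
  moreover have "(f \<circ> \<phi>) a \<notin> (f \<circ> \<phi>) ` A"
  proof
    assume "(f \<circ> \<phi>) a \<in> (f \<circ> \<phi>) ` A"
    then obtain b where b: "b \<in> A" "f (\<phi> a) = f (\<phi> b)" by auto
    have "\<phi> a \<in> carrier F" "\<phi> b \<in> carrier F" using \<phi> a b AK by (auto simp: rng_hom_def)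
    then have "\<phi> a = \<phi> b" using b f by (auto dest: inj_onD)
    then show False using sep b by blast
  qed
  ultimately show "\<exists>(F :: nat ring) \<phi>.
      rng F \<and> finite (carrier F) \<and> \<phi> \<in> rng_hom K F \<and> \<phi> a \<notin> \<phi> ` A" by blast
qed

end

theory Submission
  imports Defs "HOL-Library.Set_Algebras" "HOL-Library.Poly_Mapping" "HOL-Library.Multiset"
    "HOL-Computational_Algebra.Polynomial" "HOL-Computational_Algebra.Primes"
    "HOL-Number_Theory.Cong"
begin

text \<open>
  Let \<open>y\<close> be a root of a polynomial with coprime coefficients over \<open>\<int>\<close> or over \<open>(\<int>/p)[x]\<close>.
  By Zariski's main theorem the integral elements of the ring generated by \<open>y\<close> (and \<open>x\<close>) are
  profinitely dense at \<open>y\<close>, so separability makes \<open>y\<close> integral. Applied to generators of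
  \<open>K\<close>, this shows that \<open>c K\<close> is a finitely generated abelian group for some integer \<open>c > 0\<close>,
  and, if \<open>p ^ k K = 0\<close>, that \<open>c(x) K\<close> is a finitely generated \<open>\<int>[x]\<close>-module for some \<open>c\<close>
  nonzero modulo \<open>p\<close>, for each \<open>x\<close> that is transcendental modulo \<open>p\<close>.

  By Noetherian induction on the quotients of \<open>K\<close>, a pair \<open>a \<notin> A\<close> that cannot be separated
  satisfies \<open>a \<in> A + I\<close> for every ideal \<open>I \<noteq> 0\<close>, so \<open>a\<close> may be replaced by an element of
  \<open>I\<close>. With \<open>I = c K\<close>, and separation in finitely generated abelian groups, one gets
  \<open>p ^ k K = 0\<close>. If \<open>A\<close> contains a transcendental \<open>x\<close>, then the \<open>\<int>[x]\<close>-module \<open>c(x) K\<close> gives a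
  contradiction in the same way. Otherwise all elements of \<open>A\<close> are algebraic. A multiple \<open>J\<close>
  of \<open>c(x) K\<close> is torsion-free over \<open>(\<int>/p)[x]\<close>, and it is reduced because \<open>x\<close> and a
  square-zero element generate a ring that is not finitely separable. So each nonzero
  element of \<open>A \<inter> J\<close> has an idempotent power, which must be the identity of \<open>K\<close>, and
  therefore \<open>A\<close> meets a small enough multiple \<open>q(x) K\<close> only in \<open>0\<close>; but every nonzero ideal
  inside \<open>J\<close> meets \<open>A\<close>.
\<close>

section \<open>Noetherian modules\<close>

text \<open>Two rings show what separability excludes. In \<int>[1/2], and likewise in
  \<open>(\<int>/p)[x, 1/x]\<close>, every finite quotient is already the image of \<int>,
  respectively of \<open>(\<int>/p)[x]\<close>, so the inverse cannot be separated from that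
  subring; this is where the polynomial relations come from, and the second ring is the reason for
  two generators. If \<open>e * e = 0\<close> and \<open>x\<close> is transcendental, all additive
  subgroups of \<open>(\<int>/p)[x] e\<close> are subrings, while finite quotients only see
  submodules. The main obstacle is that \<open>A\<close> need not be finitely generated and is a
  module only over scalars that it contains. Over such scalars a Krull type argument applies: if
  \<open>J\<close> is a Noetherian ideal, an element \<open>j\<close> of \<open>J\<close> outside
  \<open>A\<close> is also outside \<open>(A \<inter> J) + q J\<close> for some nonzero scalar
  \<open>q\<close>. By minimality \<open>j\<close> lies in \<open>A + q J\<close> unless
  \<open>q J = 0\<close>, so \<open>q J = 0\<close>. With integer scalars this gives torsion, and
  with a transcendental \<open>x\<close> in \<open>A\<close> a contradiction. If \<open>A\<close> is
  algebraic, \<open>A \<inter> J\<close> is not a \<int>[x]-module for any transcendental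
  \<open>x\<close> at hand, and idempotents have to take over.\<close>

text \<open>The multipliers \<open>E\<close> are an arbitrary set: \<open>submod {} N\<close> says that \<open>N\<close> is an additive subgroup,
  \<open>submod A A\<close> that \<open>A\<close> is a subring (without identity), and \<open>submod B I\<close> with \<open>I \<subseteq> B\<close> that \<open>I\<close> is
  an ideal of \<open>B\<close>. Quotients are avoided: statements about \<open>B / I\<close> carry the ideal \<open>I\<close> along.\<close>

definition submod :: "'r::comm_ring_1 set \<Rightarrow> 'r set \<Rightarrow> bool"
  where "submod E N \<longleftrightarrow>
    0 \<in> N \<and> (\<forall>a\<in>N. \<forall>b\<in>N. a - b \<in> N) \<and> (\<forall>e\<in>E. \<forall>a\<in>N. e * a \<in> N)"

abbreviation span :: "'r::comm_ring_1 set \<Rightarrow> 'r set \<Rightarrow> 'r set"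
  where "span E S \<equiv> submod E hull S"

lemma submodI:
  assumes "0 \<in> N" "\<And>a b. a \<in> N \<Longrightarrow> b \<in> N \<Longrightarrow> a - b \<in> N"
    "\<And>e a. e \<in> E \<Longrightarrow> a \<in> N \<Longrightarrow> e * a \<in> N"
  shows "submod E N"
  using assms by (auto simp: submod_def)

lemma
  assumes "submod E N"
  shows submod_0: "0 \<in> N"
    and submod_diff: "a \<in> N \<Longrightarrow> b \<in> N \<Longrightarrow> a - b \<in> N"
    and submod_mult: "e \<in> E \<Longrightarrow> a \<in> N \<Longrightarrow> e * a \<in> N"
  using assms by (auto simp: submod_def)

lemma submod_minus: "submod E N \<Longrightarrow> a \<in> N \<Longrightarrow> - a \<in> N"
  using submod_diff[of E N 0 a] submod_0[of E N] by simp

lemma submod_add: "submod E N \<Longrightarrow> a \<in> N \<Longrightarrow> b \<in> N \<Longrightarrow> a + b \<in> N"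
  using submod_diff[of E N a "- b"] submod_minus[of E N b] by simp

lemma submod_sum: "submod E N \<Longrightarrow> (\<And>i. i \<in> Y \<Longrightarrow> f i \<in> N) \<Longrightarrow> sum f Y \<in> N"
  by (induction Y rule: infinite_finite_induct) (auto simp: submod_0 submod_add)

lemma submod_of_nat: "submod E N \<Longrightarrow> a \<in> N \<Longrightarrow> of_nat n * a \<in> N"
  by (induction n) (auto simp: submod_0 submod_add algebra_simps)

lemma submod_of_int: "submod E N \<Longrightarrow> a \<in> N \<Longrightarrow> of_int n * a \<in> N"
  by (cases n rule: int_cases2) (auto simp: submod_of_nat submod_minus)

lemma submod_antimono: "submod E N \<Longrightarrow> F \<subseteq> E \<Longrightarrow> submod F N"
  by (auto simp: submod_def)

lemma submod_span [simp]: "submod E (span E S)"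
  by (rule hull_in) (auto simp: submod_def)

lemma span_base: "s \<in> S \<Longrightarrow> s \<in> span E S"
  by (rule hull_inc)

lemma span_minimal: "submod E N \<Longrightarrow> S \<subseteq> N \<Longrightarrow> span E S \<subseteq> N"
  by (rule hull_minimal)

lemma submod_zero: "submod E {0}"
  by (auto simp: submod_def)

lemma submod_Int: "submod E M \<Longrightarrow> submod E N \<Longrightarrow> submod E (M \<inter> N)"
  by (auto simp: submod_def)

lemma submod_plus:
  assumes "submod E M" "submod E N" shows "submod E (M + N)"
proof (rule submodI)
  show "0 \<in> M + N" using set_plus_intro[OF submod_0 submod_0] assms by fastforce
next
  fix a b assume "a \<in> M + N" "b \<in> M + N"
  then obtain m n m' n' where "a = m + n" "b = m' + n'" "m \<in> M" "m' \<in> M" "n \<in> N" "n' \<in> N"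
    by (meson set_plus_elim)
  then show "a - b \<in> M + N"
    using set_plus_intro[of "m - m'" M "n - n'" N] assms by (simp add: submod_diff algebra_simps)
next
  fix e a assume e: "e \<in> E" "a \<in> M + N"
  then obtain m n where "a = m + n" "m \<in> M" "n \<in> N" by (meson set_plus_elim)
  then show "e * a \<in> M + N"
    using set_plus_intro[of "e * m" M "e * n" N] assms e by (simp add: submod_mult algebra_simps)
qed

lemma subset_plusL: "submod E N \<Longrightarrow> M \<subseteq> M + N"
  using set_plus_intro[OF _ submod_0] by fastforce

lemma subset_plusR: "submod E M \<Longrightarrow> N \<subseteq> M + N"
  using set_plus_intro[OF submod_0] by fastforce

lemma plus_minimal: "submod E K \<Longrightarrow> M \<subseteq> K \<Longrightarrow> N \<subseteq> K \<Longrightarrow> M + N \<subseteq> K"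
  by (auto elim!: set_plus_elim intro: submod_add)

lemma submod_image_mult: "submod E N \<Longrightarrow> submod E ((*) z ` N)"
proof (rule submodI)
  assume N: "submod E N"
  show "0 \<in> (*) z ` N" using submod_0[OF N] by force
  show "a - b \<in> (*) z ` N" if "a \<in> (*) z ` N" "b \<in> (*) z ` N" for a b
    using that submod_diff[OF N] by (force simp flip: right_diff_distrib)
  show "e * a \<in> (*) z ` N" if "e \<in> E" "a \<in> (*) z ` N" for e a
    using that submod_mult[OF N] by (force simp: mult.left_commute)
qed

lemma submod_vimage_mult: "submod E M \<Longrightarrow> submod E N \<Longrightarrow> submod E {t \<in> M. z * t \<in> N}"
  by (rule submodI)
    (auto simp: submod_0 submod_diff submod_mult right_diff_distrib mult.left_commute[of z])

text \<open>The ascending chain condition for the module \<open>M / I\<close>, phrased without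
  forming the quotient.\<close>

definition noetherian_between :: "'r::comm_ring_1 set \<Rightarrow> 'r set \<Rightarrow> 'r set \<Rightarrow> bool"
  where "noetherian_between E I M \<longleftrightarrow>
    (\<forall>N :: nat \<Rightarrow> 'r set.
      (\<forall>k. submod E (N k) \<and> I \<subseteq> N k \<and> N k \<subseteq> M \<and> N k \<subseteq> N (Suc k)) \<longrightarrow>
      (\<exists>k. \<forall>m\<ge>k. N m = N k))"

lemma noetherian_betweenI:
  assumes "\<And>N :: nat \<Rightarrow> 'r::comm_ring_1 set.
    \<lbrakk> \<And>k. submod E (N k); \<And>k. I \<subseteq> N k; \<And>k. N k \<subseteq> M; \<And>k m. k \<le> m \<Longrightarrow> N k \<subseteq> N m \<rbrakk>
    \<Longrightarrow> \<exists>k. \<forall>m\<ge>k. N m = N k"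
  shows "noetherian_between E I M"
  unfolding noetherian_between_def
proof (intro allI impI)
  fix N :: "nat \<Rightarrow> 'r set"
  assume N: "\<forall>k. submod E (N k) \<and> I \<subseteq> N k \<and> N k \<subseteq> M \<and> N k \<subseteq> N (Suc k)"
  then have "N k \<subseteq> N m" if "k \<le> m" for k m using lift_Suc_mono_le[of N k m] that by simp
  then show "\<exists>k. \<forall>m\<ge>k. N m = N k" using N by (intro assms) auto
qed

lemma noetherian_betweenD:
  assumes "noetherian_between E I M"
    "\<And>k. submod E (N k)" "\<And>k. I \<subseteq> N k" "\<And>k. N k \<subseteq> M" "\<And>k. N k \<subseteq> N (Suc k)"
  obtains k where "\<And>m. m \<ge> k \<Longrightarrow> N m = N k"
  using assms unfolding noetherian_between_def by (metis (no_types, lifting))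

lemma noetherian_between_mono:
  "noetherian_between E I M \<Longrightarrow> M' \<subseteq> M \<Longrightarrow> I \<subseteq> I' \<Longrightarrow> noetherian_between E I' M'"
  unfolding noetherian_between_def by (meson subset_trans)

lemma noetherian_maximal:
  assumes noe: "noetherian_between E I M"
    and "submod E N\<^sub>0" "I \<subseteq> N\<^sub>0" "N\<^sub>0 \<subseteq> M" "P N\<^sub>0"
  obtains N where "submod E N" "I \<subseteq> N" "N \<subseteq> M" "P N"
    "\<And>N'. submod E N' \<Longrightarrow> N \<subset> N' \<Longrightarrow> N' \<subseteq> M \<Longrightarrow> \<not> P N'"
proof (rule ccontr)
  assume "\<not> thesis"
  note neg = this
  define Q where "Q N \<longleftrightarrow> submod E N \<and> I \<subseteq> N \<and> N \<subseteq> M \<and> P N" for N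
  have "\<exists>f. \<forall>n. Q (f n) \<and> f n \<subset> f (Suc n)"
  proof (rule dependent_nat_choice)
    show "\<exists>N. Q N" using assms by (auto simp: Q_def)
  next
    fix N and n :: nat assume "Q N"
    then show "\<exists>N'. Q N' \<and> N \<subset> N'"
      using neg that[of N] unfolding Q_def by (meson psubset_imp_subset subset_trans)
  qed
  then obtain f where f: "Q (f n)" "f n \<subset> f (Suc n)" for n by blast
  from noe obtain k where k: "\<And>m. m \<ge> k \<Longrightarrow> f m = f k"
    by (rule noetherian_betweenD[of _ _ _ f]) (use f in \<open>unfold Q_def, blast+\<close>)
  show False using k[of "Suc k"] f(2)[of k] by auto
qed

text \<open>Of two nested submodules with the same intersection with \<open>M\<^sub>1\<close> and
  the same sum with \<open>M\<^sub>1\<close>, neither is larger. So a chain stops as soon as the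
  chains of intersections and of sums do.\<close>

lemma noetherian_between_trans:
  assumes IM1: "noetherian_between E I M\<^sub>1" and M1M: "noetherian_between E M\<^sub>1 M"
    and "submod E M\<^sub>1" "submod E M" "I \<subseteq> M\<^sub>1" "M\<^sub>1 \<subseteq> M"
  shows "noetherian_between E I M"
proof (rule noetherian_betweenI)
  fix N :: "nat \<Rightarrow> 'a set"
  assume N: "\<And>k. submod E (N k)" "\<And>k. I \<subseteq> N k" "\<And>k. N k \<subseteq> M"
    and inc: "\<And>k m. k \<le> m \<Longrightarrow> N k \<subseteq> N m"
  have "N k \<subseteq> N (Suc k)" for k using inc by simp
  note N = N this
  obtain k\<^sub>1 where k1: "\<And>m. m \<ge> k\<^sub>1 \<Longrightarrow> N m \<inter> M\<^sub>1 = N k\<^sub>1 \<inter> M\<^sub>1"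
    by (rule noetherian_betweenD[OF IM1, of "\<lambda>k. N k \<inter> M\<^sub>1"])
      (use N assms submod_Int in blast)+
  obtain k\<^sub>2 where k2: "\<And>m. m \<ge> k\<^sub>2 \<Longrightarrow> N m + M\<^sub>1 = N k\<^sub>2 + M\<^sub>1"
  proof (rule noetherian_betweenD[OF M1M, of "\<lambda>k. N k + M\<^sub>1"])
    fix k
    show "submod E (N k + M\<^sub>1)" using N assms by (intro submod_plus)
    show "M\<^sub>1 \<subseteq> N k + M\<^sub>1" using N(1) by (rule subset_plusR)
    show "N k + M\<^sub>1 \<subseteq> M" using N assms by (intro plus_minimal)
    show "N k + M\<^sub>1 \<subseteq> N (Suc k) + M\<^sub>1" using N by (intro set_plus_mono2) auto
  qed blast
  have "N m \<subseteq> N (max k\<^sub>1 k\<^sub>2)" if m: "m \<ge> max k\<^sub>1 k\<^sub>2" for m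
  proof
    let ?k = "max k\<^sub>1 k\<^sub>2"
    fix n assume n: "n \<in> N m"
    then have "n \<in> N m + M\<^sub>1" using subset_plusL assms by blast
    then have "n \<in> N ?k + M\<^sub>1" using k2[of m] k2[of ?k] m by simp
    then obtain n' u where u: "n = n' + u" "n' \<in> N ?k" "u \<in> M\<^sub>1" by (rule set_plus_elim)
    then have "n' \<in> N m" using inc m by blast
    then have "u \<in> N m \<inter> M\<^sub>1" using submod_diff[OF N(1) n, of n'] u by simp
    then have "u \<in> N ?k" using k1[of m] k1[of ?k] m by auto
    then show "n \<in> N ?k" using u N(1) by (auto intro: submod_add)
  qed
  then show "\<exists>k. \<forall>m\<ge>k. N m = N k" using inc by (intro exI[of _ "max k\<^sub>1 k\<^sub>2"]) blast
qed

text \<open>Multiplication by \<open>z\<close> induces a surjection from \<open>M / I\<close> onto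
  \<open>(z M + J) / J\<close>, and a submodule of the target is recovered from its preimage in
  \<open>M\<close>.\<close>

lemma noetherian_between_image_mult:
  assumes noe: "noetherian_between E I M"
    and "submod E M" "submod E J" "I \<subseteq> M" "\<And>i. i \<in> I \<Longrightarrow> z * i \<in> J"
  shows "noetherian_between E J ((*) z ` M + J)"
proof (rule noetherian_betweenI)
  fix N :: "nat \<Rightarrow> 'a set"
  assume N: "\<And>k. submod E (N k)" "\<And>k. J \<subseteq> N k" "\<And>k. N k \<subseteq> (*) z ` M + J"
    and inc: "\<And>k m. k \<le> m \<Longrightarrow> N k \<subseteq> N m"
  obtain k where k: "\<And>m. m \<ge> k \<Longrightarrow> {t \<in> M. z * t \<in> N m} = {t \<in> M. z * t \<in> N k}"
  proof (rule noetherian_betweenD[OF noe, of "\<lambda>k. {t \<in> M. z * t \<in> N k}"])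
    fix k
    show "submod E {t \<in> M. z * t \<in> N k}" by (intro submod_vimage_mult N assms)
    show "I \<subseteq> {t \<in> M. z * t \<in> N k}" using assms N by blast
    show "{t \<in> M. z * t \<in> N k} \<subseteq> {t \<in> M. z * t \<in> N (Suc k)}"
      using inc[of k "Suc k"] by auto
  qed auto
  have "N m \<subseteq> N k" if m: "m \<ge> k" for m
  proof
    fix n assume n: "n \<in> N m"
    then have "n \<in> (*) z ` M + J" using N by blast
    then obtain t j where t: "n = z * t + j" "t \<in> M" "j \<in> J" by (auto elim!: set_plus_elim)
    then have "j \<in> N m" "j \<in> N k" using N by auto
    moreover from this have "z * t \<in> N m" using submod_diff[OF N(1) n, of j] t by simp
    then have "z * t \<in> N k" using k[OF m] t by auto
    ultimately show "n \<in> N k" using t N(1) by (auto intro: submod_add)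
  qed
  then show "\<exists>k. \<forall>m\<ge>k. N m = N k" using inc by blast
qed

lemma noetherian_between_plus:
  assumes "noetherian_between E I M" "submod E M" "submod E J" "I \<subseteq> M" "I \<subseteq> J"
  shows "noetherian_between E J (M + J)"
proof -
  have "(*) (1::'a) ` M = M" by simp
  then show ?thesis using noetherian_between_image_mult[of E I M J 1] assms by auto
qed

text \<open>Hilbert's basis theorem, by comparing the modules of leading coefficients.\<close>

lemma noetherian_between_adjoin:
  assumes noe: "noetherian_between E {0} M\<^sub>0" and M0: "submod E M\<^sub>0"
  shows "noetherian_between (insert x E) {0} (span (insert x E) M\<^sub>0)"
proof -
  \<comment> \<open>\<open>F d\<close> consists of the values of polynomials in \<open>x\<close> of
    degree less than \<open>d\<close> with coefficients in \<open>M\<^sub>0\<close>.\<close>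
  define F where "F d = rec_nat {0} (\<lambda>d V. (*) (x ^ d) ` M\<^sub>0 + V) d" for d :: nat
  have F_0: "F 0 = {0}" and F_Suc: "F (Suc d) = (*) (x ^ d) ` M\<^sub>0 + F d" for d
    unfolding F_def by simp_all
  have F_submod: "submod E (F d)" for d
    by (induction d) (auto simp: F_0 F_Suc intro!: submod_zero submod_plus submod_image_mult M0)
  have F_le: "F d \<subseteq> F (Suc d)" for d
    unfolding F_Suc by (rule subset_plusR[OF submod_image_mult[OF M0]])
  have F_mono: "F d \<subseteq> F d'" if "d \<le> d'" for d d'
    by (rule lift_Suc_mono_le[of F, OF F_le that])
  have F_x: "x * t \<in> F (Suc d)" if "t \<in> F d" for t d
    using that
  proof (induction d arbitrary: t)
    case 0
    then show ?case using submod_0[OF F_submod] by (simp add: F_0)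
  next
    case (Suc d)
    then obtain m u where u: "t = x ^ d * m + u" "m \<in> M\<^sub>0" "u \<in> F d"
      unfolding F_Suc by (auto elim!: set_plus_elim)
    have "x ^ Suc d * m + x * u \<in> F (Suc (Suc d))"
      using u Suc.IH unfolding F_Suc[of "Suc d"] by (intro set_plus_intro) auto
    then show ?case unfolding u(1) by (simp add: algebra_simps)
  qed
  have span_F: "span (insert x E) M\<^sub>0 \<subseteq> (\<Union>d. F d)"
  proof (rule span_minimal)
    show "M\<^sub>0 \<subseteq> (\<Union>d. F d)"
    proof -
      have "M\<^sub>0 = F (Suc 0)" by (simp add: F_Suc F_0)
      then show ?thesis by blast
    qed
    show "submod (insert x E) (\<Union>d. F d)"
    proof (rule submodI)
      show "0 \<in> (\<Union>d. F d)" using submod_0[OF F_submod] by auto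
    next
      fix a b assume "a \<in> (\<Union>d. F d)" "b \<in> (\<Union>d. F d)"
      then obtain d d' where "a \<in> F d" "b \<in> F d'" by blast
      then have "a \<in> F (max d d')" "b \<in> F (max d d')" using F_mono
        by (meson max.cobounded1 max.cobounded2 subsetD)+
      then show "a - b \<in> (\<Union>d. F d)" using submod_diff[OF F_submod] by blast
    next
      fix e a assume "e \<in> insert x E" "a \<in> (\<Union>d. F d)"
      then show "e * a \<in> (\<Union>d. F d)" using F_x submod_mult[OF F_submod] by blast
    qed
  qed
  \<comment> \<open>Leading coefficients: \<open>m\<close> is in \<open>L N d\<close> if
    \<open>N\<close> has an element that is \<open>x ^ d * m\<close> up to lower terms from
    \<open>F d\<close>.\<close>
  define L where "L N d = {m \<in> M\<^sub>0. x ^ d * m \<in> N + F d}" for N d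
  have L_submod: "submod E (L N d)" if "submod (insert x E) N" for N d
    unfolding L_def using submod_antimono[OF that]
    by (intro submod_vimage_mult M0 submod_plus F_submod) blast
  have L_M0: "L N d \<subseteq> M\<^sub>0" for N d unfolding L_def by blast
  have L_Suc: "L N d \<subseteq> L N (Suc d)" if N: "submod (insert x E) N" for N d
  proof
    fix m assume m: "m \<in> L N d"
    then obtain n u where u: "x ^ d * m = n + u" "n \<in> N" "u \<in> F d"
      unfolding L_def by (auto elim!: set_plus_elim)
    have "x * n + x * u \<in> N + F (Suc d)"
      using F_x[OF u(3)] submod_mult[OF N _ u(2)] by (intro set_plus_intro) auto
    then have "x ^ Suc d * m \<in> N + F (Suc d)"
      using u(1) by (simp add: mult.assoc distrib_left)
    then show "m \<in> L N (Suc d)" using m unfolding L_def by blast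
  qed
  have L_mono: "L N d \<subseteq> L N' d'" if "N \<subseteq> N'" "d \<le> d'" "submod (insert x E) N'" for N N' d d'
  proof -
    have "L N' d \<subseteq> L N' d'" by (rule lift_Suc_mono_le[of "L N'", OF L_Suc[OF that(3)] that(2)])
    moreover have "L N d \<subseteq> L N' d"
      unfolding L_def using set_plus_mono2[OF that(1) order.refl, of "F d"] by blast
    ultimately show ?thesis by blast
  qed
  have reconstruct: "N' \<inter> F d \<subseteq> N" if N: "submod (insert x E) N" "submod (insert x E) N'"
    "N \<subseteq> N'" and L: "\<And>d. L N' d \<subseteq> L N d" for N N' d
  proof (induction d)
    case 0
    then show ?case using F_0 submod_0[OF N(1)] by auto
  next
    case (Suc d)
    show ?case
    proof
      fix t assume t: "t \<in> N' \<inter> F (Suc d)"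
      then obtain m u where m: "t = x ^ d * m + u" "m \<in> M\<^sub>0" "u \<in> F d"
        by (auto simp: F_Suc elim!: set_plus_elim)
      have "t - u \<in> N' + F d"
        using t submod_minus[OF F_submod m(3)] set_plus_intro[of t N' "- u" "F d"] by simp
      then have "m \<in> L N d" using m L[of d] unfolding L_def by auto
      then obtain n v where v: "x ^ d * m = n + v" "n \<in> N" "v \<in> F d"
        unfolding L_def by (auto elim!: set_plus_elim)
      have "t - n \<in> N'" using t v N by (intro submod_diff[OF N(2)]) auto
      moreover have "t - n = v + u" using m(1) v(1) by simp
      ultimately have "t - n \<in> N' \<inter> F d" using m(3) v(3) submod_add[OF F_submod] by simp
      then have "t - n \<in> N" using Suc by blast
      then show "t \<in> N" using submod_add[OF N(1) v(2), of "t - n"] by simp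
    qed
  qed
  show ?thesis
  proof (rule noetherian_betweenI)
    fix N :: "nat \<Rightarrow> 'a set"
    assume N: "\<And>k. submod (insert x E) (N k)" "\<And>k. N k \<subseteq> span (insert x E) M\<^sub>0"
      and inc: "\<And>k m. k \<le> m \<Longrightarrow> N k \<subseteq> N m"
    have inc_Suc: "N k \<subseteq> N (Suc k)" for k using inc by simp
    have L_0: "{0} \<subseteq> L (N k) d" for k d using submod_0[OF L_submod[OF N(1)]] by simp
    \<comment> \<open>The diagonal chain settles all degrees from \<open>k\<^sub>0\<close> on at
      once. The finitely many degrees below are settled one by one.\<close>
    obtain k\<^sub>0 where k0: "\<And>m. m \<ge> k\<^sub>0 \<Longrightarrow> L (N m) m = L (N k\<^sub>0) k\<^sub>0"
    proof (rule noetherian_betweenD[OF noe, of "\<lambda>k. L (N k) k"])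
      show "L (N k) k \<subseteq> L (N (Suc k)) (Suc k)" for k by (intro L_mono inc_Suc N) simp
    qed (use L_submod[OF N(1)] L_0 L_M0 in blast)+
    have "\<exists>k. \<forall>m\<ge>k. L (N m) d = L (N k) d" for d
    proof (rule noetherian_betweenD[OF noe, of "\<lambda>k. L (N k) d"])
      show "L (N k) d \<subseteq> L (N (Suc k)) d" for k by (intro L_mono inc_Suc N) simp
    qed (use L_submod[OF N(1)] L_0 L_M0 in blast)+
    then obtain \<kappa> where \<kappa>: "\<And>d m. m \<ge> \<kappa> d \<Longrightarrow> L (N m) d = L (N (\<kappa> d)) d" by metis
    define k where "k = Max (insert k\<^sub>0 (\<kappa> ` {..<k\<^sub>0}))"
    have k_ge: "k\<^sub>0 \<le> k" "\<And>d. d < k\<^sub>0 \<Longrightarrow> \<kappa> d \<le> k" unfolding k_def by auto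
    have "L (N m) d \<subseteq> L (N k) d" if m: "m \<ge> k" for m d
    proof (cases "d < k\<^sub>0")
      case True
      then show ?thesis using \<kappa>[of d m] \<kappa>[of d k] k_ge(2)[of d] m by simp
    next
      case False
      have "L (N m) d \<subseteq> L (N (max m d)) (max m d)" by (intro L_mono inc N) auto
      also have "\<dots> = L (N k\<^sub>0) k\<^sub>0" using k0[of "max m d"] False by simp
      also have "\<dots> \<subseteq> L (N k) d" using False k_ge by (intro L_mono inc N) auto
      finally show ?thesis .
    qed
    then have "N m \<inter> F d \<subseteq> N k" if "m \<ge> k" for m d
      using that by (intro reconstruct N inc)
    then have "N m = N k" if "m \<ge> k" for m
      using that inc[OF that] N(2)[of m] span_F by blast
    then show "\<exists>k. \<forall>m\<ge>k. N m = N k" by blast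
  qed
qed

section \<open>Finitely generated modules over \<int>[E] are Noetherian\<close>

lemma int_subgroup_principal:
  assumes T: "submod {} (T :: int set)"
  shows "\<exists>d\<in>T. \<forall>t\<in>T. d dvd t"
proof (cases "T \<subseteq> {0}")
  case True
  then show ?thesis using submod_0[OF T] by auto
next
  case False
  then obtain t where t: "t \<in> T" "t \<noteq> 0" by blast
  then have "\<bar>t\<bar> \<in> T" using submod_minus[OF T t(1)] by (auto simp: abs_if)
  then have ex: "\<exists>n. int n \<in> T \<and> n > 0" using t by (intro exI[of _ "nat \<bar>t\<bar>"]) auto
  define d where "d = (LEAST n. int n \<in> T \<and> n > 0)"
  have d: "int d \<in> T" "d > 0" using LeastI_ex[OF ex] unfolding d_def by auto
  have "int d dvd t" if "t \<in> T" for t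
  proof -
    have "t - (t div int d) * int d \<in> T"
      using submod_diff[OF T that submod_of_int[OF T d(1), of "t div int d"]] by simp
    then have "t mod int d \<in> T" by (simp add: minus_div_mult_eq_mod)
    moreover have "t mod int d = int (nat (t mod int d))" "nat (t mod int d) < d"
      using d(2) by (auto simp: nat_less_iff)
    ultimately have "nat (t mod int d) = 0"
      using not_less_Least[of "nat (t mod int d)" "\<lambda>n. int n \<in> T \<and> n > 0"] unfolding d_def
      by force
    then have "t mod int d = 0" using d(2) pos_mod_sign[of "int d" t] by linarith
    then show ?thesis by (simp add: dvd_eq_mod_eq_0)
  qed
  then show ?thesis using d by blast
qed

lemma span_empty_singleton: "span {} {g} = range (\<lambda>n::int. of_int n * g)"
proof
  show "span {} {g} \<subseteq> range (\<lambda>n::int. of_int n * g)"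
  proof (rule span_minimal, rule submodI)
    show "0 \<in> range (\<lambda>n::int. of_int n * g)" by (rule range_eqI[of _ _ 0]) simp
    show "{g} \<subseteq> range (\<lambda>n::int. of_int n * g)"
      using rangeI[of "\<lambda>n::int. of_int n * g" 1]
      by (simp only: of_int_1 mult_1 empty_subsetI insert_subset)
    show "a - b \<in> range (\<lambda>n::int. of_int n * g)"
      if "a \<in> range (\<lambda>n::int. of_int n * g)" "b \<in> range (\<lambda>n::int. of_int n * g)" for a b
      using that by (auto simp flip: left_diff_distrib of_int_diff)
  qed auto
  show "range (\<lambda>n::int. of_int n * g) \<subseteq> span {} {g}"
    using submod_of_int[OF submod_span span_base[of g "{g}"]] by blast
qed

text \<open>Pulled back along the map from \<open>n\<close> to \<open>n * g\<close>, the union of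
  the chain is an ideal of \<int>, and its generator already occurs at some stage
  \<open>k\<close>.\<close>

lemma noetherian_between_cyclic_group: "noetherian_between {} {0} (span {} {g})"
proof (rule noetherian_betweenI)
  fix N :: "nat \<Rightarrow> 'a set"
  assume N: "\<And>k. submod {} (N k)" "\<And>k. N k \<subseteq> span {} {g}"
    and inc: "\<And>k m. k \<le> m \<Longrightarrow> N k \<subseteq> N m"
  define T where "T = {n::int. \<exists>k. of_int n * g \<in> N k}"
  have "submod {} T"
  proof (rule submodI)
    show "0 \<in> T" unfolding T_def using submod_0[OF N(1)] by simp
  next
    fix a b assume "a \<in> T" "b \<in> T"
    then obtain k l where "of_int a * g \<in> N k" "of_int b * g \<in> N l" unfolding T_def by blast
    then have "of_int a * g \<in> N (max k l)" "of_int b * g \<in> N (max k l)"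
      using inc by (meson max.cobounded1 max.cobounded2 subsetD)+
    from submod_diff[OF N(1) this] show "a - b \<in> T"
      unfolding T_def by (auto simp: left_diff_distrib)
  qed auto
  from int_subgroup_principal[OF this] obtain d k where d: "of_int d * g \<in> N k"
    "\<And>t. t \<in> T \<Longrightarrow> d dvd t"
    unfolding T_def by blast
  have "N m \<subseteq> N k" for m
  proof
    fix n assume n: "n \<in> N m"
    then obtain t where t: "n = of_int t * g" using N(2) unfolding span_empty_singleton by blast
    then have "d dvd t" using n by (intro d(2)) (auto simp: T_def)
    then obtain s where "t = d * s" by blast
    then show "n \<in> N k" using submod_of_int[OF N(1) d(1), of s] t by (simp add: mult_ac)
  qed
  then show "\<exists>k. \<forall>m\<ge>k. N m = N k" using inc by blast
qed

lemma span_insert_adjoin: "span (insert x E) S \<subseteq> span (insert x E) (span E S)"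
  by (rule hull_mono) (rule hull_subset)

lemma noetherian_between_span_singleton: "finite E \<Longrightarrow> noetherian_between E {0} (span E {g})"
proof (induction E rule: finite_induct)
  case empty
  show ?case by (rule noetherian_between_cyclic_group)
next
  case (insert x E)
  then have "noetherian_between (insert x E) {0} (span (insert x E) (span E {g}))"
    by (intro noetherian_between_adjoin submod_span)
  then show ?case using noetherian_between_mono span_insert_adjoin by blast
qed

lemma span_insert_subset: "span E (insert s S) \<subseteq> span E {s} + span E S"
proof (rule span_minimal)
  show "submod E (span E {s} + span E S)" by (intro submod_plus submod_span)
  have "span E {s} \<subseteq> span E {s} + span E S" "span E S \<subseteq> span E {s} + span E S"
    by (rule subset_plusL subset_plusR, rule submod_span)+
  then show "insert s S \<subseteq> span E {s} + span E S"
    using hull_subset[of "{s}" "submod E"] hull_subset[of S "submod E"] by auto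
qed

lemma noetherian_between_span:
  assumes "finite E" "finite S"
  shows "noetherian_between E {0} (span E S)"
  using assms(2)
proof (induction S rule: finite_induct)
  case empty
  have "span E {} \<subseteq> span E {0}" by (rule hull_mono) simp
  then show ?case using noetherian_between_mono noetherian_between_span_singleton[OF assms(1)]
    by blast
next
  case (insert s S)
  have "noetherian_between E (span E S) (span E {s} + span E S)"
    by (intro noetherian_between_plus[of _ "{0}"] noetherian_between_span_singleton assms submod_span)
      (auto intro: submod_0[OF submod_span])
  then have "noetherian_between E {0} (span E {s} + span E S)"
    by (rule noetherian_between_trans[OF insert.IH])
      (auto intro: submod_0[OF submod_span] submod_plus subset_plusR[OF submod_span, THEN subsetD])
  then show ?case using noetherian_between_mono span_insert_subset by blast
qed

lemma noetherian_between_span_Un: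
  assumes "finite E" "finite S" "submod E J"
  shows "noetherian_between E J (span E (S \<union> J))"
proof -
  have "noetherian_between E J (span E S + J)"
    by (intro noetherian_between_plus[of _ "{0}"] noetherian_between_span assms submod_span)
      (auto intro: submod_0[OF submod_span] submod_0[OF assms(3)])
  moreover have "span E (S \<union> J) \<subseteq> span E S + J"
  proof (rule span_minimal)
    show "submod E (span E S + J)" by (intro submod_plus submod_span assms)
    have "span E S \<subseteq> span E S + J" "J \<subseteq> span E S + J"
      by (rule subset_plusL[OF assms(3)], rule subset_plusR[OF submod_span])
    then show "S \<union> J \<subseteq> span E S + J" using hull_subset[of S "submod E"] by blast
  qed
  ultimately show ?thesis using noetherian_between_mono by blast
qed

text \<open>\<open>span E {1}\<close> is the ring \<int>[E], so a module that is only required to be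
  stable under \<open>E\<close> is stable under all polynomials in \<open>E\<close>.\<close>

lemma span_one_mult:
  assumes "r \<in> span E {1}" "submod E N" "n \<in> N"
  shows "r * n \<in> N"
proof -
  have "span E {1} \<subseteq> {r. r * n \<in> N}"
    using assms(2,3)
    by (intro span_minimal submodI) (auto
      simp: submod_0 submod_diff submod_mult left_diff_distrib mult.assoc)
  then show ?thesis using assms(1) by blast
qed

lemma span_singleton: "span E {t} \<subseteq> (\<lambda>r. r * t) ` span E {1}"
proof (rule span_minimal)
  have "(\<lambda>r. r * t) ` span E {1} = (*) t ` span E {1}" by (simp add: mult.commute)
  then show "submod E ((\<lambda>r. r * t) ` span E {1})" by (simp add: submod_image_mult)
  show "{t} \<subseteq> (\<lambda>r. r * t) ` span E {1}"
    using span_base[of 1 "{1}" E] by (simp add: image_iff) force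
qed

text \<open>Otherwise, in a quotient \<open>J / M\<close> where \<open>j\<close> lies in every
  nonzero submodule, all scalars in \<Gamma> act injectively and \<open>j\<close> is infinitely
  divisible by \<open>r\<^sub>0\<close>, which a Noetherian module forbids. The two cases in view
  are the nonzero integers with \<open>r\<^sub>0 = 2\<close> and the polynomials in \<open>x\<close>
  nonzero modulo \<open>p\<close> with \<open>r\<^sub>0 = x\<close>; the condition on
  \<open>1 - s * r\<^sub>0\<close> says that \<open>r\<^sub>0\<close> is far from
  invertible.\<close>

lemma noetherian_separate:
  assumes noe: "noetherian_between E N J"
    and N: "submod E N" "N \<subseteq> J" and J: "submod E J" and j: "j \<in> J" "j \<notin> N"
    and \<Gamma>: "\<Gamma> \<subseteq> span E {1}" "\<And>r k. r \<in> \<Gamma> \<Longrightarrow> r ^ k \<in> \<Gamma>"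
    and r\<^sub>0: "r\<^sub>0 \<in> \<Gamma>" "\<And>s. s \<in> span E {1} \<Longrightarrow> 1 - s * r\<^sub>0 \<in> \<Gamma>"
  shows "\<exists>q\<in>\<Gamma>. j \<notin> N + (*) q ` J"
proof (rule ccontr)
  assume "\<not> (\<exists>q\<in>\<Gamma>. j \<notin> N + (*) q ` J)"
  then have j_mem: "j \<in> N + (*) q ` J" if "q \<in> \<Gamma>" for q using that by blast
  obtain M where M: "submod E M" "N \<subseteq> M" "M \<subseteq> J" "j \<notin> M"
    and max: "\<And>M'. submod E M' \<Longrightarrow> M \<subset> M' \<Longrightarrow> M' \<subseteq> J \<Longrightarrow> j \<in> M'"
    by (rule noetherian_maximal[OF noe N(1) order.refl N(2), of "\<lambda>M. j \<notin> M"]) (use j in auto)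
  have j_div: "\<exists>t\<in>J. j - q * t \<in> M" if q: "q \<in> \<Gamma>" for q
  proof -
    obtain n t where "j = n + q * t" "n \<in> N" "t \<in> J" using j_mem[OF q]
      by (auto elim!: set_plus_elim)
    then show ?thesis using M by (intro bexI[of _ t]) auto
  qed
  text \<open>Every nonzero element of \<open>J / M\<close> generates a submodule containing \<open>j\<close>, so a scalar acting
    non-injectively is nilpotent.\<close>
  have inj: "t \<in> M" if r: "r \<in> \<Gamma>" and t: "t \<in> J" "r * t \<in> M" for r t
  proof (rule ccontr)
    assume "t \<notin> M"
    have rM: "r * m \<in> M" if "m \<in> M" for m using span_one_mult[OF _ M(1) that] r \<Gamma>(1) by blast
    define T where "T k = {t \<in> J. r ^ k * t \<in> M}" for k
    obtain k where k: "\<And>m. m \<ge> k \<Longrightarrow> T m = T k"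
    proof (rule noetherian_betweenD[OF noe, of T])
      fix k
      show "submod E (T k)" unfolding T_def by (intro submod_vimage_mult J M)
      have "r ^ k * m \<in> M" if "m \<in> M" for m using that by (induction k) (auto simp: rM mult.assoc)
      then show "N \<subseteq> T k" unfolding T_def using M by blast
      show "T k \<subseteq> J" unfolding T_def by blast
      show "T k \<subseteq> T (Suc k)" unfolding T_def by (auto simp: rM mult.assoc)
    qed blast
    have "submod E {t \<in> J. r * t \<in> M}" by (intro submod_vimage_mult J M)
    moreover have "M \<subset> {t \<in> J. r * t \<in> M}" using \<open>t \<notin> M\<close> t M(3) rM by blast
    ultimately have rj: "r * j \<in> M" using max by blast
    obtain s where s: "s \<in> J" "j - r ^ k * s \<in> M" using j_div \<Gamma>(2)[OF r] by blast
    have "r * (r ^ k * s) \<in> M"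
      using submod_diff[OF M(1) rj rM[OF s(2)]] by (simp add: algebra_simps)
    then have "s \<in> T (Suc k)" unfolding T_def using s by (simp add: mult.assoc)
    then have "s \<in> T k" using k[of "Suc k"] by simp
    then have "r ^ k * s \<in> M" unfolding T_def by simp
    then show False using submod_add[OF M(1) s(2), of "r ^ k * s"] M(4) by simp
  qed
  have "\<forall>k. \<exists>t\<in>J. j - r\<^sub>0 ^ k * t \<in> M" using j_div \<Gamma>(2) r\<^sub>0(1) by blast
  then obtain t where t: "\<And>k. t k \<in> J" "\<And>k. j - r\<^sub>0 ^ k * t k \<in> M" by metis
  have step: "t k - r\<^sub>0 * t (Suc k) \<in> M" for k
  proof (rule inj[of "r\<^sub>0 ^ k"])
    show "r\<^sub>0 ^ k \<in> \<Gamma>" using \<Gamma>(2) r\<^sub>0(1) by blast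
    have "r\<^sub>0 * t (Suc k) \<in> J" using span_one_mult[OF _ J t(1)] \<Gamma>(1) r\<^sub>0(1) by blast
    then show "t k - r\<^sub>0 * t (Suc k) \<in> J" using t by (intro submod_diff[OF J])
    show "r\<^sub>0 ^ k * (t k - r\<^sub>0 * t (Suc k)) \<in> M"
      using submod_diff[OF M(1) t(2)[of "Suc k"] t(2)[of k]] by (simp add: algebra_simps)
  qed
  \<comment> \<open>Dividing \<open>j\<close> by higher and higher powers of
    \<open>r\<^sub>0\<close> gives an ascending chain of cyclic submodules. Where it stops,
    \<open>t (Suc k)\<close> is a multiple of \<open>t k\<close> modulo \<open>M\<close>, so it is
    killed by some \<open>1 - s * r\<^sub>0\<close>.\<close>
  define S where "S k = span E {t k} + M" for k
  obtain k where k: "\<And>m. m \<ge> k \<Longrightarrow> S m = S k"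
  proof (rule noetherian_betweenD[OF noe, of S])
    fix k
    show S: "submod E (S k)" for k unfolding S_def by (intro submod_plus submod_span M)
    have MS: "M \<subseteq> S k" for k unfolding S_def by (rule subset_plusR[OF submod_span])
    then show "N \<subseteq> S k" using M by blast
    show "S k \<subseteq> J" unfolding S_def
      using t by (intro plus_minimal[OF J] span_minimal[OF J] M) auto
    have "t (Suc k) \<in> span E {t (Suc k)}" by (rule span_base) simp
    also have "\<dots> \<subseteq> S (Suc k)" unfolding S_def by (rule subset_plusL[OF M(1)])
    finally have "r\<^sub>0 * t (Suc k) \<in> S (Suc k)"
      using span_one_mult[OF _ S] \<Gamma>(1) r\<^sub>0(1) by blast
    moreover have "t k - r\<^sub>0 * t (Suc k) \<in> S (Suc k)" using step MS by blast
    ultimately have "t k \<in> S (Suc k)" using submod_add[OF S] by fastforce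
    then show "S k \<subseteq> S (Suc k)" unfolding S_def[of k]
      by (intro plus_minimal[OF S] span_minimal[OF S] MS) auto
  qed blast
  have "t (Suc k) \<in> span E {t (Suc k)}" by (rule span_base) simp
  also have "\<dots> \<subseteq> S (Suc k)" unfolding S_def by (rule subset_plusL[OF M(1)])
  also have "\<dots> = S k" by (rule k) simp
  finally obtain c m where c: "t (Suc k) = c + m" "c \<in> span E {t k}" "m \<in> M"
    unfolding S_def by (rule set_plus_elim)
  then obtain s where s: "t (Suc k) = s * t k + m" "s \<in> span E {1}" "m \<in> M"
    using span_singleton[of E "t k"] by blast
  have "s * (t k - r\<^sub>0 * t (Suc k)) \<in> M" by (intro span_one_mult[OF _ M(1)] s step)
  from submod_add[OF M(1) this s(3)] have "(1 - s * r\<^sub>0) * t (Suc k) \<in> M"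
    using s(1) by (simp add: algebra_simps)
  then have "t (Suc k) \<in> M" using inj[OF r\<^sub>0(2)[OF s(2)] t(1)] by blast
  then have "r\<^sub>0 ^ Suc k * t (Suc k) \<in> M"
    using span_one_mult[OF _ M(1)] \<Gamma> r\<^sub>0(1) by blast
  then show False
    using submod_add[OF M(1) t(2)[of "Suc k"], of "r\<^sub>0 ^ Suc k * t (Suc k)"] M(4) by simp
qed

section \<open>Finite separability\<close>

definition finite_index :: "'r::comm_ring_1 set \<Rightarrow> 'r set \<Rightarrow> bool"
  where "finite_index B Q \<longleftrightarrow> (\<exists>S. finite S \<and> S \<subseteq> B \<and> (\<forall>b\<in>B. \<exists>s\<in>S. b - s \<in> Q))"

text \<open>Finite separability of the ring \<open>B / I\<close>.\<close>

definition fin_sep :: "'r::comm_ring_1 set \<Rightarrow> 'r set \<Rightarrow> bool"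
  where "fin_sep I B \<longleftrightarrow>
    (\<forall>A. \<forall>a\<in>B. submod A A \<and> I \<subseteq> A \<and> A \<subseteq> B \<and> a \<notin> A \<longrightarrow>
      (\<exists>Q. submod B Q \<and> I \<subseteq> Q \<and> Q \<subseteq> B \<and> finite_index B Q \<and> a \<notin> A + Q))"

lemma fin_sepD:
  assumes "fin_sep I B" "submod A A" "I \<subseteq> A" "A \<subseteq> B" "a \<in> B" "a \<notin> A"
  obtains Q where "submod B Q" "I \<subseteq> Q" "Q \<subseteq> B" "finite_index B Q" "a \<notin> A + Q"
proof -
  have "\<exists>Q. submod B Q \<and> I \<subseteq> Q \<and> Q \<subseteq> B \<and> finite_index B Q \<and> a \<notin> A + Q"
    using assms(1)[unfolded fin_sep_def, rule_format, OF assms(5), of A] assms(2-) by simp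
  then show thesis using that by blast
qed

section \<open>Permanence properties of finite index and separability\<close>

lemma finite_index_mono: "finite_index B Q \<Longrightarrow> Q \<subseteq> Q' \<Longrightarrow> finite_index B Q'"
  unfolding finite_index_def by (meson subsetD)

lemma finite_index_subset:
  assumes fin: "finite_index B Q" and "B' \<subseteq> B" and Q: "submod E Q"
  shows "finite_index B' Q"
proof -
  obtain S where S: "finite S" "\<And>b. b \<in> B \<Longrightarrow> \<exists>s\<in>S. b - s \<in> Q"
    using fin unfolding finite_index_def by blast
  define S' where "S' = {s \<in> S. \<exists>w\<in>B'. w - s \<in> Q}"
  have "\<forall>s\<in>S'. \<exists>w\<in>B'. w - s \<in> Q" unfolding S'_def by blast
  then obtain f where f: "\<And>s. s \<in> S' \<Longrightarrow> f s \<in> B'" "\<And>s. s \<in> S' \<Longrightarrow> f s - s \<in> Q" by metis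
  have "\<exists>t\<in>f ` S'. w - t \<in> Q" if w: "w \<in> B'" for w
  proof -
    obtain s where s: "s \<in> S" "w - s \<in> Q" using S(2) w assms(2) by blast
    then have "s \<in> S'" unfolding S'_def using w by blast
    then have "w - f s \<in> Q" using submod_diff[OF Q s(2) f(2)[of s]] by simp
    then show ?thesis using \<open>s \<in> S'\<close> by blast
  qed
  moreover have "finite (f ` S')" "f ` S' \<subseteq> B'" using S(1) f(1) by (auto simp: S'_def)
  ultimately show ?thesis unfolding finite_index_def by blast
qed

text \<open>Pigeonhole on the powers with exponent at least 1, since \<open>B\<close> need not
  contain an identity; hence \<open>m > 0\<close>.\<close>

lemma finite_index_powers:
  assumes "finite_index B Q" "submod B B" "submod B Q" "b \<in> B"
  obtains m d where "m > 0" "d > 0" "b ^ (m + d) - b ^ m \<in> Q"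
proof -
  obtain S where S: "finite S" "\<And>b. b \<in> B \<Longrightarrow> \<exists>s\<in>S. b - s \<in> Q"
    using assms(1) unfolding finite_index_def by blast
  have pow: "b ^ Suc k \<in> B" for k using assms(2,4) by (induction k) (auto intro: submod_mult)
  have "\<forall>k. \<exists>s\<in>S. b ^ Suc k - s \<in> Q" using S(2) pow by blast
  then obtain f where f: "\<And>k. f k \<in> S" "\<And>k. b ^ Suc k - f k \<in> Q" by metis
  have "\<not> inj f" using finite_subset[of "range f" S] S(1) f(1) range_inj_infinite by blast
  then obtain k l where kl: "f k = f l" "k < l" unfolding inj_def by (metis linorder_neqE_nat)
  have "b ^ Suc l - b ^ Suc k \<in> Q"
    using submod_diff[OF assms(3) f(2)[of l] f(2)[of k]] kl by (simp del: power_Suc)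
  then show thesis using that[of "Suc k" "l - k"] kl by simp
qed

text \<open>\<open>A\<close> contains \<open>I'\<close>, so enlarging \<open>Q\<close> to
  \<open>Q + I'\<close> does not enlarge \<open>A + Q\<close>.\<close>

lemma fin_sep_mono:
  assumes "fin_sep I B" "submod B I'" "I \<subseteq> I'" "I' \<subseteq> B" "submod B B"
  shows "fin_sep I' B"
  unfolding fin_sep_def
proof (intro allI ballI impI)
  fix A a assume a: "a \<in> B" and A: "submod A A \<and> I' \<subseteq> A \<and> A \<subseteq> B \<and> a \<notin> A"
  then obtain Q where Q: "submod B Q" "I \<subseteq> Q" "Q \<subseteq> B" "finite_index B Q" "a \<notin> A + Q"
    using fin_sepD[OF assms(1), of A a] assms(3) by (metis subset_trans)
  have "a \<notin> A + (Q + I')"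
  proof
    assume "a \<in> A + (Q + I')"
    then obtain b q i where "a = b + (q + i)" "b \<in> A" "q \<in> Q" "i \<in> I'"
      by (blast elim!: set_plus_elim)
    moreover from this have "b + i \<in> A" using A submod_add[of A A b i] by blast
    ultimately have "a \<in> A + Q" using set_plus_intro[of "b + i" A q Q]
      by (simp add: algebra_simps)
    then show False using Q by blast
  qed
  moreover have "I' \<subseteq> Q + I'" "Q \<subseteq> Q + I'"
    by (rule subset_plusR[OF Q(1)], rule subset_plusL[OF assms(2)])
  moreover have "Q + I' \<subseteq> B" using Q assms by (intro plus_minimal)
  ultimately show "\<exists>Q. submod B Q \<and> I' \<subseteq> Q \<and> Q \<subseteq> B \<and> finite_index B Q \<and> a \<notin> A + Q"
    using submod_plus[OF Q(1) assms(2)] finite_index_mono[OF Q(4)] by blast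
qed

text \<open>A separating ideal of the larger ring, cut down to \<open>B\<close>, still has finite
  index, and the sum with \<open>A\<close> only shrinks.\<close>

lemma fin_sep_subset:
  assumes fs: "fin_sep I U" and B: "submod B B" "B \<subseteq> U" "I \<subseteq> B"
  shows "fin_sep I B"
  unfolding fin_sep_def
proof (intro allI ballI impI)
  fix A a assume a: "a \<in> B" and A: "submod A A \<and> I \<subseteq> A \<and> A \<subseteq> B \<and> a \<notin> A"
  then have A': "submod A A" "I \<subseteq> A" "A \<subseteq> U" "a \<in> U" "a \<notin> A" using B(2) by auto
  obtain Q where Q: "submod U Q" "I \<subseteq> Q" "Q \<subseteq> U" "finite_index U Q" "a \<notin> A + Q"
    by (rule fin_sepD[OF fs A'])
  have BQ: "submod B Q" by (rule submod_antimono[OF Q(1) B(2)])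
  obtain S where S: "finite S" "S \<subseteq> B" "\<And>b. b \<in> B \<Longrightarrow> \<exists>s\<in>S. b - s \<in> Q"
    using finite_index_subset[OF Q(4) B(2) Q(1)] unfolding finite_index_def by blast
  then have "\<exists>s\<in>S. b - s \<in> Q \<inter> B" if "b \<in> B" for b
    using submod_diff[OF B(1) that] that by blast
  then have "finite_index B (Q \<inter> B)" unfolding finite_index_def using S(1,2) by blast
  moreover have "A + (Q \<inter> B) \<subseteq> A + Q" by (rule set_plus_mono2) auto
  then have "a \<notin> A + (Q \<inter> B)" using Q(5) by blast
  ultimately show "\<exists>Q. submod B Q \<and> I \<subseteq> Q \<and> Q \<subseteq> B \<and> finite_index B Q \<and> a \<notin> A + Q"
    using submod_Int[OF BQ B(1)] Q(2) B(3) by blast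
qed

lemma fin_sep_dense:
  assumes fs: "fin_sep I B" and B: "submod B B" and I': "submod B I'" "I \<subseteq> I'" "I' \<subseteq> B"
    and A: "submod A A" "I' \<subseteq> A" "A \<subseteq> B" and a: "a \<in> B"
    and dense: "\<And>Q. \<lbrakk> submod B Q; I' \<subseteq> Q; Q \<subseteq> B; finite_index B Q \<rbrakk> \<Longrightarrow> a \<in> A + Q"
  shows "a \<in> A"
proof (rule ccontr)
  assume "a \<notin> A"
  then obtain Q where "submod B Q" "I' \<subseteq> Q" "Q \<subseteq> B" "finite_index B Q" "a \<notin> A + Q"
    by (rule fin_sepD[OF fin_sep_mono[OF fs I' B] A a])
  then show False using dense by blast
qed

text \<open>Every term of the binomial expansion contains \<open>a ^ m\<close> or
  \<open>b ^ k\<close>, so the radical of \<open>J\<close> is closed under addition.\<close>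

lemma power_add_mem:
  assumes T: "submod T T" "1 \<in> T" and J: "submod T J"
    and "a \<in> T" "b \<in> T" "a ^ m \<in> J" "b ^ k \<in> J"
  shows "(a + b) ^ (m + k) \<in> J"
proof -
  have pow: "c ^ i \<in> T" if "c \<in> T" for c i
    using that T by (induction i) (auto intro: submod_mult)
  have J_pow: "c ^ i \<in> J" if "c ^ l \<in> J" "l \<le> i" "c \<in> T" for c l i
    using submod_mult[OF J pow[OF that(3), of "i - l"] that(1)] that(2) by (simp flip: power_add)
  have "of_nat (m + k choose i) * a ^ i * b ^ (m + k - i) \<in> J" if "i \<le> m + k" for i
  proof (cases "m \<le> i")
    case True
    then have "b ^ (m + k - i) * a ^ i \<in> J" using assms J_pow pow
      by (intro submod_mult[OF J]) blast+
    from submod_of_nat[OF J this, of "m + k choose i"] show ?thesis by (simp add: mult_ac)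
  next
    case False
    then have "a ^ i * b ^ (m + k - i) \<in> J"
      using assms J_pow[of b k "m + k - i"] pow by (intro submod_mult[OF J]) auto
    from submod_of_nat[OF J this, of "m + k choose i"] show ?thesis by (simp add: mult_ac)
  qed
  then show ?thesis unfolding binomial_ring by (intro submod_sum[OF J]) auto
qed

text \<open>Combinations with coefficients in \<open>{0..<d}\<close> represent all cosets: a
  finitely generated abelian group of bounded exponent is finite.\<close>

lemma finite_index_span:
  assumes "finite S" "submod {} I" "(d::int) > 0" "\<And>s. s \<in> S \<Longrightarrow> of_int d * s \<in> I"
  shows "finite_index (span {} (S \<union> I)) I"
  using assms(1,4)
proof (induction S rule: finite_induct)
  case empty
  have "span {} ({} \<union> I) = I" using assms(2) by (simp add: hull_same)
  then show ?case unfolding finite_index_def using submod_0[OF assms(2)]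
    by (intro exI[of _ "{0}"]) auto
next
  case (insert s S)
  then obtain R where R: "finite R" "R \<subseteq> span {} (S \<union> I)"
    "\<And>b. b \<in> span {} (S \<union> I) \<Longrightarrow> \<exists>r\<in>R. b - r \<in> I"
    unfolding finite_index_def by auto
  let ?B = "span {} (insert s S \<union> I)"
  define R' where "R' = (\<lambda>(k, r). of_int k * s + r) ` ({0..<d} \<times> R)"
  have sub: "span {} (S \<union> I) \<subseteq> ?B" by (intro hull_mono) auto
  have "R' \<subseteq> ?B"
  proof
    fix t assume "t \<in> R'"
    then obtain k r where "t = of_int k * s + r" "r \<in> R" unfolding R'_def by auto
    moreover have "of_int k * s \<in> ?B" by (intro submod_of_int[OF submod_span] span_base) simp
    ultimately show "t \<in> ?B" using R(2) sub by (auto intro: submod_add[OF submod_span])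
  qed
  moreover have "\<exists>t\<in>R'. b - t \<in> I" if "b \<in> ?B" for b
  proof -
    have "b \<in> span {} {s} + span {} (S \<union> I)" using span_insert_subset[of "{}" s "S \<union> I"] that
      by auto
    then obtain n c where n: "b = of_int n * s + c" "c \<in> span {} (S \<union> I)"
      unfolding span_empty_singleton by (auto elim!: set_plus_elim)
    obtain r where r: "r \<in> R" "c - r \<in> I" using R(3) n(2) by blast
    have "of_int (n div d) * (of_int d * s) \<in> I"
      by (intro submod_of_int[OF assms(2)] insert.prems) simp
    moreover have "of_int n * s = of_int (n div d) * (of_int d * s) + of_int (n mod d) * s"
      unfolding mult.assoc[symmetric] of_int_mult[symmetric] distrib_right[symmetric]
        of_int_add[symmetric]
      by (simp add: div_mult_mod_eq)
    ultimately have "b - (of_int (n mod d) * s + r) \<in> I"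
      using submod_add[OF assms(2) r(2), of "of_int (n div d) * (of_int d * s)"] n
      by (simp add: algebra_simps)
    moreover have "of_int (n mod d) * s + r \<in> R'" unfolding R'_def
      using r assms(3) by (auto intro!: image_eqI[of _ _ "(n mod d, r)"])
    ultimately show ?thesis by blast
  qed
  moreover have "finite R'" unfolding R'_def using R by simp
  ultimately show ?case unfolding finite_index_def by blast
qed

section \<open>Integral elements and Zariski's main theorem\<close>

definition integral_mod :: "'r::comm_ring_1 set \<Rightarrow> 'r set \<Rightarrow> 'r \<Rightarrow> bool"
  where "integral_mod E I y \<longleftrightarrow> (\<exists>m. y ^ Suc m \<in> span E ((\<lambda>j. y ^ Suc j) ` {..<m} \<union> I))"

lemma submod_colon: "submod E N \<Longrightarrow> submod E {t. v * t \<in> N}"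
  using submod_vimage_mult[of E UNIV N v] by (simp add: submod_def)

text \<open>The \<int>[E]-module spanned by the powers of \<open>y\<close> with exponents from 1 to
  \<open>m\<close>. The exponent 0 is left out here and in \<open>integral_mod\<close>: there is no
  identity, so an integral equation has no constant term.\<close>

definition pow_span :: "'r::comm_ring_1 set \<Rightarrow> 'r \<Rightarrow> nat \<Rightarrow> 'r set"
  where "pow_span E y m = span E ((\<lambda>j. y ^ Suc j) ` {..<m})"

lemma submod_pow_span: "submod E (pow_span E y m)"
  unfolding pow_span_def by (rule submod_span)

lemma pow_span_mono: "m \<le> n \<Longrightarrow> pow_span E y m \<subseteq> pow_span E y n"
  unfolding pow_span_def by (intro hull_mono) auto

lemma power_mem_pow_span: "j < m \<Longrightarrow> y ^ Suc j \<in> pow_span E y m"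
  unfolding pow_span_def by (rule span_base) (rule imageI, simp)

lemma pow_span_mult:
  assumes "a \<in> pow_span E y m" "b \<in> pow_span E y n"
  shows "a * b \<in> pow_span E y (m + n)"
proof -
  let ?N = "pow_span E y (m + n)"
  have "pow_span E y n \<subseteq> {b. y ^ Suc i * b \<in> ?N}" if "i < m" for i
    unfolding pow_span_def[of E y n]
  proof (rule span_minimal[OF submod_colon[OF submod_pow_span]], intro image_subsetI CollectI)
    fix j assume "j \<in> {..<n}"
    then have "y ^ Suc (Suc (i + j)) \<in> ?N" using that by (intro power_mem_pow_span) auto
    then show "y ^ Suc i * y ^ Suc j \<in> ?N" by (simp add: power_add mult_ac)
  qed
  then have "pow_span E y m \<subseteq> {a. b * a \<in> ?N}"
    unfolding pow_span_def[of E y m] using assms(2)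
    by (intro span_minimal[OF submod_colon[OF submod_pow_span]])
      (auto simp: mult.commute[of b] simp del: power_Suc)
  then show ?thesis using assms(1) by (auto simp: mult.commute)
qed

text \<open>A case of Zariski's main theorem. If \<open>y\<close> satisfies an equation with coefficients
  \<open>a i\<close> generating the unit ideal, then the elements \<open>z i = a n * y ^ (n + 1 - i) + \<dots> + a i * y\<close>
  span a ring, which is profinitely dense at \<open>y\<close>: the localisations at the elements
  \<open>b i = a i + z (i + 1)\<close> contain \<open>y\<close> because \<open>b i * y = z i\<close>, and the \<open>b i\<close> generate the unit
  ideal because \<open>a i = b i - b (i + 1) * y\<close>.\<close>

lemma fin_sep_integral:
  assumes fs: "fin_sep I B"
    and B: "submod B B" and I: "submod B I" "I \<subseteq> B" and E: "E \<subseteq> B" "finite E" and y: "y \<in> B"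
    and a: "\<And>i. a i \<in> span E {1}" and u: "\<And>i. u i \<in> span E {1}"
    and rel: "(\<Sum>i\<le>n. a i * y ^ Suc i) \<in> I"
    and unit: "\<And>t. t \<in> B \<Longrightarrow> t - (\<Sum>i\<le>n. u i * a i) * t \<in> I"
  shows "integral_mod E I y"
proof -
  have EB: "submod E B" and EI: "submod E I"
    using submod_antimono[OF B E(1)] submod_antimono[OF I(1) E(1)] .
  have pow_B: "y ^ Suc j \<in> B" for j using y by (induction j) (auto intro: submod_mult[OF B])
  define z where "z i = (\<Sum>l\<in>{i..n}. a l * y ^ (Suc l - i))" for i
  have z_B: "z i \<in> B" for i unfolding z_def
  proof (intro submod_sum[OF EB])
    fix l assume "l \<in> {i..n}"
    then have "Suc l - i = Suc (l - i)" by auto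
    then show "a l * y ^ (Suc l - i) \<in> B" using span_one_mult[OF a EB pow_B] by metis
  qed
  have z_gt: "z i = 0" if "i > n" for i unfolding z_def using that by simp
  have z_Suc: "z i = y * (z (Suc i) + a i)" if "i \<le> n" for i
  proof -
    have "z i = a i * y + (\<Sum>l\<in>{Suc i..n}. a l * y ^ (Suc l - i))"
      unfolding z_def using that by (simp add: sum.atLeast_Suc_atMost)
    also have "(\<Sum>l\<in>{Suc i..n}. a l * y ^ (Suc l - i)) = y * z (Suc i)"
      unfolding z_def sum_distrib_left
      by (intro sum.cong) (auto simp: Suc_diff_le mult_ac)
    finally show ?thesis by (simp add: algebra_simps)
  qed
  have z_0: "z 0 \<in> I" using rel unfolding z_def by (simp add: atMost_atLeast0)
  define C where "C = span E (z ` {..n} \<union> I)"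
  have C_sub: "submod E C" unfolding C_def by (rule submod_span)
  have IC: "I \<subseteq> C" unfolding C_def by (auto intro: span_base)
  have CB: "C \<subseteq> B" unfolding C_def using z_B I by (intro span_minimal[OF EB]) auto
  have z_C: "z i \<in> C" for i
  proof (cases "i \<le> n")
    case True
    then show ?thesis unfolding C_def by (intro span_base) auto
  next
    case False
    then show ?thesis using z_gt submod_0[OF C_sub] by simp
  qed
  \<comment> \<open>The relation
    \<open>z (i + 1) * z j = z i * z (j + 1) + a j * z i - a i * z j\<close> lowers the first index
    until \<open>z 0\<close>, which lies in \<open>I\<close>, is reached.\<close>
  have zz: "z i * z j \<in> C" for i j
  proof (cases "i \<le> n")
    case False
    then show ?thesis using z_gt submod_0[OF C_sub] by simp
  next
    case True
    then show ?thesis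
    proof (induction i arbitrary: j)
      case 0
      then show ?case using submod_mult[OF I(1) z_B z_0, of j] IC by (auto simp: mult.commute)
    next
      case (Suc i)
      show ?case
      proof (cases "j \<le> n")
        case False
        then show ?thesis using z_gt submod_0[OF C_sub] by simp
      next
        case True
        have "z (Suc i) * z j = (y * z (Suc i)) * (z (Suc j) + a j)"
          unfolding z_Suc[OF True] by (simp add: algebra_simps)
        also have "y * z (Suc i) = z i - a i * y"
          using z_Suc[of i] Suc.prems by (simp add: algebra_simps)
        also have "(z i - a i * y) * (z (Suc j) + a j) = z i * z (Suc j) + a j * z i - a i * z j"
          unfolding z_Suc[OF True] by (simp add: algebra_simps)
        also have "\<dots> \<in> C"
          using Suc by (intro submod_diff[OF C_sub] submod_add[OF C_sub] span_one_mult[OF a C_sub] z_C) auto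
        finally show ?thesis .
      qed
    qed
  qed
  have zC: "z i * c \<in> C" if "c \<in> C" for i c
  proof -
    have "C \<subseteq> {c. z i * c \<in> C}"
    proof (subst (1) C_def, rule span_minimal)
      show "submod E {c. z i * c \<in> C}"
        by (rule submod_colon[OF C_sub])
      show "z ` {..n} \<union> I \<subseteq> {c. z i * c \<in> C}"
        using zz submod_mult[OF I(1) z_B] IC by auto
    qed
    then show ?thesis using that by blast
  qed
  have CC: "submod C C"
  proof (rule submodI)
    fix c d assume "c \<in> C" "d \<in> C"
    have "C \<subseteq> {c. c * d \<in> C}"
    proof (subst (1) C_def, rule span_minimal)
      show "submod E {c. c * d \<in> C}"
        using submod_colon[OF C_sub, of d] by (simp add: mult.commute)
      have "i * d \<in> C" if "i \<in> I" for i
        using submod_mult[OF I(1) _ that, of d] IC CB \<open>d \<in> C\<close> by (auto simp: mult.commute)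
      then show "z ` {..n} \<union> I \<subseteq> {c. c * d \<in> C}" using zC \<open>d \<in> C\<close> by auto
    qed
    then show "c * d \<in> C" using \<open>c \<in> C\<close> by blast
  qed (use submod_0[OF C_sub] submod_diff[OF C_sub] in auto)
  define b where "b i = a i + z (Suc i)" for i
  have bC: "b i * c \<in> C" if "c \<in> C" for i c
    unfolding b_def distrib_right
    using that by (intro submod_add[OF C_sub] span_one_mult[OF a C_sub] zC)
  have by_z: "b i * y = z i" if "i \<le> n" for i
    unfolding b_def z_Suc[OF that] by (simp add: algebra_simps)
  have z_pow: "z i ^ Suc j \<in> C" for i j by (induction j) (auto intro: z_C zC)
  have b_pow_y: "b i ^ D * y ^ Suc j \<in> C" if "j < D" "i \<le> n" for i j D
  proof -
    have "b i ^ D = b i ^ (D - Suc j) * b i ^ Suc j"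
      using that by (simp flip: power_add del: power_Suc)
    then have "b i ^ D * y ^ Suc j = b i ^ (D - Suc j) * z i ^ Suc j"
      by (simp add: mult.assoc by_z[OF that(2), symmetric] power_mult_distrib del: power_Suc)
    moreover have "b i ^ k * c \<in> C" if "c \<in> C" for k c
      using that by (induction k) (auto simp: mult.assoc bC)
    ultimately show ?thesis using z_pow by simp
  qed
  have "y \<in> C"
  proof (rule ccontr)
    assume "y \<notin> C"
    then obtain Q where Q: "submod B Q" "I \<subseteq> Q" "Q \<subseteq> B" "finite_index B Q" "y \<notin> C + Q"
      using fin_sepD[OF fs CC IC CB y] by metis
    have EQ: "submod E Q" using submod_antimono[OF Q(1) E(1)] .
    \<comment> \<open>\<open>B'\<close> is the set of multiples of \<open>y\<close> in \<int>[E][y].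
      Finitely many of them represent \<open>B'\<close> modulo \<open>Q\<close>, so a single bound
      \<open>D\<close> on the degree in \<open>y\<close> will do.\<close>
    define B' where "B' = span (insert y E) {y}"
    have B'_sub: "submod (insert y E) B'" unfolding B'_def by (rule submod_span)
    have EB': "submod E B'" using submod_antimono[OF B'_sub] by blast
    have B'B: "B' \<subseteq> B" unfolding B'_def using submod_antimono[OF B, of "insert y E"] E y
      by (intro span_minimal) auto
    define T where "T = pow_span E y"
    have T_sub: "submod E (T D)" and T_mono: "D \<le> D' \<Longrightarrow> T D \<subseteq> T D'" for D D'
      unfolding T_def by (rule submod_pow_span, rule pow_span_mono)
    have T_y: "y * t \<in> T (Suc D)" if "t \<in> T D" for t D
      using pow_span_mult[OF power_mem_pow_span[of 0 1] that[unfolded T_def]] unfolding T_def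
      by simp
    have "B' \<subseteq> (\<Union>D. T D)" unfolding B'_def
    proof (rule span_minimal)
      have "y \<in> T 1" using power_mem_pow_span[of 0 1 y E] unfolding T_def by simp
      then show "{y} \<subseteq> (\<Union>D. T D)" by blast
      show "submod (insert y E) (\<Union>D. T D)"
      proof (rule submodI)
        show "0 \<in> (\<Union>D. T D)" using submod_0[OF T_sub] by auto
      next
        fix s t assume "s \<in> (\<Union>D. T D)" "t \<in> (\<Union>D. T D)"
        then obtain D D' where "s \<in> T D" "t \<in> T D'" by blast
        then have "s \<in> T (max D D')" "t \<in> T (max D D')"
          using T_mono by (meson max.cobounded1 max.cobounded2 subsetD)+
        then show "s - t \<in> (\<Union>D. T D)" using submod_diff[OF T_sub] by blast
      next
        fix e t assume "e \<in> insert y E" "t \<in> (\<Union>D. T D)"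
        then show "e * t \<in> (\<Union>D. T D)" using T_y submod_mult[OF T_sub] by blast
      qed
    qed
    moreover obtain S where S: "finite S" "S \<subseteq> B'" "\<And>w. w \<in> B' \<Longrightarrow> \<exists>s\<in>S. w - s \<in> Q"
      using finite_index_subset[OF Q(4) B'B EQ] unfolding finite_index_def by blast
    ultimately have "\<forall>s\<in>S. \<exists>D. s \<in> T D" by blast
    then obtain \<delta> where \<delta>: "\<And>s. s \<in> S \<Longrightarrow> s \<in> T (\<delta> s)" by metis
    define D where "D = Max (insert 0 (\<delta> ` S))"
    have S_T: "S \<subseteq> T D"
    proof
      fix s assume "s \<in> S"
      then have "\<delta> s \<le> D" unfolding D_def using S(1) by simp
      then show "s \<in> T D" using \<delta>[OF \<open>s \<in> S\<close>] T_mono by blast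
    qed
    \<comment> \<open>The goal \<open>y \<in> C + Q\<close> follows from \<open>1 \<in> J\<close>.
      The multiplier ring \<open>R\<close> acts on \<open>J\<close> and has an identity, which
      \<open>B\<close> may lack.\<close>
    define J where "J = {\<beta>. \<forall>w\<in>B'. \<beta> * w \<in> C + Q}"
    define R where "R = {v. \<forall>w\<in>B'. v * w \<in> B'}"
    have CQ_sub: "submod E (C + Q)" by (rule submod_plus[OF C_sub EQ])
    have R_sub: "submod R R" unfolding R_def
      by (rule submodI) (auto simp: submod_0[OF EB'] left_diff_distrib mult.assoc submod_diff[OF EB'])
    have R_1: "1 \<in> R" unfolding R_def by simp
    have J_sub: "submod R J" unfolding J_def R_def
    proof (rule submodI)
      fix v \<beta> assume "v \<in> {v. \<forall>w\<in>B'. v * w \<in> B'}" "\<beta> \<in> {\<beta>. \<forall>w\<in>B'. \<beta> * w \<in> C + Q}"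
      then have "\<beta> * (v * w) \<in> C + Q" if "w \<in> B'" for w using that by simp
      then show "v * \<beta> \<in> {\<beta>. \<forall>w\<in>B'. \<beta> * w \<in> C + Q}" by (simp add: mult_ac)
    qed (auto simp: submod_0[OF CQ_sub] left_diff_distrib submod_diff[OF CQ_sub])
    have y_R: "y \<in> R" unfolding R_def using submod_mult[OF B'_sub] by blast
    have one_R: "r \<in> R" if "r \<in> span E {1}" for r
      unfolding R_def using span_one_mult[OF that EB'] by blast
    have pow_R: "v ^ k \<in> R" if "v \<in> R" for v k
      using that R_1 by (induction k) (auto intro: submod_mult[OF R_sub])
    have pow_R': "y ^ k \<in> R" for k by (rule pow_R[OF y_R])
    have z_R: "z i \<in> R" for i unfolding z_def
      by (intro submod_sum[OF R_sub] submod_mult[OF R_sub] one_R[OF a] pow_R')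
    have b_R: "b i \<in> R" for i unfolding b_def
      by (intro submod_add[OF R_sub] one_R[OF a] z_R)
    have bQ: "b i * q \<in> Q" if "q \<in> Q" for i q
      unfolding b_def distrib_right
      using that by (intro submod_add[OF EQ] span_one_mult[OF a EQ] submod_mult[OF Q(1) z_B])
    \<comment> \<open>Modulo \<open>Q\<close> all of \<open>B'\<close> has degree at most
      \<open>D\<close> in \<open>y\<close>, and \<open>b i ^ D\<close> clears that many denominators
      because \<open>b i * y = z i\<close> lies in \<open>C\<close>.\<close>
    have b_J: "b i ^ D \<in> J" if "i \<le> n" for i
      unfolding J_def
    proof (intro CollectI ballI)
      fix w assume "w \<in> B'"
      then obtain s where s: "s \<in> S" "w - s \<in> Q" using S(3) by blast
      have "T D \<subseteq> {s. b i ^ D * s \<in> C}" unfolding T_def pow_span_def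
      proof (rule span_minimal)
        show "submod E {s. b i ^ D * s \<in> C}"
          by (rule submod_colon[OF C_sub])
        show "(\<lambda>j. y ^ Suc j) ` {..<D} \<subseteq> {s. b i ^ D * s \<in> C}" using b_pow_y that by blast
      qed
      then have "b i ^ D * s \<in> C" using s S_T by blast
      moreover have "b i ^ k * q \<in> Q" if "q \<in> Q" for k q
        using that by (induction k) (auto simp: mult.assoc bQ)
      then have "b i ^ D * (w - s) \<in> Q" using s by blast
      ultimately have "b i ^ D * s + b i ^ D * (w - s) \<in> C + Q" by (rule set_plus_intro)
      then show "b i ^ D * w \<in> C + Q" by (simp add: algebra_simps)
    qed
    \<comment> \<open>The radical of \<open>J\<close> in \<open>R\<close>. It contains the multiples
      of the \<open>b i\<close>, hence \<open>u i * a i\<close>, hence 1, because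
      \<open>1 - (\<Sum>i\<le>n. u i * a i)\<close> maps \<open>B'\<close> into
      \<open>I\<close>.\<close>
    define P where "P = {r \<in> R. \<exists>k. r ^ k \<in> J}"
    have P_add: "r + s \<in> P" if "r \<in> P" "s \<in> P" for r s
      using that power_add_mem[OF R_sub R_1 J_sub] submod_add[OF R_sub] unfolding P_def by blast
    have bP: "v * b i \<in> P" if "v \<in> R" "i \<le> n" for v i
    proof -
      have "(v * b i) ^ D \<in> J" unfolding power_mult_distrib
        by (intro submod_mult[OF J_sub] pow_R that b_J)
      then show ?thesis unfolding P_def using submod_mult[OF R_sub that(1) b_R] by blast
    qed
    have P_0: "0 \<in> P" unfolding P_def using submod_0[OF R_sub] submod_0[OF J_sub]
      by (auto intro!: exI[of _ 1])
    have P_sum: "sum f Y \<in> P" if "\<And>i. i \<in> Y \<Longrightarrow> f i \<in> P" for f and Y :: "nat set"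
      using that by (induction Y rule: infinite_finite_induct) (auto simp: P_0 P_add)
    have zP: "v * z (Suc i) \<in> P" if "v \<in> R" for v i
    proof (cases "Suc i \<le> n")
      case True
      then have "v * z (Suc i) = (v * y) * b (Suc i)" using by_z by (simp add: mult_ac)
      then show ?thesis using bP[OF submod_mult[OF R_sub that y_R] True] by simp
    next
      case False
      then show ?thesis using z_gt P_0 by simp
    qed
    have "u i * a i \<in> P" if "i \<le> n" for i
    proof -
      have "u i * a i = u i * b i + (- u i) * z (Suc i)" unfolding b_def
        by (simp add: algebra_simps)
      then show ?thesis
        using P_add[OF bP[OF one_R[OF u] that] zP[OF submod_minus[OF R_sub one_R[OF u]]]] by metis
    qed
    then have sum_P: "(\<Sum>i\<le>n. u i * a i) \<in> P" by (intro P_sum) auto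
    have "1 - (\<Sum>i\<le>n. u i * a i) \<in> J" unfolding J_def
    proof (intro CollectI ballI)
      fix w assume "w \<in> B'"
      then have "w - (\<Sum>i\<le>n. u i * a i) * w \<in> I" using unit B'B by blast
      then have "w - (\<Sum>i\<le>n. u i * a i) * w \<in> C + Q" using IC subset_plusL[OF EQ] by blast
      then show "(1 - (\<Sum>i\<le>n. u i * a i)) * w \<in> C + Q" by (simp add: left_diff_distrib)
    qed
    moreover have "1 - (\<Sum>i\<le>n. u i * a i) \<in> R"
      using sum_P R_1 submod_diff[OF R_sub] unfolding P_def by blast
    ultimately have "1 - (\<Sum>i\<le>n. u i * a i) \<in> P" unfolding P_def
      by (auto intro!: exI[of _ 1])
    from P_add[OF this sum_P] have "1 \<in> J" unfolding P_def by auto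
    moreover have "y \<in> B'" unfolding B'_def by (rule span_base) simp
    ultimately have "y \<in> C + Q" unfolding J_def by fastforce
    then show False using Q(5) by blast
  qed
  have y_pow_C: "y ^ Suc j \<in> C" for j
    using \<open>y \<in> C\<close> by (induction j) (auto intro: submod_mult[OF CC])
  \<comment> \<open>\<open>C / I\<close> is a Noetherian \<int>[E]-module containing all powers of
    \<open>y\<close>, so some power depends on the lower ones.\<close>
  have noe: "noetherian_between E I C" unfolding C_def
    by (intro noetherian_between_span_Un E EI) simp
  obtain m where m: "\<And>k. k \<ge> m \<Longrightarrow> span E ((\<lambda>j. y ^ Suc j) ` {..<k} \<union> I) =
    span E ((\<lambda>j. y ^ Suc j) ` {..<m} \<union> I)"
  proof (rule noetherian_betweenD[OF noe, of "\<lambda>m. span E ((\<lambda>j. y ^ Suc j) ` {..<m} \<union> I)"])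
    fix k
    show "span E ((\<lambda>j. y ^ Suc j) ` {..<k} \<union> I) \<subseteq> C"
      using y_pow_C IC by (intro span_minimal[OF C_sub]) auto
    show "span E ((\<lambda>j. y ^ Suc j) ` {..<k} \<union> I) \<subseteq> span E ((\<lambda>j. y ^ Suc j) ` {..<Suc k} \<union> I)"
      by (intro hull_mono) auto
  qed (auto intro: span_base)
  have "y ^ Suc m \<in> span E ((\<lambda>j. y ^ Suc j) ` {..<Suc m} \<union> I)"
    by (rule span_base) auto
  then show ?thesis unfolding integral_mod_def using m[of "Suc m"] by auto
qed

section \<open>Finite modules from integral generators\<close>

abbreviation subalg :: "'r::comm_ring_1 set \<Rightarrow> 'r set"
  where "subalg G \<equiv> (\<lambda>A. submod A A) hull G"

lemma submod_subalg [simp]: "submod (subalg G) (subalg G)"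
  by (rule hull_in) (auto simp: submod_def)

lemma subalg_minimal: "submod A A \<Longrightarrow> G \<subseteq> A \<Longrightarrow> subalg G \<subseteq> A"
  by (rule hull_minimal)

text \<open>Being an ideal can be tested on generators, because the elements that multiply
  \<open>N\<close> into itself form a ring.\<close>

lemma submod_from_generators:
  assumes gen: "B \<subseteq> subalg S + I" and N: "submod S N" "I \<subseteq> N" and I: "submod N I"
  shows "submod B N"
proof (rule submodI)
  fix b n assume "b \<in> B" and n: "n \<in> N"
  then have "b \<in> subalg S + I" using gen by blast
  then obtain s i where b: "b = s + i" "s \<in> subalg S" "i \<in> I" by (rule set_plus_elim)
  have "subalg S \<subseteq> {s. \<forall>n\<in>N. s * n \<in> N}"
    by (rule subalg_minimal, rule submodI)
      (auto simp: submod_0[OF N(1)] left_diff_distrib mult.assoc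
        intro: submod_diff[OF N(1)] submod_mult[OF N(1)])
  then have "s * n \<in> N" using b(2) n by blast
  moreover have "n * i \<in> N" using submod_mult[OF I n b(3)] N(2) by blast
  ultimately show "b * n \<in> N" unfolding b(1) distrib_right mult.commute[of i]
    by (rule submod_add[OF N(1)])
qed (use submod_0[OF N(1)] submod_diff[OF N(1)] in auto)

lemma integral_mod_stable:
  assumes int: "integral_mod E J y" and J: "\<And>i. i \<in> J \<Longrightarrow> y * i \<in> J"
  obtains P where "finite P" "P \<subseteq> range (\<lambda>j. y ^ Suc j)" "y \<in> span E (P \<union> J)"
    "\<forall>w\<in>span E (P \<union> J). y * w \<in> span E (P \<union> J)"
proof -
  obtain m where m: "y ^ Suc m \<in> span E ((\<lambda>j. y ^ Suc j) ` {..<m} \<union> J)"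
    using int unfolding integral_mod_def by blast
  define P where "P = (\<lambda>j. y ^ Suc j) ` {..<m}"
  have pow: "y ^ Suc j \<in> span E (P \<union> J)" if "j \<le> m" for j
  proof (cases "j = m")
    case True
    then show ?thesis using m unfolding P_def by simp
  next
    case False
    then show ?thesis using that unfolding P_def by (intro span_base UnI1 imageI) simp
  qed
  have "span E (P \<union> J) \<subseteq> {w. y * w \<in> span E (P \<union> J)}"
  proof (rule span_minimal[OF submod_colon[OF submod_span]], rule subsetI, rule CollectI)
    fix s assume "s \<in> P \<union> J"
    then consider j where "j < m" "s = y ^ Suc j" | "s \<in> J" unfolding P_def by blast
    then show "y * s \<in> span E (P \<union> J)"
    proof cases
      case (1 j)
      then show ?thesis using pow[of "Suc j"] by simp
    next
      case 2
      then show ?thesis using J by (intro span_base) blast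
    qed
  qed
  then show thesis using that[of P] pow[of 0] unfolding P_def by auto
qed

text \<open>Generators are adjoined one at a time. The intermediate spans are only modules, so
  stability under each generator adjoined so far is carried through the induction.\<close>

lemma integral_imp_finite_span:
  assumes "finite G" and U: "submod (subalg G) J" "J \<subseteq> subalg G" and E: "E \<subseteq> subalg G"
    and int: "\<And>g. g \<in> G \<Longrightarrow> integral_mod E J g"
  obtains S where "finite S" "S \<subseteq> subalg G" "subalg G = span E (S \<union> J)"
proof -
  let ?U = "subalg G"
  have EU: "submod E ?U" using submod_antimono[OF submod_subalg E] .
  have "\<exists>S. finite S \<and> S \<subseteq> ?U \<and>
      (\<forall>g\<in>G'. g \<in> span E (S \<union> J) \<and> (\<forall>h\<in>span E (S \<union> J). g * h \<in> span E (S \<union> J)))"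
    if "finite G'" "G' \<subseteq> G" for G'
    using that
  proof (induction G' rule: finite_induct)
    case empty
    show ?case by (rule exI[of _ "{}"]) simp
  next
    case (insert y G')
    then obtain S where S: "finite S" "S \<subseteq> ?U"
      and G': "\<And>g. g \<in> G' \<Longrightarrow> g \<in> span E (S \<union> J)"
        "\<And>g h. g \<in> G' \<Longrightarrow> h \<in> span E (S \<union> J) \<Longrightarrow> g * h \<in> span E (S \<union> J)"
      by auto
    have yG: "y \<in> ?U" using insert.prems by (auto intro: hull_inc)
    obtain P where P: "finite P" "P \<subseteq> range (\<lambda>j. y ^ Suc j)" "y \<in> span E (P \<union> J)"
      "\<forall>w\<in>span E (P \<union> J). y * w \<in> span E (P \<union> J)"
      by (rule integral_mod_stable[OF int[of y]])
        (use insert.prems yG in \<open>auto intro: submod_mult[OF U(1)]\<close>)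
    \<comment> \<open>\<open>S\<close> and \<open>P\<close> are kept beside the products, since
      without an identity they need not be covered by them.\<close>
    define S' where "S' = S \<union> P \<union> P * S"
    let ?W = "span E (P \<union> J)" and ?H = "span E (S \<union> J)" and ?H' = "span E (S' \<union> J)"
    have "y ^ Suc j \<in> ?U" for j
      using yG by (induction j) (auto intro: submod_mult[OF submod_subalg])
    then have PU: "P \<subseteq> ?U" using P(2) by blast
    then have S'U: "S' \<subseteq> ?U" unfolding S'_def
      using S by (auto elim!: set_times_elim intro: submod_mult[OF submod_subalg])
    have HU: "?H \<subseteq> ?U" using S U by (intro span_minimal[OF EU]) auto
    have HH': "?H \<subseteq> ?H'" and WH': "?W \<subseteq> ?H'" unfolding S'_def by (intro hull_mono; auto)+
    have SH: "s \<in> ?H" if "s \<in> S" for s using that by (intro span_base) simp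
    have UJ: "v * i \<in> ?H'" if "v \<in> ?U" "i \<in> J" for v i
      using submod_mult[OF U(1) that] by (intro span_base) simp
    note minimal = span_minimal[OF submod_colon[OF submod_span]]
    have PH: "w * h \<in> ?H'" if w: "w \<in> P" and h: "h \<in> ?H" for w h
    proof -
      have "w * s \<in> ?H'" if "s \<in> S" for s
        using set_times_intro[OF w that] unfolding S'_def by (intro span_base) simp
      then have "?H \<subseteq> {h. w * h \<in> ?H'}" using UJ PU w by (intro minimal) blast
      then show ?thesis using h by blast
    qed
    have WH: "w * h \<in> ?H'" if w: "w \<in> ?W" and h: "h \<in> ?H" for w h
    proof -
      have "?W \<subseteq> {w. h * w \<in> ?H'}"
        using PH[OF _ h] UJ[of h] HU h by (intro minimal) (auto simp: mult.commute[of h])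
      then show ?thesis using w by (auto simp: mult.commute)
    qed
    have stable: "g * h \<in> ?H'" if g: "g \<in> ?U" and h: "h \<in> ?H'"
      and gP: "\<And>w. w \<in> P \<Longrightarrow> g * w \<in> ?H'" and gS: "\<And>s. s \<in> S \<Longrightarrow> g * s \<in> ?H'"
      and gPS: "\<And>w s. w \<in> P \<Longrightarrow> s \<in> S \<Longrightarrow> g * (w * s) \<in> ?H'" for g h
    proof -
      have "?H' \<subseteq> {h. g * h \<in> ?H'}"
        using gP gS gPS UJ[OF g] by (intro minimal) (auto simp: S'_def elim!: set_times_elim)
      then show ?thesis using h by blast
    qed
    have PW: "w \<in> ?W" if "w \<in> P" for w using that by (intro span_base) simp
    have new: "y * h \<in> ?H'" if "h \<in> ?H'" for h
    proof (rule stable[OF yG that])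
      show "y * w \<in> ?H'" if "w \<in> P" for w using P(4) PW[OF that] WH' by blast
      show "y * s \<in> ?H'" if "s \<in> S" for s by (rule WH[OF P(3) SH[OF that]])
      show "y * (w * s) \<in> ?H'" if "w \<in> P" "s \<in> S" for w s
        using WH[of "y * w" s] P(4) PW[OF that(1)] SH[OF that(2)] by (simp add: mult.assoc)
    qed
    have old: "g * h \<in> ?H'" if g: "g \<in> G'" and h: "h \<in> ?H'" for g h
    proof (rule stable[OF _ h])
      show "g \<in> ?U" using HU G'(1)[OF g] by blast
      show "g * w \<in> ?H'" if "w \<in> P" for w
        using PH[OF that G'(1)[OF g]] by (simp add: mult.commute)
      show "g * s \<in> ?H'" if "s \<in> S" for s using G'(2)[OF g SH[OF that]] HH' by blast
      show "g * (w * s) \<in> ?H'" if "w \<in> P" "s \<in> S" for w s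
        using PH[OF that(1) G'(2)[OF g SH[OF that(2)]]] by (simp add: mult.left_commute)
    qed
    have "finite S'" unfolding S'_def using S P(1) by (simp add: finite_set_times)
    moreover have "y \<in> ?H'" using P(3) WH' by blast
    ultimately show ?case using S'U old new G'(1) HH' by (intro exI[of _ S']) auto
  qed
  from this[OF assms(1) order.refl] obtain S where S: "finite S" "S \<subseteq> ?U"
    and g: "\<And>g. g \<in> G \<Longrightarrow> g \<in> span E (S \<union> J)"
      "\<And>g h. g \<in> G \<Longrightarrow> h \<in> span E (S \<union> J) \<Longrightarrow> g * h \<in> span E (S \<union> J)"
    by blast
  let ?H = "span E (S \<union> J)"
  have "?U \<subseteq> {u \<in> ?H. \<forall>h\<in>?H. u * h \<in> ?H}"
    by (rule subalg_minimal, rule submodI)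
      (auto simp: submod_0[OF submod_span] submod_diff[OF submod_span] left_diff_distrib mult.assoc g)
  moreover have "?H \<subseteq> ?U" using S U by (intro span_minimal[OF EU]) auto
  ultimately show thesis using that S by blast
qed

section \<open>Polynomial relations\<close>

text \<open>Interpreted for \<open>of_int\<close> and then for the evaluation of integer polynomials
  at \<open>x\<close>, so that relations over \<int> and over \<int>[x] are treated alike.\<close>

locale coeff_hom =
  fixes \<phi> :: "'b::comm_ring_1 \<Rightarrow> 'r::comm_ring_1"
  assumes hom_0: "\<phi> 0 = 0" and hom_1: "\<phi> 1 = 1"
    and hom_add: "\<phi> (a + b) = \<phi> a + \<phi> b" and hom_mult: "\<phi> (a * b) = \<phi> a * \<phi> b"
begin

lemma poly_map_pCons: "poly (map_poly \<phi> (pCons a q)) y = \<phi> a + y * poly (map_poly \<phi> q) y"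
  by (simp add: map_poly_pCons hom_0)

lemma poly_map_add:
  "poly (map_poly \<phi> (q + r)) y = poly (map_poly \<phi> q) y + poly (map_poly \<phi> r) y"
  by (induction q r rule: poly_induct2) (auto simp: poly_map_pCons hom_add algebra_simps)

lemma poly_map_smult: "poly (map_poly \<phi> (smult a q)) y = \<phi> a * poly (map_poly \<phi> q) y"
  by (induction q) (auto simp: poly_map_pCons hom_mult algebra_simps)

lemma poly_map_mult:
  "poly (map_poly \<phi> (q * r)) y = poly (map_poly \<phi> q) y * poly (map_poly \<phi> r) y"
  by (induction q)
    (auto simp: poly_map_pCons poly_map_add poly_map_smult hom_0 algebra_simps)

lemma poly_map_minus: "poly (map_poly \<phi> (- q)) y = - poly (map_poly \<phi> q) y"
  using poly_map_add[of q "- q" y] by (simp add: eq_neg_iff_add_eq_0 add.commute)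

lemma poly_map_diff:
  "poly (map_poly \<phi> (q - r)) y = poly (map_poly \<phi> q) y - poly (map_poly \<phi> r) y"
  using poly_map_add[of q "- r" y] by (simp add: poly_map_minus)

lemma hom_diff: "\<phi> (a - b) = \<phi> a - \<phi> b"
  using hom_add[of "a - b" b] by simp

lemma hom_power: "\<phi> (a ^ n) = \<phi> a ^ n"
  by (induction n) (auto simp: hom_1 hom_mult)

lemma poly_map_1: "poly (map_poly \<phi> 1) y = 1"
  by (simp add: hom_1 hom_0)

lemma poly_map_power: "poly (map_poly \<phi> (q ^ k)) y = poly (map_poly \<phi> q) y ^ k"
  by (induction k) (auto simp: poly_map_1 poly_map_mult)

lemma poly_map_sum:
  "poly (map_poly \<phi> (sum f Y)) y = (\<Sum>i\<in>Y. poly (map_poly \<phi> (f i)) y)"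
  by (induction Y rule: infinite_finite_induct) (auto simp: poly_map_add)

lemma poly_map_monom: "poly (map_poly \<phi> (monom a k)) y = \<phi> a * y ^ k"
  by (simp add: map_poly_monom hom_0 poly_monom)

lemma poly_map_altdef:
  "poly (map_poly \<phi> q) y = (\<Sum>i\<le>degree q. \<phi> (coeff q i) * y ^ i)"
proof -
  have "poly (map_poly \<phi> q) y = poly (map_poly \<phi> (\<Sum>i\<le>degree q. monom (coeff q i) i)) y"
    by (simp add: poly_as_sum_of_monoms)
  then show ?thesis by (simp only: poly_map_sum poly_map_monom)
qed

lemmas poly_map_simps = poly_map_pCons poly_map_add poly_map_smult poly_map_mult poly_map_minus
  poly_map_diff poly_map_1 poly_map_power poly_map_monom hom_0 hom_1

end

interpretation int_hom: coeff_hom "of_int :: int \<Rightarrow> 'r::comm_ring_1"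
  by unfold_locales auto

abbreviation ipoly :: "int poly \<Rightarrow> 'r::comm_ring_1 \<Rightarrow> 'r"
  where "ipoly q x \<equiv> poly (map_poly of_int q) x"

interpretation ipoly_hom: coeff_hom "\<lambda>q. ipoly q x"
  by unfold_locales (auto simp: int_hom.poly_map_simps simp del: map_poly_1)

lemma span_ipoly: "span {x} {1} = range (\<lambda>q. ipoly q x)"
proof
  show "span {x} {1} \<subseteq> range (\<lambda>q. ipoly q x)"
  proof (rule span_minimal, rule submodI)
    have "ipoly 0 x = 0" "ipoly 1 x = 1" by (auto simp: int_hom.poly_map_1 simp del: map_poly_1)
    then show "0 \<in> range (\<lambda>q. ipoly q x)" "{1} \<subseteq> range (\<lambda>q. ipoly q x)"
      by (metis rangeI, metis empty_subsetI insert_subset rangeI)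
    show "a - b \<in> range (\<lambda>q. ipoly q x)"
      if "a \<in> range (\<lambda>q. ipoly q x)" "b \<in> range (\<lambda>q. ipoly q x)" for a b
      using that by (auto simp flip: int_hom.poly_map_diff)
    have "x * ipoly q x = ipoly (pCons 0 q) x" for q by (simp add: int_hom.poly_map_simps)
    then show "e * a \<in> range (\<lambda>q. ipoly q x)" if "e \<in> {x}" "a \<in> range (\<lambda>q. ipoly q x)" for e a
      using that by auto
  qed
  have "ipoly q x \<in> span {x} {1}" for q
  proof (induction q)
    case 0
    then show ?case by (simp add: submod_0[OF submod_span])
  next
    case (pCons a q)
    have "of_int a * 1 \<in> span {x} {1}" by (intro submod_of_int[OF submod_span] span_base) simp
    then show ?case using pCons
      by (auto simp: int_hom.poly_map_pCons
        intro!: submod_add[OF submod_span] submod_mult[OF submod_span])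
  qed
  then show "range (\<lambda>q. ipoly q x) \<subseteq> span {x} {1}" by blast
qed

lemma ipoly_mem: "submod E N \<Longrightarrow> x \<in> E \<Longrightarrow> n \<in> N \<Longrightarrow> ipoly q x * n \<in> N"
  using span_one_mult[of "ipoly q x" "{x}" N n] submod_antimono[of E N "{x}"]
  by (auto simp: span_ipoly)

lemma subalg_singleton: "t \<in> subalg {y} \<Longrightarrow> \<exists>q. t = y * ipoly q y"
proof -
  have "subalg {y} \<subseteq> range (\<lambda>q. y * ipoly q y)"
  proof (rule subalg_minimal, rule submodI)
    show "0 \<in> range (\<lambda>q. y * ipoly q y)" by (rule range_eqI[of _ _ 0]) simp
    show "{y} \<subseteq> range (\<lambda>q. y * ipoly q y)"
      by (auto intro!: range_eqI[of _ _ 1] simp: int_hom.poly_map_1 simp del: map_poly_1)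
    show "a - b \<in> range (\<lambda>q. y * ipoly q y)"
      if "a \<in> range (\<lambda>q. y * ipoly q y)" "b \<in> range (\<lambda>q. y * ipoly q y)" for a b
      using that by (auto simp flip: int_hom.poly_map_diff right_diff_distrib)
    have "y * ipoly q y * (y * ipoly r y) = y * ipoly (q * pCons 0 r) y" for q r
      by (simp add: int_hom.poly_map_simps mult_ac)
    then show "a * b \<in> range (\<lambda>q. y * ipoly q y)"
      if "a \<in> range (\<lambda>q. y * ipoly q y)" "b \<in> range (\<lambda>q. y * ipoly q y)" for a b
      using that by auto
  qed
  then show "t \<in> subalg {y} \<Longrightarrow> \<exists>q. t = y * ipoly q y" by blast
qed

text \<open>Inverting \<open>\<xi>\<close>, we get a quotient of \<open>B\<close> in which \<open>y\<close> is the inverse of \<open>\<xi>\<close>. In every finite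
  quotient of that, \<open>y\<close> is a power of \<open>\<xi>\<close>, so by separability it is already a polynomial in \<open>\<xi>\<close>.\<close>

lemma (in coeff_hom) fin_sep_imp_relation:
  assumes fs: "fin_sep I B" and B: "submod B B" and I: "submod B I" "I \<subseteq> B"
    and \<phi>: "\<And>N. submod B N \<Longrightarrow> submod (range \<phi>) N"
    and gen: "B \<subseteq> subalg S + I" "S \<subseteq> B" "S \<subseteq> range (\<lambda>V. poly (map_poly \<phi> V) y)" and y: "y \<in> B"
  obtains r V where "y * poly (map_poly \<phi> (1 - [:\<xi> * r:] - ([:0, \<xi>:] - 1) * V)) y \<in> I"
proof -
  define ev where "ev V = poly (map_poly \<phi> V) y" for V
  define x where "x = \<phi> \<xi>"
  \<comment> \<open>\<open>I\<close> and \<open>D\<close> will generate the ideal \<open>I'\<close>.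
    Modulo \<open>I'\<close> the element \<open>x * y\<close> is idempotent, and \<open>y\<close> is
    inverse to \<open>x\<close> relative to this idempotent. The factor \<open>y\<close> keeps
    \<open>D\<close> inside \<open>B\<close>.\<close>
  define D where "D = y * (x * y - 1)"
  have ev_mem: "ev V * n \<in> N" if "submod B N" "n \<in> N" for V n N
  proof (induction V)
    case 0
    then show ?case using submod_0[OF that(1)] by (simp add: ev_def)
  next
    case (pCons a V)
    show ?case unfolding ev_def poly_map_pCons distrib_right mult.assoc
      by (rule submod_add[OF that(1) submod_mult[OF \<phi>[OF that(1)] rangeI that(2)]
            submod_mult[OF that(1) y pCons.IH[unfolded ev_def]]])
  qed
  have xB: "x * b \<in> B" if "b \<in> B" for b unfolding x_def
    by (rule submod_mult[OF \<phi>[OF B] rangeI that])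
  have D_B: "D \<in> B"
    using submod_diff[OF B submod_mult[OF B y xB[OF y]] y] unfolding D_def
    by (simp add: algebra_simps)
  define I' where "I' = range (\<lambda>V. D * ev V) + I"
  have ran: "submod (range ev) (range (\<lambda>V. D * ev V))"
  proof (rule submodI)
    show "0 \<in> range (\<lambda>V. D * ev V)" by (rule range_eqI[of _ _ 0]) (simp add: ev_def)
    show "a - b \<in> range (\<lambda>V. D * ev V)"
      if ab: "a \<in> range (\<lambda>V. D * ev V)" "b \<in> range (\<lambda>V. D * ev V)" for a b
      using ab unfolding ev_def by (auto simp flip: poly_map_diff right_diff_distrib)
    have "ev W * (D * ev V) = D * ev (W * V)" for W V
      by (simp add: ev_def poly_map_mult mult_ac)
    then show "e * a \<in> range (\<lambda>V. D * ev V)" if "e \<in> range ev" "a \<in> range (\<lambda>V. D * ev V)" for e a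
      using that by auto
  qed
  have II': "I \<subseteq> I'" unfolding I'_def by (rule subset_plusR[OF ran])
  have "D * ev V \<in> B" for V using ev_mem[OF B D_B] by (simp add: mult.commute)
  then have I'B: "I' \<subseteq> B" unfolding I'_def by (intro plus_minimal[OF B] I) auto
  have I': "submod B I'"
  proof (rule submod_from_generators[OF gen(1) _ II' submod_antimono[OF I(1) I'B]])
    have "S \<subseteq> range ev" using gen(3) unfolding ev_def .
    then show "submod S I'" unfolding I'_def
      by (intro submod_plus submod_antimono[OF ran] submod_antimono[OF I(1) gen(2)])
  qed
  have D_ev: "D * ev V \<in> I'" for V
    unfolding I'_def by (rule subset_plusL[OF I(1), THEN subsetD]) blast
  have D_\<phi>: "\<phi> r * D \<in> I'" for r
    using D_ev[of "[:r:]"] by (simp add: ev_def poly_map_pCons mult.commute)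
  \<comment> \<open>The image of the coefficient ring, cut down by the idempotent
    \<open>x * y\<close>.\<close>
  define A where "A = range (\<lambda>r. \<phi> r * (x * y)) + I'"
  have ranA: "submod {} (range (\<lambda>r. \<phi> r * (x * y)))"
  proof (rule submodI)
    show "0 \<in> range (\<lambda>r. \<phi> r * (x * y))" by (rule range_eqI[of _ _ 0]) (simp add: hom_0)
    show "a - b \<in> range (\<lambda>r. \<phi> r * (x * y))"
      if ab: "a \<in> range (\<lambda>r. \<phi> r * (x * y))" "b \<in> range (\<lambda>r. \<phi> r * (x * y))" for a b
      using ab by (auto simp flip: hom_diff left_diff_distrib)
  qed auto
  have A0: "submod {} A" unfolding A_def by (intro submod_plus ranA submod_antimono[OF I']) simp
  have I'A: "I' \<subseteq> A" unfolding A_def by (rule subset_plusR[OF ranA])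
  have ran_A: "\<phi> r * (x * y) \<in> A" for r
    unfolding A_def by (rule subset_plusL[OF I', THEN subsetD]) blast
  have ran_B: "\<phi> r * (x * y) \<in> B" for r by (rule submod_mult[OF \<phi>[OF B] rangeI xB[OF y]])
  have AB: "A \<subseteq> B" unfolding A_def using ran_B by (intro plus_minimal[OF B] I'B) auto
  have A: "submod A A"
  proof (rule submodI)
    fix s t assume st: "s \<in> A" "t \<in> A"
    obtain r i where s: "s = \<phi> r * (x * y) + i" "i \<in> I'"
      using st(1) unfolding A_def by (auto elim!: set_plus_elim)
    obtain r' i' where t: "t = \<phi> r' * (x * y) + i'" "i' \<in> I'"
      using st(2) unfolding A_def by (auto elim!: set_plus_elim)
    have "\<phi> (r * r') * (x * y) + (\<phi> (\<xi> * r * r') * D + (\<phi> r' * (x * y) * i + s * i')) \<in> A"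
      using I'A D_\<phi> submod_mult[OF I' ran_B s(2)] submod_mult[OF I' _ t(2)] st(1) AB
      by (intro submod_add[OF A0] ran_A) blast+
    then show "s * t \<in> A" unfolding s(1) t(1) D_def x_def by (simp add: hom_mult algebra_simps)
  qed (use submod_0[OF A0] submod_diff[OF A0] in auto)
  have "y \<in> A"
  proof (rule fin_sep_dense[OF fs B I' II' I'B A I'A AB y])
    fix Q assume Q: "submod B Q" "I' \<subseteq> Q" "Q \<subseteq> B" "finite_index B Q"
    obtain m d where md: "m > 0" "d > 0" "y ^ (m + d) - y ^ m \<in> Q"
      by (rule finite_index_powers[OF Q(4) B Q(1) y])
    have Qx: "x ^ n * q \<in> Q" if "q \<in> Q" for n q
      using that by (induction n) (auto simp: x_def mult.assoc intro: submod_mult[OF \<phi>[OF Q(1)]])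
    have pow: "x ^ n * y ^ Suc n - y \<in> Q" for n
    proof (induction n)
      case 0
      then show ?case using submod_0[OF Q(1)] by simp
    next
      case (Suc n)
      have "x ^ 1 * (y * (x ^ n * y ^ Suc n - y)) + \<phi> 1 * D \<in> Q"
        using Q(2) D_\<phi> by (intro submod_add[OF Q(1)] Qx submod_mult[OF Q(1) y] Suc) blast
      then show ?case unfolding D_def by (simp add: hom_1 algebra_simps)
    qed
    obtain m' d' where md': "m = Suc m'" "d = Suc d'" using md gr0_implies_Suc by metis
    \<comment> \<open>Powers of \<open>y\<close> repeat modulo \<open>Q\<close>. Multiplying
      \<open>y ^ (m + d) = y ^ m\<close> by \<open>x ^ (m' + d)\<close> turns this into
      \<open>y = x ^ d * y\<close>, which is in \<open>A\<close> since \<open>d > 0\<close>.\<close>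
    have "x ^ (m' + d) * (y ^ (m + d) - y ^ m) + x ^ d * (x ^ m' * y ^ Suc m' - y)
        - (x ^ (m' + d) * y ^ Suc (m' + d) - y) \<in> Q"
      by (intro submod_diff[OF Q(1)] submod_add[OF Q(1)] Qx pow md)
    then have "y - x ^ d * y \<in> Q" unfolding md' by (simp add: algebra_simps power_add)
    moreover have "x ^ d * y = \<phi> (\<xi> ^ d') * (x * y)"
      unfolding md' x_def hom_power by (simp add: mult_ac)
    then have "x ^ d * y \<in> A" using ran_A by simp
    ultimately have "x ^ d * y + (y - x ^ d * y) \<in> A + Q" by (intro set_plus_intro)
    then show "y \<in> A + Q" by simp
  qed
  then obtain s t where st: "y = s + t" "s \<in> range (\<lambda>r. \<phi> r * (x * y))" "t \<in> I'"
    unfolding A_def by (rule set_plus_elim)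
  obtain u i where u: "t = u + i" "u \<in> range (\<lambda>V. D * ev V)" "i \<in> I"
    using st(3) unfolding I'_def by (rule set_plus_elim)
  obtain r V where "s = \<phi> r * (x * y)" "u = D * ev V" using st(2) u(2) by blast
  then have i: "y = \<phi> r * (x * y) + (D * ev V + i)" using st(1) u(1) by simp
  have "ev (1 - [:\<xi> * r:] - ([:0, \<xi>:] - 1) * V) = 1 - x * \<phi> r - (y * x - 1) * ev V"
    unfolding ev_def x_def poly_map_diff poly_map_mult poly_map_1 poly_map_pCons hom_mult
    by (simp add: hom_0)
  then have "y * ev (1 - [:\<xi> * r:] - ([:0, \<xi>:] - 1) * V) = y - \<phi> r * (x * y) - D * ev V"
    unfolding D_def by (simp only:) (simp add: algebra_simps)
  also have "\<dots> = i" using i by (simp add: algebra_simps)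
  finally show thesis using u(3) unfolding ev_def by (intro that[of r V]) (simp only:)
qed

section \<open>One generator: integrality up to an integer factor\<close>

lemma fin_sep_imp_algebraic:
  assumes fs: "fin_sep I B" and B: "submod B B" and I: "submod B I" "I \<subseteq> B"
    and gen: "B \<subseteq> subalg {y} + I" and y: "y \<in> B"
  obtains s where "s \<noteq> 0" "y * ipoly s y \<in> I"
proof -
  have "submod (range of_int) N" if "submod B N" for N
    using that by (intro submodI) (auto intro: submod_0 submod_diff submod_of_int)
  moreover have "{y} \<subseteq> range (\<lambda>V. ipoly V y)"
    using rangeI[of "\<lambda>V. ipoly V y" "[:0, 1:]"] by (simp add: int_hom.poly_map_pCons)
  ultimately obtain r V where rV: "y * ipoly (1 - [:2 * r:] - ([:0, 2:] - 1) * V) y \<in> I"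
    using int_hom.fin_sep_imp_relation[OF fs B I _ gen _ _ y, of 2] y by blast
  \<comment> \<open>The reason for taking \<open>\<xi> = 2\<close>: the constant
    \<open>1 - 2 * r\<close> is odd, hence nonzero, and a nonzero constant is not a multiple of
    \<open>[:-1, 2:]\<close>.\<close>
  have "1 - [:2 * r:] - ([:0, 2:] - 1) * V \<noteq> 0"
  proof
    assume "1 - [:2 * r:] - ([:0, 2:] - 1) * V = 0"
    then have eq: "[:1 - 2 * r:] = [:-1, 2:] * V" by (simp add: one_pCons)
    have "1 - 2 * r \<noteq> 0" by presburger
    then have "V \<noteq> 0" using eq by auto
    then have "degree ([:-1, 2:] * V) = 1 + degree V" by (subst degree_mult_eq) auto
    then show False using eq by (metis add_is_0 degree_pCons_0 zero_neq_one)
  qed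
  then show thesis using that rV by blast
qed

lemma sum_kronecker:
  "finite Y \<Longrightarrow> i \<in> Y \<Longrightarrow> (\<Sum>j\<in>Y. (if j = i then 1 else 0) * f j) = (f i :: 'a::comm_ring_1)"
  by (subst sum.remove[of _ i]) auto

lemma int_bezout:
  fixes f :: "nat \<Rightarrow> int"
  assumes "f j \<noteq> 0" "j \<le> n"
  obtains c h u where "c \<noteq> 0" "\<And>i. i \<le> n \<Longrightarrow> f i = c * h i" "(\<Sum>i\<le>n. u i * h i) = 1"
proof -
  define T where "T = range (\<lambda>u. \<Sum>i\<le>n. u i * f i)"
  have "submod {} T" unfolding T_def
  proof (rule submodI)
    show "0 \<in> range (\<lambda>u. \<Sum>i\<le>n. u i * f i)" by (rule range_eqI[of _ _ "\<lambda>_. 0"]) simp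
    show "a - b \<in> range (\<lambda>u. \<Sum>i\<le>n. u i * f i)"
      if ab: "a \<in> range (\<lambda>u. \<Sum>i\<le>n. u i * f i)" "b \<in> range (\<lambda>u. \<Sum>i\<le>n. u i * f i)" for a b
    proof -
      obtain u v where "a = (\<Sum>i\<le>n. u i * f i)" "b = (\<Sum>i\<le>n. v i * f i)" using ab by blast
      then show ?thesis
        by (intro range_eqI[of _ _ "\<lambda>i. u i - v i"]) (simp add: sum_subtractf left_diff_distrib)
    qed
  qed auto
  from int_subgroup_principal[OF this] obtain c where c: "c \<in> T" "\<And>t. t \<in> T \<Longrightarrow> c dvd t" by blast
  have "f i \<in> T" if "i \<le> n" for i
    unfolding T_def using that
    by (intro range_eqI[of _ _ "\<lambda>j. if j = i then 1 else 0"]) (simp add: sum_kronecker)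
  then have dvd: "c dvd f i" if "i \<le> n" for i using c(2) that by blast
  then have h: "f i = c * (f i div c)" if "i \<le> n" for i using that by simp
  have "c \<noteq> 0" using dvd[OF assms(2)] assms(1) by auto
  obtain u where "c = (\<Sum>i\<le>n. u i * f i)" using c(1) unfolding T_def by blast
  also have "\<dots> = c * (\<Sum>i\<le>n. u i * (f i div c))"
    unfolding sum_distrib_left by (intro sum.cong) (auto simp: mult.left_commute[of c] dvd)
  finally have "(\<Sum>i\<le>n. u i * (f i div c)) = 1" using \<open>c \<noteq> 0\<close> by simp
  then show thesis using that[of c "\<lambda>i. f i div c" u] \<open>c \<noteq> 0\<close> h by blast
qed

lemma of_int_mem_span_one: "of_int n \<in> span E {1}"
  using submod_of_int[OF submod_span span_base[of 1 "{1}" E]] by simp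

text \<open>Dividing the relation by its content \<open>c\<close> makes the coefficients coprime, as
  \<open>fin_sep_integral\<close> demands. The divided relation holds only after multiplication by
  \<open>c\<close>, so \<open>I\<close> gives way to the elements that \<open>c\<close> sends into
  \<open>I\<close>.\<close>

lemma fin_sep_imp_integral_int:
  assumes fs: "fin_sep I B" and B: "submod B B" and I: "submod B I" and IB: "I \<subseteq> B"
    and gen: "B \<subseteq> subalg {y} + I" and yB: "y \<in> B"
  obtains c :: int where "c \<noteq> 0" "integral_mod {} {t \<in> B. of_int c * t \<in> I} y"
proof -
  obtain s where s: "s \<noteq> 0" "y * ipoly s y \<in> I"
    by (rule fin_sep_imp_algebraic[OF fs B I IB gen yB])
  obtain c h u where c: "c \<noteq> 0" "\<And>i. i \<le> degree s \<Longrightarrow> coeff s i = c * h i"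
    "(\<Sum>i\<le>degree s. u i * h i) = 1"
    by (rule int_bezout[of "coeff s" "degree s"]) (use s in auto)
  define J where "J = {t \<in> B. of_int c * t \<in> I}"
  have J: "submod B J" unfolding J_def by (rule submod_vimage_mult[OF B I])
  have IJ: "I \<subseteq> J" unfolding J_def using IB submod_of_int[OF I] by blast
  have JB: "J \<subseteq> B" unfolding J_def by blast
  have pow_B: "y ^ Suc j \<in> B" for j using yB by (induction j) (auto intro: submod_mult[OF B])
  have "integral_mod {} J y"
  proof (rule fin_sep_integral[where a = "\<lambda>i. of_int (h i)" and u = "\<lambda>i. of_int (u i)" and n = "degree s"])
    show "fin_sep J B" by (rule fin_sep_mono[OF fs J IJ JB B])
    have "of_int c * (\<Sum>i\<le>degree s. of_int (h i) * y ^ Suc i) = y * ipoly s y"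
      unfolding int_hom.poly_map_altdef sum_distrib_left
      by (intro sum.cong) (auto simp: c mult_ac)
    moreover have "(\<Sum>i\<le>degree s. of_int (h i) * y ^ Suc i) \<in> B"
      by (intro submod_sum[OF B] submod_of_int[OF B] pow_B)
    ultimately show "(\<Sum>i\<le>degree s. of_int (h i) * y ^ Suc i) \<in> J" unfolding J_def using s by simp
    have "(\<Sum>i\<le>degree s. of_int (u i) * of_int (h i)) = (1 :: 'a)"
      using arg_cong[OF c(3), of "of_int :: int \<Rightarrow> 'a"] by simp
    then show "t - (\<Sum>i\<le>degree s. of_int (u i) * of_int (h i)) * t \<in> J" if "t \<in> B" for t
      using submod_0[OF J] by simp
  qed (use B J JB yB of_int_mem_span_one in auto)
  then show thesis using that c(1) unfolding J_def by blast
qed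

section \<open>Integer polynomials modulo a prime\<close>

lemma prime_elem_const: "Factorial_Ring.prime (p :: int) \<Longrightarrow> prime_elem [:p:]"
  using prime_elem_const_poly_iff[of p] prime_imp_prime_elem by blast

lemma prime_const_dvd_mult:
  fixes a b :: "int poly"
  assumes "Factorial_Ring.prime p"
  shows "[:p:] dvd a * b \<longleftrightarrow> [:p:] dvd a \<or> [:p:] dvd b"
  by (rule prime_elem_dvd_mult_iff[OF prime_elem_const[OF assms]])

lemma prime_const_dvd_power:
  fixes a :: "int poly"
  shows "Factorial_Ring.prime p \<Longrightarrow> [:p:] dvd a ^ k \<Longrightarrow> [:p:] dvd a"
  using prime_elem_dvd_power[OF prime_elem_const] .

lemma not_const_dvd_X: "Factorial_Ring.prime (p::int) \<Longrightarrow> \<not> [:p:] dvd [:0, 1:]"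
  unfolding const_poly_dvd_iff by (auto simp: coeff_pCons intro!: exI[of _ 1])

text \<open>Terms above the highest coefficient prime to \<open>p\<close> are dropped, and the rest
  is multiplied by the inverse of that coefficient modulo \<open>p\<close>.\<close>

lemma monic_multiple_mod_prime:
  fixes q :: "int poly"
  assumes p: "Factorial_Ring.prime p" and q: "\<not> [:p:] dvd q"
  obtains c s where "lead_coeff c = 1" "degree c \<le> degree q" "[:p:] dvd smult s q - c"
proof -
  define N where "N = {i. \<not> p dvd coeff q i}"
  have N: "N \<noteq> {}" "N \<subseteq> {..degree q}"
    using q unfolding N_def by (auto simp: const_poly_dvd_iff intro: le_degree)
  then have fin: "finite N" using finite_subset by blast
  define d where "d = Max N"
  have d: "d \<in> N" unfolding d_def by (rule Max_in[OF fin N(1)])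
  have gt_d: "p dvd coeff q i" if "i > d" for i
    using Max_ge[OF fin, of i] that unfolding d_def[symmetric] by (auto simp: N_def)
  have "coprime (coeff q d) p"
    using d p unfolding N_def by (metis coprime_commute mem_Collect_eq prime_imp_coprime)
  then obtain s where s: "[coeff q d * s = 1] (mod p)" using cong_solve_coprime_int by blast
  define c where "c = monom 1 d + smult s (poly_cutoff d q)"
  have coeff_c: "coeff c i = (if i = d then 1 else if i < d then s * coeff q i else 0)" for i
    unfolding c_def by (simp add: coeff_poly_cutoff)
  have deg: "degree c = d"
    by (rule antisym) (auto intro!: degree_le le_degree simp: coeff_c)
  have "[:p:] dvd smult s q - c" unfolding const_poly_dvd_iff
  proof
    fix i
    show "p dvd coeff (smult s q - c) i"
      using s gt_d[of i] by (auto simp: coeff_c cong_iff_dvd_diff mult.commute)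
  qed
  moreover have "d \<le> degree q" using d N(2) by auto
  ultimately show thesis using that[of c s] deg by (simp add: coeff_c)
qed

text \<open>Bezout's identity in \<open>\<int>[X] / (p)\<close>: a nonzero element of least degree in the ideal of the
  \<open>f i\<close> is a greatest common divisor.\<close>

lemma mod_prime_bezout:
  fixes f :: "nat \<Rightarrow> int poly"
  assumes p: "Factorial_Ring.prime p" and f: "\<not> [:p:] dvd f j" "j \<le> n"
  obtains c h u where "\<not> [:p:] dvd c" "\<And>i. i \<le> n \<Longrightarrow> [:p:] dvd f i - c * h i"
    "[:p:] dvd (\<Sum>i\<le>n. u i * h i) - 1"
proof -
  define T where "T = {t. \<exists>u. [:p:] dvd (\<Sum>i\<le>n. u i * f i) - t}"
  have T: "submod UNIV T"
  proof (rule submodI)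
    show "0 \<in> T" unfolding T_def by (auto intro!: exI[of _ "\<lambda>_. 0"])
  next
    fix a b assume "a \<in> T" "b \<in> T"
    then obtain u v where "[:p:] dvd (\<Sum>i\<le>n. u i * f i) - a" "[:p:] dvd (\<Sum>i\<le>n. v i * f i) - b"
      unfolding T_def by blast
    then have "[:p:] dvd ((\<Sum>i\<le>n. u i * f i) - a) - ((\<Sum>i\<le>n. v i * f i) - b)" by (rule dvd_diff)
    then have "[:p:] dvd (\<Sum>i\<le>n. (u i - v i) * f i) - (a - b)"
      by (simp add: sum_subtractf algebra_simps)
    then show "a - b \<in> T" unfolding T_def by (intro CollectI exI[of _ "\<lambda>i. u i - v i"])
  next
    fix e a assume "a \<in> T"
    then obtain u where "[:p:] dvd (\<Sum>i\<le>n. u i * f i) - a" unfolding T_def by blast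
    then have "[:p:] dvd e * ((\<Sum>i\<le>n. u i * f i) - a)" by (rule dvd_mult)
    then have "[:p:] dvd (\<Sum>i\<le>n. e * u i * f i) - e * a"
      by (simp add: sum_distrib_left right_diff_distrib mult.assoc)
    then show "e * a \<in> T" unfolding T_def by (intro CollectI exI[of _ "\<lambda>i. e * u i"])
  qed
  have f_T: "f i \<in> T" if "i \<le> n" for i
    unfolding T_def using that
    by (intro CollectI exI[of _ "\<lambda>j. if j = i then 1 else 0"]) (simp add: sum_kronecker)
  have T_cong: "b \<in> T" if "a \<in> T" "[:p:] dvd a - b" for a b
  proof -
    obtain u where "[:p:] dvd (\<Sum>i\<le>n. u i * f i) - a" using \<open>a \<in> T\<close> unfolding T_def by blast
    from dvd_add[OF this that(2)] show ?thesis unfolding T_def by auto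
  qed
  define P where "P d \<longleftrightarrow> (\<exists>c\<in>T. \<not> [:p:] dvd c \<and> degree c = d)" for d
  have "P (degree (f j))" unfolding P_def using f f_T by blast
  then have "P (LEAST d. P d)" by (rule LeastI)
  then obtain c\<^sub>0 where c0: "c\<^sub>0 \<in> T" "\<not> [:p:] dvd c\<^sub>0" "degree c\<^sub>0 = (LEAST d. P d)"
    unfolding P_def by blast
  obtain c s where c: "lead_coeff c = 1" "degree c \<le> degree c\<^sub>0" "[:p:] dvd smult s c\<^sub>0 - c"
    by (rule monic_multiple_mod_prime[OF p c0(2)])
  have "[:s:] * c\<^sub>0 \<in> T" using submod_mult[OF T _ c0(1)] by blast
  then have c_T: "c \<in> T" using T_cong c(3) by simp
  have c_p: "\<not> [:p:] dvd c"
  proof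
    assume "[:p:] dvd c"
    then have "p dvd lead_coeff c" unfolding const_poly_dvd_iff by blast
    then show False using c(1) p not_prime_unit by metis
  qed
  have "c \<noteq> 0" using c_p by auto
  have "\<exists>h. [:p:] dvd t - c * h" if "t \<in> T" for t
  proof -
    obtain q r where qr: "pseudo_divmod t c = (q, r)" by fastforce
    have eq: "t = c * q + r" and deg: "r = 0 \<or> degree r < degree c"
      using pseudo_divmod[OF \<open>c \<noteq> 0\<close> qr] c(1) by auto
    have "t - q * c \<in> T" using submod_diff[OF T that submod_mult[OF T _ c_T]] by blast
    then have "r \<in> T" using eq by (simp add: mult.commute)
    have "[:p:] dvd r"
    proof (rule ccontr)
      assume r: "\<not> [:p:] dvd r"
      then have "P (degree r)" unfolding P_def using \<open>r \<in> T\<close> by blast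
      then have "degree c\<^sub>0 \<le> degree r" unfolding c0(3) by (rule Least_le)
      then show False using deg c(2) r by auto
    qed
    then show ?thesis using eq by (intro exI[of _ q]) simp
  qed
  then have "\<forall>i. \<exists>h. i \<le> n \<longrightarrow> [:p:] dvd f i - c * h" using f_T by blast
  then obtain h where h: "\<And>i. i \<le> n \<Longrightarrow> [:p:] dvd f i - c * h i" by metis
  obtain u where u: "[:p:] dvd (\<Sum>i\<le>n. u i * f i) - c" using c_T unfolding T_def by blast
  have "[:p:] dvd (\<Sum>i\<le>n. u i * (f i - c * h i))" using h by (intro dvd_sum dvd_mult) auto
  from dvd_diff[OF u this] have "[:p:] dvd c * ((\<Sum>i\<le>n. u i * h i) - 1)"
    by (simp add: right_diff_distrib sum_subtractf sum_distrib_left mult_ac)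
  then have "[:p:] dvd (\<Sum>i\<le>n. u i * h i) - 1" using c_p prime_const_dvd_mult[OF p] by blast
  then show thesis using that c_p h by blast
qed

section \<open>Transcendence and integrality modulo a prime\<close>

lemma const_dvd_ipoly:
  assumes "[:p:] dvd q" "submod E N" "x \<in> E" "of_int p * n \<in> N"
  shows "ipoly q x * n \<in> N"
proof -
  obtain r where "q = [:p:] * r" using assms(1) by blast
  then have "ipoly q x * n = ipoly r x * (of_int p * n)"
    by (simp only: int_hom.poly_map_mult int_hom.poly_map_pCons) (simp add: mult_ac)
  then show ?thesis using ipoly_mem[OF assms(2-4)] by simp
qed

text \<open>Transcendence over \<open>\<int>/p\<close>, tested modulo \<open>I\<close>. The factor
  \<open>x\<close> appears because \<open>q(x)\<close> itself need not lie in a ring without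
  identity.\<close>

definition transc :: "int \<Rightarrow> 'r::comm_ring_1 set \<Rightarrow> 'r \<Rightarrow> bool"
  where "transc p I x \<longleftrightarrow> (\<forall>q. \<not> [:p:] dvd q \<longrightarrow> x * ipoly q x \<notin> I)"

lemma integral_mod_iff:
  assumes "submod E I"
  shows "integral_mod E I y \<longleftrightarrow> (\<exists>m. \<exists>w\<in>pow_span E y m. y ^ Suc m - w \<in> I)"
proof -
  have "y ^ Suc m \<in> span E ((\<lambda>j. y ^ Suc j) ` {..<m} \<union> I) \<longleftrightarrow>
    (\<exists>w\<in>pow_span E y m. y ^ Suc m - w \<in> I)" (is "?L \<longleftrightarrow> ?R") for m
  proof
    have sub: "submod E (pow_span E y m + I)" by (intro submod_plus submod_pow_span assms)
    have "(\<lambda>j. y ^ Suc j) ` {..<m} \<subseteq> pow_span E y m" using power_mem_pow_span by blast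
    also have "\<dots> \<subseteq> pow_span E y m + I" by (rule subset_plusL[OF assms])
    finally have "span E ((\<lambda>j. y ^ Suc j) ` {..<m} \<union> I) \<subseteq> pow_span E y m + I"
      using subset_plusR[OF submod_pow_span, of I E y m] by (intro span_minimal[OF sub] Un_least)
    moreover assume ?L
    ultimately have "y ^ Suc m \<in> pow_span E y m + I" by blast
    then obtain w i where "y ^ Suc m = w + i" "w \<in> pow_span E y m" "i \<in> I" by (rule set_plus_elim)
    then show ?R by (intro bexI[of _ w]) (auto simp del: power_Suc)
  next
    assume ?R
    then obtain w where w: "w \<in> pow_span E y m" "y ^ Suc m - w \<in> I" by blast
    have "pow_span E y m \<subseteq> span E ((\<lambda>j. y ^ Suc j) ` {..<m} \<union> I)"
      unfolding pow_span_def by (intro hull_mono) auto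
    then have "w + (y ^ Suc m - w) \<in> span E ((\<lambda>j. y ^ Suc j) ` {..<m} \<union> I)"
      using w by (intro submod_add[OF submod_span]) (auto intro: span_base)
    then show ?L by simp
  qed
  then show ?thesis unfolding integral_mod_def by blast
qed

text \<open>A power of \<open>y ^ Suc m - w\<close> is a power of \<open>y\<close> minus terms of
  lower degree, so nilpotence of a monic expression in \<open>y\<close> is as good as its
  vanishing.\<close>

lemma integral_mod_power:
  assumes I: "submod E I" and w: "w \<in> pow_span E y m" and t: "(y ^ Suc m - w) ^ Suc k \<in> I"
  shows "integral_mod E I y"
proof -
  let ?M = "Suc m"
  note sub = submod_pow_span[of E y]
  \<comment> \<open>Since \<open>pow_span E y n\<close> admits exponents up to \<open>n\<close>, the
    \<open>- 1\<close> is what excludes the leading power.\<close>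
  have "(y ^ ?M) ^ Suc k - (y ^ ?M - w) ^ Suc k \<in> pow_span E y (?M * Suc k - 1)" for k
  proof (induction k)
    case 0
    then show ?case using w by (simp del: power_Suc)
  next
    case (Suc k)
    define Y u where "Y = y ^ ?M" and "u = Y ^ Suc k - (Y - w) ^ Suc k"
    have u: "u \<in> pow_span E y (?M * Suc k - 1)" using Suc unfolding u_def Y_def .
    have Y_pow: "Y ^ Suc l \<in> pow_span E y (?M * Suc l)" for l
      using power_mem_pow_span[of "?M * Suc l - 1" "?M * Suc l" y E]
      unfolding Y_def power_mult[symmetric] by (simp del: power_Suc)
    have 1: "Y ^ Suc k * w \<in> pow_span E y (?M * Suc (Suc k) - 1)"
      using pow_span_mult[OF Y_pow[of k] w] by (simp add: algebra_simps)
    have 2: "u * Y ^ Suc 0 \<in> pow_span E y (?M * Suc (Suc k) - 1)"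
      using pow_span_mult[OF u Y_pow[of 0]] by (simp add: algebra_simps)
    have "u * w \<in> pow_span E y (?M * Suc k - 1 + m)" by (rule pow_span_mult[OF u w])
    then have 3: "u * w \<in> pow_span E y (?M * Suc (Suc k) - 1)"
      using pow_span_mono[of "?M * Suc k - 1 + m" "?M * Suc (Suc k) - 1" E y] by auto
    have "Y ^ Suc (Suc k) - (Y - w) ^ Suc (Suc k) = Y ^ Suc k * w + u * Y ^ Suc 0 - u * w"
      unfolding u_def by (simp add: algebra_simps)
    also have "\<dots> \<in> pow_span E y (?M * Suc (Suc k) - 1)"
      by (intro submod_diff[OF sub] submod_add[OF sub] 1 2 3)
    finally show ?case unfolding Y_def .
  qed
  from this[of k] have "y ^ Suc (?M * Suc k - 1) - (y ^ ?M - w) ^ Suc k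
      \<in> pow_span E y (?M * Suc k - 1)"
    unfolding power_mult[symmetric] by (simp del: power_Suc)
  then show ?thesis unfolding integral_mod_iff[OF I]
    using t by (intro exI bexI) (auto simp del: power_Suc)
qed

text \<open>Modulo \<open>I\<close> the element \<open>t\<close> is \<open>p * b\<close> with
  \<open>b\<close> in \<open>B\<close>, so its power with exponent \<open>Suc k\<close> is divisible
  by \<open>p ^ Suc k\<close> and vanishes.\<close>

lemma power_mem_of_prime_power:
  assumes B: "submod B B" and I: "submod B I" "I \<subseteq> B"
    and pk: "\<And>b. b \<in> B \<Longrightarrow> of_int p ^ Suc k * b \<in> I"
    and t: "t \<in> I + (*) (of_int p) ` B"
  shows "t ^ Suc k \<in> I"
proof -
  obtain i b where ib: "t = i + of_int p * b" "i \<in> I" "b \<in> B"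
    using t by (auto elim!: set_plus_elim)
  have pow: "b ^ Suc j \<in> B" for j using ib(3) by (induction j) (auto intro: submod_mult[OF B])
  have "t ^ Suc j - of_int p ^ Suc j * b ^ Suc j \<in> I" for j
  proof (induction j)
    case 0
    then show ?case using ib by simp
  next
    case (Suc j)
    define v where "v = t ^ Suc j - of_int p ^ Suc j * b ^ Suc j"
    have tB: "t \<in> B"
      unfolding ib by (intro submod_add[OF B] submod_of_int[OF B] ib) (use ib I in auto)
    have "t * v \<in> I" using submod_mult[OF I(1) tB] Suc unfolding v_def .
    moreover have "of_int (p ^ Suc j) * (b ^ Suc j * i) \<in> I"
      by (intro submod_of_int[OF I(1)] submod_mult[OF I(1)] pow ib)
    ultimately have "t * v + of_int (p ^ Suc j) * (b ^ Suc j * i) \<in> I"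
      by (rule submod_add[OF I(1)])
    then show ?case unfolding v_def ib(1) by (simp add: algebra_simps)
  qed
  from submod_add[OF I(1) this[of k] pk[OF pow[of k]]] show ?thesis by (simp del: power_Suc)
qed

text \<open>A polynomial that is nonzero modulo \<open>p\<close> can be made monic, but only modulo
  \<open>p\<close>. The monic equation thus holds modulo \<open>I + p B\<close>, which is nilpotent
  modulo \<open>I\<close>, and \<open>integral_mod_power\<close> applies.\<close>

lemma algebraic_imp_integral:
  assumes p: "Factorial_Ring.prime p" and B: "submod B B" and I: "submod B I" "I \<subseteq> B" and y:
    "y \<in> B"
    and pk: "\<And>b. b \<in> B \<Longrightarrow> of_int p ^ Suc k * b \<in> I"
    and alg: "\<not> transc p I y"
  shows "integral_mod {} I y"
proof -
  obtain q where q: "\<not> [:p:] dvd q" "y * ipoly q y \<in> I" using alg unfolding transc_def by blast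
  obtain c s where c: "lead_coeff c = 1" "[:p:] dvd smult s q - c"
    by (rule monic_multiple_mod_prime[OF p q(1)])
  define w where "w = y ^ Suc (degree c) - y * ipoly c y"
  have "w = (\<Sum>i<degree c. - (of_int (coeff c i) * y ^ Suc i))"
    unfolding w_def int_hom.poly_map_altdef
    by (simp add: c lessThan_Suc_atMost[symmetric] sum_negf sum_distrib_left algebra_simps)
  also have "\<dots> \<in> pow_span {} y (degree c)"
    by (intro submod_sum[OF submod_pow_span] submod_minus[OF submod_pow_span]
        submod_of_int[OF submod_pow_span] power_mem_pow_span) simp
  finally have w: "w \<in> pow_span {} y (degree c)" .
  let ?J = "I + (*) (of_int p) ` B"
  have J: "submod B ?J" by (intro submod_plus submod_image_mult B I)
  have IJ: "I \<subseteq> ?J" by (rule subset_plusL[OF submod_image_mult[OF B]])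
  have "ipoly (smult s q - c) y * y \<in> ?J"
    by (rule const_dvd_ipoly[OF c(2) J y])
      (use y subset_plusR[OF I(1), of "(*) (of_int p) ` B"] in blast)
  moreover have "of_int s * (y * ipoly q y) \<in> ?J"
    by (intro submod_of_int[OF J]) (use q IJ in blast)
  ultimately have "of_int s * (y * ipoly q y) - ipoly (smult s q - c) y * y \<in> ?J"
    by (intro submod_diff[OF J])
  then have "y ^ Suc (degree c) - w \<in> ?J"
    unfolding w_def by (simp add: int_hom.poly_map_simps algebra_simps)
  from power_mem_of_prime_power[OF B I pk this]
  show ?thesis using w by (intro integral_mod_power[of "{}" I w y "degree c" k] submod_antimono[OF I(1)]) auto
qed

section \<open>Two generators: integrality over \<int>[x] up to a scalar\<close>

abbreviation ipoly2 :: "int poly poly \<Rightarrow> 'r::comm_ring_1 \<Rightarrow> 'r \<Rightarrow> 'r"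
  where "ipoly2 V x y \<equiv> poly (map_poly (\<lambda>q. ipoly q x) V) y"

text \<open>Here \<xi> is the variable \<open>Z\<close> of the coefficient ring. If \<open>p\<close>
  divided all coefficients of the relation, it would divide every
  \<open>coeff V (Suc j) - Z * coeff V j\<close>, hence, descending from the degree, every
  \<open>coeff V j\<close>. Then \<open>p\<close> would divide \<open>1 - Z * r\<close>, whose value
  at 0 is 1.\<close>

lemma fin_sep_imp_dependent:
  assumes p: "Factorial_Ring.prime p" and fs: "fin_sep I B"
    and B: "submod B B" and I: "submod B I" "I \<subseteq> B"
    and gen: "B \<subseteq> subalg {x, y} + I" and x: "x \<in> B" and y: "y \<in> B"
  obtains V j where "\<not> [:p:] dvd coeff V j" "y * ipoly2 V x y \<in> I"
proof -
  define Z where "Z = [:0, 1 :: int:]"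
  have \<phi>: "submod (range (\<lambda>q. ipoly q x)) N" if "submod B N" for N
    using that x by (intro submodI) (auto intro: submod_0 submod_diff ipoly_mem)
  have "x = ipoly2 [:Z:] x y" "y = ipoly2 [:0, 1:] x y"
    unfolding Z_def by (simp_all add: ipoly_hom.poly_map_pCons int_hom.poly_map_pCons)
  then have "{x, y} \<subseteq> range (\<lambda>V. ipoly2 V x y)" by blast
  then obtain r V where rV: "y * ipoly2 (1 - [:Z * r:] - ([:0, Z:] - 1) * V) x y \<in> I"
    using ipoly_hom.fin_sep_imp_relation[OF fs B I \<phi> gen _ _ y, of Z] x y by blast
  define W where "W = 1 - [:Z * r:] - ([:0, Z:] - 1) * V"
  have "\<exists>j. \<not> [:p:] dvd coeff W j"
  proof (rule ccontr)
    assume "\<not> (\<exists>j. \<not> [:p:] dvd coeff W j)"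
    then have dvd: "[:p:] dvd coeff W j" for j by blast
    have "coeff W (Suc j) = coeff V (Suc j) - Z * coeff V j" for j
      unfolding W_def by (simp add: one_pCons coeff_pCons algebra_simps)
    then have rec: "[:p:] dvd coeff V (Suc j) - Z * coeff V j" for j using dvd[of "Suc j"] by simp
    have high: "[:p:] dvd coeff V j" if "degree V < j + k" for j k
      using that
    proof (induction k arbitrary: j)
      case 0
      then show ?case by (simp add: coeff_eq_0)
    next
      case (Suc k)
      then have "[:p:] dvd coeff V (Suc j)" by simp
      from dvd_diff[OF this rec[of j]] have "[:p:] dvd Z * coeff V j" by simp
      then show ?case
        using not_const_dvd_X[OF p] prime_const_dvd_mult[OF p] unfolding Z_def by blast
    qed
    have "coeff W 0 = 1 - Z * r + coeff V 0"
      unfolding W_def by (simp add: one_pCons algebra_simps)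
    then have "[:p:] dvd 1 - Z * r"
      using dvd[of 0] high[of 0 "Suc (degree V)"] by (simp add: dvd_add_left_iff)
    then have "p dvd coeff (1 - Z * r) 0" unfolding const_poly_dvd_iff by blast
    then show False using p not_prime_unit unfolding Z_def by auto
  qed
  then show thesis using that rV unfolding W_def by blast
qed

text \<open>As over \<int>, with the greatest common divisor \<open>c\<close> taken modulo
  \<open>p\<close>. The factorisation and Bezout's identity hold up to multiples of
  \<open>p\<close>, which act as zero because \<open>p B\<close> lies in \<open>I\<close>.\<close>

lemma fin_sep_imp_integral_prime:
  assumes p: "Factorial_Ring.prime p" and fs: "fin_sep I B"
    and B: "submod B B" and I: "submod B I" "I \<subseteq> B"
    and gen: "B \<subseteq> subalg {x, y} + I" and x: "x \<in> B" and y: "y \<in> B"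
    and pB: "\<And>b. b \<in> B \<Longrightarrow> of_int p * b \<in> I"
  obtains c where "\<not> [:p:] dvd c" "integral_mod {x} {t \<in> B. x * ipoly c x * t \<in> I} y"
proof -
  obtain V j where V: "\<not> [:p:] dvd coeff V j" "y * ipoly2 V x y \<in> I"
    by (rule fin_sep_imp_dependent[OF p fs B I gen x y])
  have j: "j \<le> degree V" using V(1) by (intro le_degree) auto
  obtain c h u where c: "\<not> [:p:] dvd c" "\<And>i. i \<le> degree V \<Longrightarrow> [:p:] dvd coeff V i - c * h i"
    "[:p:] dvd (\<Sum>i\<le>degree V. u i * h i) - 1"
  proof (rule mod_prime_bezout[where f = "coeff V", OF p V(1) j])
    fix c h u
    assume "\<not> [:p:] dvd c" "\<And>i. i \<le> degree V \<Longrightarrow> [:p:] dvd coeff V i - c * h i"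
      "[:p:] dvd (\<Sum>i\<le>degree V. u i * h i) - 1"
    then show thesis by (rule that)
  qed
  define J where "J = {t \<in> B. x * ipoly c x * t \<in> I}"
  have J: "submod B J" unfolding J_def by (rule submod_vimage_mult[OF B I(1)])
  have xI: "submod {x} I" and xB: "submod {x} B"
    using submod_antimono[OF I(1), of "{x}"] submod_antimono[OF B, of "{x}"] x by auto
  have IJ: "I \<subseteq> J" unfolding J_def using I ipoly_mem[OF xI] submod_mult[OF xI]
    by (auto simp: mult.assoc)
  have JB: "J \<subseteq> B" unfolding J_def by blast
  have pow_B: "y ^ Suc i \<in> B" for i using y by (induction i) (auto intro: submod_mult[OF B])
  have ip: "ipoly q x \<in> span {x} {1}" for q unfolding span_ipoly by blast
  have p_mem: "ipoly q x * b \<in> I" if "[:p:] dvd q" "b \<in> B" for q b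
    by (rule const_dvd_ipoly[OF that(1) xI _ pB[OF that(2)]]) simp
  have "integral_mod {x} J y"
  proof (rule fin_sep_integral[where a = "\<lambda>i. ipoly (h i) x" and u = "\<lambda>i. ipoly (u i) x"
        and n = "degree V"])
    show "fin_sep J B" by (rule fin_sep_mono[OF fs J IJ JB B])
    define s where "s = (\<Sum>i\<le>degree V. ipoly (h i) x * y ^ Suc i)"
    have s: "s \<in> B" unfolding s_def by (intro submod_sum[OF B] ipoly_mem[OF xB] pow_B) simp
    have "ipoly c x * s = y * ipoly2 V x y - (\<Sum>i\<le>degree V. ipoly (coeff V i - c * h i) x * y ^ Suc i)"
      unfolding s_def ipoly_hom.poly_map_altdef
      by (simp add: int_hom.poly_map_diff int_hom.poly_map_mult sum_distrib_left
          flip: sum_subtractf) (simp add: algebra_simps)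
    also have "\<dots> \<in> I"
      using V c(2) pow_B by (intro submod_diff[OF I(1)] submod_sum[OF I(1)] p_mem) auto
    finally have "x * (ipoly c x * s) \<in> I"
      using submod_mult[OF xI, of x "ipoly c x * s"] by simp
    then show "(\<Sum>i\<le>degree V. ipoly (h i) x * y ^ Suc i) \<in> J"
      unfolding J_def s_def[symmetric] using s by (simp add: mult.assoc)
    fix t assume t: "t \<in> B"
    have "ipoly ((\<Sum>i\<le>degree V. u i * h i) - 1) x * t \<in> I" by (rule p_mem[OF c(3) t])
    then have "- (ipoly ((\<Sum>i\<le>degree V. u i * h i) - 1) x * t) \<in> I" by (rule submod_minus[OF I(1)])
    then show "t - (\<Sum>i\<le>degree V. ipoly (u i) x * ipoly (h i) x) * t \<in> J"
      using IJ by (auto simp: int_hom.poly_map_diff int_hom.poly_map_sum int_hom.poly_map_mult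
          int_hom.poly_map_1 algebra_simps simp del: map_poly_1)
  qed (use B J JB x y ip in auto)
  then show thesis using that c(1) unfolding J_def by blast
qed

text \<open>The case where \<open>p\<close> acts as zero applies to \<open>I + p B\<close>. Raising
  the resulting equation, scalar included, to the power \<open>Suc k\<close> moves it from
  \<open>I + p B\<close> into \<open>I\<close>; this dictates \<open>c'\<close>.\<close>

lemma fin_sep_imp_integral_prime_power:
  assumes p: "Factorial_Ring.prime p" and fs: "fin_sep I B"
    and B: "submod B B" and I: "submod B I" "I \<subseteq> B"
    and gen: "B \<subseteq> subalg {x, y} + I" and x: "x \<in> B" and y: "y \<in> B"
    and pk: "\<And>b. b \<in> B \<Longrightarrow> of_int p ^ Suc k * b \<in> I"
  obtains c where "\<not> [:p:] dvd c" "integral_mod {x} {t \<in> B. x * ipoly c x * t \<in> I} y"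
proof -
  define I' where "I' = I + (*) (of_int p) ` B"
  have pB_sub: "submod B ((*) (of_int p) ` B)" by (rule submod_image_mult[OF B])
  have I': "submod B I'" unfolding I'_def by (intro submod_plus pB_sub I)
  have II': "I \<subseteq> I'" unfolding I'_def by (rule subset_plusL[OF pB_sub])
  have I'B: "I' \<subseteq> B" unfolding I'_def using submod_of_int[OF B]
    by (intro plus_minimal[OF B] I) auto
  have pB: "of_int p * b \<in> I'" if "b \<in> B" for b
    unfolding I'_def by (rule subset_plusR[OF I(1), THEN subsetD]) (use that in simp)
  have "B \<subseteq> subalg {x, y} + I'" using gen set_plus_mono2[OF order.refl II'] by blast
  then obtain c where c: "\<not> [:p:] dvd c" "integral_mod {x} {t \<in> B. x * ipoly c x * t \<in> I'} y"
    using fin_sep_imp_integral_prime[OF p fin_sep_mono[OF fs I' II' I'B B] B I' I'B _ x y pB]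
    by metis
  have "submod {x} {t \<in> B. x * ipoly c x * t \<in> I'}"
    by (rule submod_antimono[OF submod_vimage_mult[OF B I']]) (use x in simp)
  then obtain m w where w: "w \<in> pow_span {x} y m" "x * ipoly c x * (y ^ Suc m - w) \<in> I'"
    using iffD1[OF integral_mod_iff c(2)] \<open>submod {x} {t \<in> B. x * ipoly c x * t \<in> I'}\<close> by blast
  define c' where "c' = [:0, 1:] ^ k * c ^ Suc k"
  have "x * ipoly c' x = (x * ipoly c x) ^ Suc k"
    unfolding c'_def int_hom.poly_map_mult int_hom.poly_map_power int_hom.poly_map_pCons
    by (simp add: power_mult_distrib mult_ac)
  moreover have "(x * ipoly c x * (y ^ Suc m - w)) ^ Suc k \<in> I"
    by (rule power_mem_of_prime_power[OF B I pk]) (use w(2) in \<open>simp_all only: I'_def\<close>)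
  ultimately have c'_I: "x * ipoly c' x * (y ^ Suc m - w) ^ Suc k \<in> I"
    by (simp only: power_mult_distrib)
  have pow_B: "y ^ Suc i \<in> B" for i using y by (induction i) (auto intro: submod_mult[OF B])
  have xB: "submod {x} B" by (rule submod_antimono[OF B]) (use x in simp)
  have "pow_span {x} y m \<subseteq> B" unfolding pow_span_def using pow_B
    by (intro span_minimal[OF xB]) auto
  then have "y ^ Suc m - w \<in> B" using w(1) pow_B by (intro submod_diff[OF B]) auto
  then have "(y ^ Suc m - w) ^ Suc k \<in> B" by (induction k) (auto intro: submod_mult[OF B])
  then have "(y ^ Suc m - w) ^ Suc k \<in> {t \<in> B. x * ipoly c' x * t \<in> I}" using c'_I by blast
  moreover have "submod {x} {t \<in> B. x * ipoly c' x * t \<in> I}"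
    by (rule submod_antimono[OF submod_vimage_mult[OF B I(1)]]) (use x in simp)
  ultimately have "integral_mod {x} {t \<in> B. x * ipoly c' x * t \<in> I} y"
    using integral_mod_power w(1) by blast
  moreover have "\<not> [:p:] dvd c'"
    unfolding c'_def using prime_const_dvd_mult[OF p] prime_const_dvd_power[OF p] c(1)
      not_const_dvd_X[OF p]
    by blast
  ultimately show thesis using that by blast
qed

text \<open>A linear functional on \<open>\<int>[X] / (p)\<close> which does not vanish on any nonzero ideal, because the
  indicator of the powers of two is not eventually periodic.\<close>

definition pow2_sum :: "int poly \<Rightarrow> int"
  where "pow2_sum v = (\<Sum>i\<le>degree v. coeff v i * of_bool (i = 0 \<or> (\<exists>N. i = 2 ^ N)))"

lemma pow2_sum_eq:
  "degree v \<le> n \<Longrightarrow> pow2_sum v = (\<Sum>i\<le>n. coeff v i * of_bool (i = 0 \<or> (\<exists>N. i = 2 ^ N)))"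
  unfolding pow2_sum_def by (rule sum.mono_neutral_left) (auto simp: coeff_eq_0)

lemma pow2_sum_diff: "pow2_sum (u - v) = pow2_sum u - pow2_sum v"
proof -
  let ?n = "max (degree u) (degree v)"
  have "degree (u - v) \<le> ?n" by (rule degree_diff_le_max)
  then show ?thesis
    by (simp add: pow2_sum_eq[of _ ?n] sum_subtractf left_diff_distrib)
qed

lemma pow2_sum_monom: "pow2_sum (monom 1 k) = of_bool (k = 0 \<or> (\<exists>N. k = 2 ^ N))"
proof -
  have "pow2_sum (monom 1 k) =
    (\<Sum>i\<le>k. (if i = k then 1 else 0) * of_bool (i = 0 \<or> (\<exists>N. i = 2 ^ N)))"
    by (subst pow2_sum_eq[of _ k]) (auto intro!: sum.cong simp: degree_monom_le)
  then show ?thesis by (simp only: sum_kronecker finite_atMost atMost_iff order.refl)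
qed

lemma dvd_pow2_sum: "[:p:] dvd v \<Longrightarrow> p dvd pow2_sum v"
  unfolding pow2_sum_def const_poly_dvd_iff by (intro dvd_sum dvd_mult2) auto

lemma not_power_of_two_between:
  assumes "0 < d" "d < 2 ^ N" shows "2 ^ N + d \<noteq> (2 ^ M :: nat)"
proof
  assume eq: "2 ^ N + d = (2 ^ M :: nat)"
  then have "(2::nat) ^ N < 2 ^ M" "(2::nat) ^ M < 2 ^ Suc N"
    using assms by (linarith, simp only: power_Suc)
  then have "N < M" "M < Suc N"
    by (meson one_less_numeral_iff power_less_imp_less_exp semiring_norm(76))+
  then show False by simp
qed

text \<open>Because \<open>e * e\<close> lies in \<open>I\<close>, any additive subgroup of
  \<int>[x] e gives a subring, whereas \<open>Q\<close> is also stable under multiplication by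
  \<open>x\<close>. The subring \<open>A\<close> is cut out by \<open>pow2_sum\<close>, which
  vanishes on no nonzero ideal modulo \<open>p\<close>, and so \<open>A + Q\<close> always reaches
  \<open>e\<close>.\<close>

lemma fin_sep_imp_not_square_zero:
  assumes p: "Factorial_Ring.prime p" and fs: "fin_sep I B"
    and B: "submod B B" and I: "submod B I" "I \<subseteq> B" and x: "x \<in> B" and e: "e \<in> B"
    and ee: "e * e \<in> I" and tf: "\<And>q. \<not> [:p:] dvd q \<Longrightarrow> ipoly q x * e \<notin> I"
  shows False
proof -
  have xI: "submod {x} I" and xB: "submod {x} B"
    using submod_antimono[OF I(1), of "{x}"] submod_antimono[OF B, of "{x}"] x by auto
  define V where "V = {v. p dvd pow2_sum v}"
  define A where "A = (\<lambda>v. ipoly v x * e) ` V + I"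
  have im: "submod {} ((\<lambda>v. ipoly v x * e) ` V)"
  proof (rule submodI)
    show "0 \<in> (\<lambda>v. ipoly v x * e) ` V"
      by (rule image_eqI[of _ _ 0]) (auto simp: V_def pow2_sum_def)
    show "a - b \<in> (\<lambda>v. ipoly v x * e) ` V"
      if ab: "a \<in> (\<lambda>v. ipoly v x * e) ` V" "b \<in> (\<lambda>v. ipoly v x * e) ` V" for a b
    proof -
      obtain u v where "u \<in> V" "v \<in> V" "a = ipoly u x * e" "b = ipoly v x * e" using ab by blast
      then show ?thesis
        by (intro image_eqI[of _ _ "u - v"])
          (auto simp: V_def pow2_sum_diff int_hom.poly_map_diff left_diff_distrib)
    qed
  qed auto
  have A0: "submod {} A" unfolding A_def by (intro submod_plus im submod_antimono[OF I(1)]) simp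
  have IA: "I \<subseteq> A" unfolding A_def by (rule subset_plusR[OF im])
  have ipe: "ipoly v x * e \<in> B" for v by (rule ipoly_mem[OF xB _ e]) simp
  have AB: "A \<subseteq> B" unfolding A_def using ipe by (intro plus_minimal[OF B] I) auto
  have A: "submod A A"
  proof (rule submodI)
    fix s t assume st: "s \<in> A" "t \<in> A"
    obtain q i where s: "s = ipoly q x * e + i" "i \<in> I"
      using st(1) unfolding A_def by (auto elim!: set_plus_elim)
    obtain q' i' where t: "t = ipoly q' x * e + i'" "i' \<in> I"
      using st(2) unfolding A_def by (auto elim!: set_plus_elim)
    have "ipoly (q * q') x * (e * e) + (ipoly q' x * e * i + s * i') \<in> I"
      using ipoly_mem[OF xI _ ee] submod_mult[OF I(1) ipe s(2)] submod_mult[OF I(1) _ t(2)] st(1)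
        AB
      by (intro submod_add[OF I(1)]) blast+
    then show "s * t \<in> A" unfolding s(1) t(1)
      using IA by (auto simp: int_hom.poly_map_mult algebra_simps)
  qed (use submod_0[OF A0] submod_diff[OF A0] in auto)
  have one: "monom 1 0 = (1 :: int poly)" by (simp add: monom_0)
  \<comment> \<open>Counting the exponent 0 in \<open>pow2_sum\<close> produces this value, which
    keeps \<open>e\<close> out of \<open>A\<close>.\<close>
  have pow2_1: "pow2_sum 1 = 1" using pow2_sum_monom[of 0] by (simp add: one)
  have "e \<notin> A"
  proof
    assume "e \<in> A"
    then obtain v i where v: "v \<in> V" "e = ipoly v x * e + i" "i \<in> I"
      unfolding A_def by (auto elim!: set_plus_elim)
    have "ipoly (1 - v) x * e = i"
      using v(2) by (simp add: int_hom.poly_map_diff int_hom.poly_map_1 algebra_simps del: map_poly_1)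
    then have "[:p:] dvd 1 - v" using tf v(3) by blast
    then have "p dvd 1 - pow2_sum v" using dvd_pow2_sum[of p "1 - v"]
      by (simp add: pow2_sum_diff pow2_1)
    then have "p dvd 1" using v(1) unfolding V_def by (simp add: dvd_diff_left_iff)
    then show False using p not_prime_unit by blast
  qed
  then obtain Q where Q: "submod B Q" "I \<subseteq> Q" "Q \<subseteq> B" "finite_index B Q" "e \<notin> A + Q"
    using fin_sepD[OF fs A IA AB e] by metis
  obtain m d where md: "m > 0" "d > 0" "x ^ (m + d) - x ^ m \<in> Q"
    by (rule finite_index_powers[OF Q(4) B Q(1) x])
  \<comment> \<open>\<open>N\<close> is so large that a shift by \<open>i\<close> moves
    \<open>m\<close> to \<open>2 ^ N\<close> and that \<open>2 ^ N + d\<close> falls strictly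
    between two powers of two. Then \<open>pow2_sum v\<close> is 1 - (1 - 0) = 0.\<close>
  define N where "N = m + d"
  have N: "m \<le> 2 ^ N" "d < 2 ^ N"
    unfolding N_def using less_exp[of "m + d"] by linarith+
  define i where "i = 2 ^ N - m"
  define v where "v = 1 - (monom 1 (m + i) - monom 1 (m + d + i) :: int poly)"
  have eq: "m + i = 2 ^ N" "m + d + i = 2 ^ N + d" unfolding i_def using N by auto
  have "m + i = 0 \<or> (\<exists>M. m + i = 2 ^ M)" using eq(1) by blast
  moreover have "\<not> (m + d + i = 0 \<or> (\<exists>M. m + d + i = 2 ^ M))"
    unfolding eq(2) using not_power_of_two_between[OF md(2) N(2)] by simp
  ultimately have "pow2_sum v = 0"
    unfolding v_def pow2_sum_diff pow2_sum_monom pow2_1 by (simp only: of_bool_eq)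
  then have "v \<in> V" unfolding V_def by simp
  then have "ipoly v x * e \<in> A" unfolding A_def
    by (intro subset_plusL[OF I(1), THEN subsetD] imageI)
  moreover have "(x ^ i * e) * (x ^ (m + d) - x ^ m) \<in> Q"
    using ipe[of "monom 1 i"] by (intro submod_mult[OF Q(1) _ md(3)])
      (simp add: int_hom.poly_map_monom)
  then have "- ((x ^ i * e) * (x ^ (m + d) - x ^ m)) \<in> Q" by (rule submod_minus[OF Q(1)])
  ultimately have "ipoly v x * e + - ((x ^ i * e) * (x ^ (m + d) - x ^ m)) \<in> A + Q"
    by (rule set_plus_intro)
  moreover have "ipoly v x = 1 - (x ^ (m + i) - x ^ (m + d + i))"
    unfolding v_def by (simp add: int_hom.poly_map_diff int_hom.poly_map_monom int_hom.poly_map_1 del: map_poly_1)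
  then have "ipoly v x * e + - ((x ^ i * e) * (x ^ (m + d) - x ^ m)) = e"
    by (simp only:) (simp add: algebra_simps power_add)
  ultimately show False using Q(5) by simp
qed

section \<open>Minimal counterexamples\<close>

definition pairwise_sep :: "'r::comm_ring_1 set \<Rightarrow> 'r set \<Rightarrow> bool"
  where "pairwise_sep I U \<longleftrightarrow> (\<forall>x\<in>U. \<forall>y\<in>U. fin_sep I (subalg {x, y} + I))"

lemma submod_subalg_plus:
  assumes U: "submod U U" "S \<subseteq> U" and I: "submod U I" "I \<subseteq> U"
  shows "subalg S + I \<subseteq> U" "submod (subalg S + I) (subalg S + I)" "submod (subalg S + I) I"
    "I \<subseteq> subalg S + I" "S \<subseteq> subalg S + I"
proof -
  have SU: "subalg S \<subseteq> U" by (rule subalg_minimal[OF U])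
  show BU: "subalg S + I \<subseteq> U" by (rule plus_minimal[OF U(1) SU I(2)])
  show BI: "submod (subalg S + I) I" by (rule submod_antimono[OF I(1) BU])
  show IB: "I \<subseteq> subalg S + I" by (rule subset_plusR[OF submod_subalg])
  have SB: "subalg S \<subseteq> subalg S + I" by (rule subset_plusL[OF I(1)])
  then show "S \<subseteq> subalg S + I" using hull_subset[of S] by blast
  show "submod (subalg S + I) (subalg S + I)"
  proof (rule submod_from_generators[OF order.refl _ IB BI])
    have "S \<subseteq> subalg S" by (rule hull_subset)
    then show "submod S (subalg S + I)"
      using submod_antimono[OF I(1) U(2)] by (intro submod_plus submod_antimono[OF submod_subalg])
  qed
qed

text \<open>Modulo the larger ideal, \<open>x\<close> and \<open>y\<close> generate
  \<open>(B + I) / I\<close>, which is isomorphic to \<open>B / (I \<inter> B)\<close> and thus a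
  quotient of the separable ring \<open>B / I\<^sub>0\<close>. Staying inside \<open>B\<close>
  avoids the isomorphism.\<close>

lemma pairwise_sep_mono:
  assumes pw: "pairwise_sep I\<^sub>0 U" and U: "submod U U" and I0: "submod U I\<^sub>0"
    and I: "submod U I" "I\<^sub>0 \<subseteq> I" "I \<subseteq> U" and xy: "x \<in> U" "y \<in> U"
  shows "\<exists>B. x \<in> B \<and> y \<in> B \<and> submod B B \<and> B \<subseteq> U \<and> submod B (I \<inter> B) \<and>
    B \<subseteq> subalg {x, y} + (I \<inter> B) \<and> fin_sep (I \<inter> B) B"
proof -
  have xyU: "{x, y} \<subseteq> U" and I0U: "I\<^sub>0 \<subseteq> U" using xy I by auto
  define B where "B = subalg {x, y} + I\<^sub>0"
  note B = submod_subalg_plus[OF U xyU I0 I0U, folded B_def]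
  have I': "submod B (I \<inter> B)" by (intro submod_Int submod_antimono[OF I(1) B(1)] B(2))
  have sub: "I\<^sub>0 \<subseteq> I \<inter> B" using I(2) B(4) by blast
  have "fin_sep I\<^sub>0 B" using pw xy unfolding pairwise_sep_def B_def by blast
  then have "fin_sep (I \<inter> B) B" by (rule fin_sep_mono[OF _ I' sub _ B(2)]) simp
  moreover have "B \<subseteq> subalg {x, y} + (I \<inter> B)"
    using set_plus_mono2[OF order.refl sub, of "subalg {x, y}"] B_def by simp
  ultimately show ?thesis using B(1,2,5) I' by blast
qed

text \<open>Over the multipliers \<open>G\<close> each generator is trivially integral, as its
  square is \<open>g * g\<close>. So \<open>subalg G\<close> is a finitely generated
  \<int>[G]-module, which gives Hilbert's basis theorem for a ring without identity.\<close>

lemma noetherian_subalg: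
  assumes "finite G"
  shows "noetherian_between G {0} (subalg G)"
proof -
  have G: "G \<subseteq> subalg G" by (rule hull_subset)
  have int: "integral_mod G {0} g" if "g \<in> G" for g
  proof -
    have "g * g ^ Suc 0 \<in> span G ((\<lambda>j. g ^ Suc j) ` {..<1} \<union> {0})"
      by (intro submod_mult[OF submod_span that] span_base) simp
    then have "g ^ Suc 1 \<in> span G ((\<lambda>j. g ^ Suc j) ` {..<1} \<union> {0})" by simp
    then show ?thesis unfolding integral_mod_def by blast
  qed
  have zero: "{0} \<subseteq> subalg G" using submod_0[OF submod_subalg] by simp
  obtain S where S: "finite S" "S \<subseteq> subalg G" "subalg G = span G (S \<union> {0})"
    by (rule integral_imp_finite_span[OF assms submod_zero zero G int])
  show ?thesis unfolding S(3) by (rule noetherian_between_span_Un[OF assms S(1) submod_zero])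
qed

lemma integral_mod_mono: "integral_mod E I y \<Longrightarrow> I \<subseteq> J \<Longrightarrow> integral_mod E J y"
proof -
  assume "integral_mod E I y" "I \<subseteq> J"
  then obtain m where "y ^ Suc m \<in> span E ((\<lambda>j. y ^ Suc j) ` {..<m} \<union> I)"
    unfolding integral_mod_def by blast
  moreover have "span E ((\<lambda>j. y ^ Suc j) ` {..<m} \<union> I) \<subseteq> span E ((\<lambda>j. y ^ Suc j) ` {..<m} \<union> J)"
    using \<open>I \<subseteq> J\<close> by (intro hull_mono) auto
  ultimately show ?thesis unfolding integral_mod_def by blast
qed

text \<open>A counterexample \<open>(I, A, a)\<close> with \<open>I\<close> maximal.\<close>

locale critical =
  fixes U I A :: "'r::comm_ring_1 set" and a :: 'r and G :: "'r set"
  assumes finite_G: "finite G" and U_def: "U = subalg G"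
    and I: "submod U I" "I \<subseteq> U"
    and pair_ring: "\<lbrakk> x \<in> U; y \<in> U \<rbrakk> \<Longrightarrow> \<exists>B. x \<in> B \<and> y \<in> B \<and> submod B B \<and> B \<subseteq> U \<and> submod B (I \<inter> B) \<and>
      B \<subseteq> subalg {x, y} + (I \<inter> B) \<and> fin_sep (I \<inter> B) B"
    and A: "submod A A" "I \<subseteq> A" "A \<subseteq> U"
    and a: "a \<in> U" "a \<notin> A"
    and near: "\<And>I'. submod U I' \<Longrightarrow> I \<subset> I' \<Longrightarrow> I' \<subseteq> U \<Longrightarrow> a \<in> A + I'"
    and infinite_index: "\<not> finite_index U I"
begin

lemma U: "submod U U" unfolding U_def by simp

lemma G_U: "G \<subseteq> U" unfolding U_def by (rule hull_subset)

lemma scaled_ideal: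
  assumes J: "submod U J" "J \<subseteq> U" and q: "q \<in> span E {1}" "E \<subseteq> U"
  shows "submod U ((*) q ` J + I)" "I \<subseteq> (*) q ` J + I" "(*) q ` J + I \<subseteq> U"
    "\<And>j. j \<in> J \<Longrightarrow> q * j \<in> (*) q ` J + I" "I \<subseteq> J \<Longrightarrow> (*) q ` J + I \<subseteq> J"
proof -
  have qJ: "submod U ((*) q ` J)" by (rule submod_image_mult[OF J(1)])
  then show "submod U ((*) q ` J + I)" by (intro submod_plus I)
  show "I \<subseteq> (*) q ` J + I" by (rule subset_plusR[OF qJ])
  have "q * j \<in> J" if "j \<in> J" for j
    by (rule span_one_mult[OF q(1) submod_antimono[OF J(1) q(2)] that])
  then have sub: "(*) q ` J \<subseteq> J" by blast
  then show "(*) q ` J + I \<subseteq> U" using J(2) by (intro plus_minimal[OF U] I) blast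
  show "q * j \<in> (*) q ` J + I" if "j \<in> J" for j
    using that by (intro subset_plusL[OF I(1), THEN subsetD] imageI)
  show "(*) q ` J + I \<subseteq> J" if "I \<subseteq> J" using sub that by (intro plus_minimal[OF J(1)])
qed

lemma near_element:
  assumes J: "submod U J" "I \<subset> J" "J \<subseteq> U"
  obtains j where "j \<in> J" "j \<notin> A"
    "\<forall>I'. submod U I' \<longrightarrow> I \<subset> I' \<longrightarrow> I' \<subseteq> U \<longrightarrow> j \<in> A + I'"
proof -
  obtain \<alpha> j where j: "a = \<alpha> + j" "\<alpha> \<in> A" "j \<in> J" using near[OF J] by (rule set_plus_elim)
  have "j \<notin> A" using submod_add[OF A(1) j(2)] j(1) a(2) by blast
  moreover have "j \<in> A + I'" if I': "submod U I'" "I \<subset> I'" "I' \<subseteq> U" for I'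
  proof -
    obtain \<beta> i where i: "a = \<beta> + i" "\<beta> \<in> A" "i \<in> I'" using near[OF I'] by (rule set_plus_elim)
    have "(\<beta> - \<alpha>) + i \<in> A + I'" using submod_diff[OF A(1) i(2) j(2)] i(3) by (rule set_plus_intro)
    moreover have "(\<beta> - \<alpha>) + i = j" using i(1) j(1) by (simp add: algebra_simps)
    ultimately show ?thesis by simp
  qed
  ultimately show thesis using that j(3) by blast
qed

text \<open>As \<open>E \<subseteq> A\<close>, the intersection \<open>A \<inter> J\<close> is a
  module, and some \<open>q J\<close> separates from it an element \<open>j\<close> of
  \<open>J\<close> outside \<open>A\<close>. If \<open>q J + I\<close> were larger than
  \<open>I\<close>, then \<open>j\<close> would lie in \<open>A + q J\<close>, and its component in
  \<open>A\<close> would belong to \<open>J\<close>, against the separation.\<close>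

lemma scalar_kills:
  assumes J: "submod U J" "I \<subset> J" "J \<subseteq> U" and noe: "noetherian_between E I J" and E: "E \<subseteq> A"
    and \<Gamma>: "\<Gamma> \<subseteq> span E {1}" "\<And>r k. r \<in> \<Gamma> \<Longrightarrow> r ^ k \<in> \<Gamma>"
    and r\<^sub>0: "r\<^sub>0 \<in> \<Gamma>" "\<And>s. s \<in> span E {1} \<Longrightarrow> 1 - s * r\<^sub>0 \<in> \<Gamma>"
  obtains q where "q \<in> \<Gamma>" "\<forall>j\<in>J. q * j \<in> I"
proof -
  obtain j where j: "j \<in> J" "j \<notin> A"
    "\<forall>I'. submod U I' \<longrightarrow> I \<subset> I' \<longrightarrow> I' \<subseteq> U \<longrightarrow> j \<in> A + I'"
    by (rule near_element[OF J])
  have EU: "E \<subseteq> U" using E A(3) by blast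
  have EJ: "submod E J" by (rule submod_antimono[OF J(1) EU])
  have AJ: "submod E (A \<inter> J)" by (intro submod_Int submod_antimono[OF A(1) E] EJ)
  have "noetherian_between E (A \<inter> J) J"
    using noetherian_between_mono[OF noe order.refl, of "A \<inter> J"] J(2) A(2) by blast
  then obtain q where q: "q \<in> \<Gamma>" "j \<notin> A \<inter> J + (*) q ` J"
    using noetherian_separate[OF _ AJ _ EJ j(1) _ \<Gamma> r\<^sub>0] j(2) by blast
  have q1: "q \<in> span E {1}" using q(1) \<Gamma>(1) by blast
  note I' = scaled_ideal[OF J(1,3) q1 EU]
  have IJ: "I \<subseteq> J" using J(2) by blast
  have "\<not> I \<subset> (*) q ` J + I"
  proof
    assume "I \<subset> (*) q ` J + I"
    then have "j \<in> A + ((*) q ` J + I)" by (rule j(3)[rule_format, OF I'(1) _ I'(3)])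
    then obtain \<alpha> t i where t: "j = \<alpha> + (q * t + i)" "\<alpha> \<in> A" "t \<in> J" "i \<in> I"
      by (auto elim!: set_plus_elim)
    have "q * t \<in> J" by (rule span_one_mult[OF q1 EJ t(3)])
    then have "j - q * t \<in> J" using j(1) by (intro submod_diff[OF J(1)])
    moreover have "\<alpha> + i \<in> A" using submod_add[OF A(1) t(2)] t(4) A(2) by blast
    moreover have "\<alpha> + i = j - q * t" using t(1) by (simp add: algebra_simps)
    ultimately have "(j - q * t) + q * t \<in> A \<inter> J + (*) q ` J" using t(3)
      by (intro set_plus_intro) auto
    then show False using q(2) by simp
  qed
  then have "(*) q ` J + I = I" using I'(2) by blast
  then show thesis using that[OF q(1)] I'(4) by blast
qed

text \<open>Modulo the elements \<open>J\<^sub>c\<close> that \<open>c\<close> sends into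
  \<open>I\<close>, the ring \<open>U\<close> is a finite module, and multiplication by
  \<open>c\<close> carries \<open>U / J\<^sub>c\<close> onto the module in question.\<close>

lemma integral_generators:
  assumes E: "finite E" "E \<subseteq> U"
    and int: "\<And>g. g \<in> G \<Longrightarrow> integral_mod E {t \<in> U. c * t \<in> I} g"
  shows "noetherian_between E I ((*) c ` U + I)"
proof -
  define J\<^sub>c where "J\<^sub>c = {t \<in> U. c * t \<in> I}"
  have Jc: "submod U J\<^sub>c" unfolding J\<^sub>c_def by (rule submod_vimage_mult[OF U I(1)])
  have JcU: "J\<^sub>c \<subseteq> U" unfolding J\<^sub>c_def by blast
  obtain S where S: "finite S" "S \<subseteq> U" "U = span E (S \<union> J\<^sub>c)"
    by (rule integral_imp_finite_span[OF finite_G, folded U_def, OF Jc JcU E(2) int[folded J\<^sub>c_def]])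
  have EU: "submod E U" by (rule submod_antimono[OF U E(2)])
  have "noetherian_between E J\<^sub>c U"
    by (subst S(3)) (rule noetherian_between_span_Un[OF E(1) S(1) submod_antimono[OF Jc E(2)]])
  then show ?thesis
    by (rule noetherian_between_image_mult[OF _ EU submod_antimono[OF I(1) E(2)]])
      (auto simp: J\<^sub>c_def)
qed

end

section \<open>Torsion of prime power exponent\<close>

context critical
begin

text \<open>The product \<open>C\<close> of the integers belonging to the generators serves all of
  them, so \<open>C U\<close> is a Noetherian abelian group modulo \<open>I\<close>. By
  \<open>scalar_kills\<close> a nonzero integer annihilates it.\<close>

lemma torsion_bounded:
  obtains d :: nat where "d > 0" "\<forall>u\<in>U. of_nat d * u \<in> I"
proof -
  have "\<exists>c::int. c \<noteq> 0 \<and> integral_mod {} {t \<in> U. of_int c * t \<in> I} g" if "g \<in> G" for g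
  proof -
    have "g \<in> U" using G_U that by blast
    then obtain B where B: "g \<in> B" "submod B B" "B \<subseteq> U" "submod B (I \<inter> B)"
      "B \<subseteq> subalg {g} + (I \<inter> B)" "fin_sep (I \<inter> B) B"
      using pair_ring[of g g] by auto
    obtain c :: int where "c \<noteq> 0" "integral_mod {} {t \<in> B. of_int c * t \<in> I \<inter> B} g"
      by (rule fin_sep_imp_integral_int[OF B(6,2,4) _ B(5,1)]) simp
    moreover have "{t \<in> B. of_int c * t \<in> I \<inter> B} \<subseteq> {t \<in> U. of_int c * t \<in> I}"
      using B(3) by blast
    ultimately show ?thesis using integral_mod_mono by blast
  qed
  then obtain c :: "'r \<Rightarrow> int" where c: "\<And>g. g \<in> G \<Longrightarrow> c g \<noteq> 0"
    "\<And>g. g \<in> G \<Longrightarrow> integral_mod {} {t \<in> U. of_int (c g) * t \<in> I} g" by metis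
  define C where "C = prod c G"
  have "C \<noteq> 0" unfolding C_def using c(1) finite_G by simp
  have int: "integral_mod {} {t \<in> U. of_int C * t \<in> I} g" if g: "g \<in> G" for g
  proof (rule integral_mod_mono[OF c(2)[OF g]], safe)
    fix t assume "t \<in> U" "of_int (c g) * t \<in> I"
    then have "of_int (prod c (G - {g})) * (of_int (c g) * t) \<in> I"
      by - (rule submod_of_int[OF I(1)])
    then show "of_int C * t \<in> I"
      unfolding C_def prod.remove[OF finite_G g] by (simp add: mult_ac)
  qed
  define J where "J = (*) (of_int C) ` U + I"
  note J = scaled_ideal[OF U order.refl of_int_mem_span_one[of C "{}"] empty_subsetI, folded J_def]
  have noe: "noetherian_between {} I J"
    unfolding J_def by (rule integral_generators[OF _ _ int]) simp_all
  have "\<exists>n::int. n \<noteq> 0 \<and> (\<forall>u\<in>U. of_int n * u \<in> I)"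
  proof (cases "J = I")
    case True
    then show ?thesis using J(4) \<open>C \<noteq> 0\<close> by auto
  next
    case False
    then have "I \<subset> J" using J(2) by blast
    then obtain q where q: "q \<in> {of_int n | n. n \<noteq> 0}" "\<forall>j\<in>J. q * j \<in> I"
    proof (rule scalar_kills[OF J(1) _ J(3) noe])
      show "{of_int n | n. n \<noteq> 0} \<subseteq> span {} {1::'r}" using of_int_mem_span_one by blast
      show "r ^ k \<in> {of_int n | n. n \<noteq> 0}" if "r \<in> {of_int n | n. n \<noteq> 0}" for r :: 'r and k
      proof -
        obtain n where n: "r = of_int n" "n \<noteq> 0" using \<open>r \<in> {of_int n | n. n \<noteq> 0}\<close> by blast
        then have "r ^ k = of_int (n ^ k)" "n ^ k \<noteq> 0" by auto
        then show ?thesis by blast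
      qed
      \<comment> \<open>\<open>r\<^sub>0 = 2\<close> is admissible because \<open>1 - n * 2\<close>
        is a nonzero integer. The scalars are images of nonzero integers and may themselves vanish
        in the ring.\<close>
      have "(2::'r) = of_int 2" by simp
      then show "(2::'r) \<in> {of_int n | n. n \<noteq> 0}" by (intro CollectI exI[of _ 2]) simp
      show "1 - s * 2 \<in> {of_int n | n. n \<noteq> 0}" if s: "s \<in> span {} {1::'r}" for s
      proof -
        obtain n :: int where "s = of_int n" using s unfolding span_empty_singleton by auto
        then have "1 - s * 2 = of_int (1 - n * 2)" by simp
        moreover have "1 - n * 2 \<noteq> 0" by presburger
        ultimately show ?thesis by blast
      qed
    qed (simp, blast)
    then obtain n where n: "n \<noteq> 0" "q = of_int n" by blast
    have "of_int (n * C) * u \<in> I" if "u \<in> U" for u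
      using bspec[OF q(2) J(4)[OF that]] n by (simp add: mult.assoc)
    then show ?thesis using n(1) \<open>C \<noteq> 0\<close> by (intro exI[of _ "n * C"]) simp
  qed
  then obtain n :: int where n: "n \<noteq> 0" "\<And>u. u \<in> U \<Longrightarrow> of_int n * u \<in> I" by blast
  have "of_nat (nat \<bar>n\<bar>) * u \<in> I" if u: "u \<in> U" for u
  proof (cases "n > 0")
    case True
    then show ?thesis using n(2)[OF u] by simp
  next
    case False
    then have "of_nat (nat \<bar>n\<bar>) * u = - (of_int n * u)" by simp
    then show ?thesis using submod_minus[OF I(1) n(2)[OF u]] by simp
  qed
  then show thesis using that[of "nat \<bar>n\<bar>"] n(1) by simp
qed

text \<open>Let \<open>d\<close> be the least exponent. If \<open>d = p ^ n * e\<close> with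
  \<open>e > 1\<close> prime to \<open>p\<close>, both torsion parts \<open>U\<^sub>1\<close> and
  \<open>U\<^sub>2\<close> exceed \<open>I\<close> by minimality of \<open>d\<close>. As
  \<open>a\<close> lies in \<open>A + U\<^sub>1\<close> and in \<open>A + U\<^sub>2\<close>, both
  \<open>p ^ n * a\<close> and \<open>e * a\<close> are in \<open>A\<close>, and by Bezout so is
  \<open>a\<close>.\<close>

lemma prime_power_torsion:
  obtains p :: int and k where "Factorial_Ring.prime p" "\<forall>u\<in>U. of_int p ^ Suc k * u \<in> I"
proof -
  define P where "P d \<longleftrightarrow> d > 0 \<and> (\<forall>u\<in>U. of_nat d * u \<in> I)" for d :: nat
  define d where "d = (LEAST d. P d)"
  have "\<exists>d. P d" using torsion_bounded unfolding P_def by metis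
  then have Pd: "P d" unfolding d_def by (rule LeastI_ex)
  have min: "\<not> P m" if "m < d" for m using that not_less_Least unfolding d_def by blast
  have "d \<noteq> 1"
  proof
    assume "d = 1"
    then have "a \<in> I" using Pd a(1) unfolding P_def by simp
    then show False using a(2) A(2) by blast
  qed
  then obtain p where p: "Factorial_Ring.prime p" "p dvd d" using prime_factor_nat by blast
  obtain e where e: "d = p ^ multiplicity p d * e" "\<not> p dvd e"
    using multiplicity_decompose'[of d p] Pd p(1) unfolding P_def
    by (metis not_prime_unit bot_nat_0.not_eq_extremum)
  define n where "n = multiplicity p d"
  have n: "n > 0" unfolding n_def using p Pd unfolding P_def
    by (simp add: prime_multiplicity_gt_zero_iff)
  have de: "d = p ^ n * e" using e(1) unfolding n_def .
  have pos: "e > 0" "p ^ n > 0" using de Pd unfolding P_def by (auto intro: Nat.gr0I)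
  have "e = 1"
  proof (rule ccontr)
    assume "e \<noteq> 1"
    then have "e \<ge> 2" using pos by linarith
    have "p ^ n \<ge> 2" using prime_ge_2_nat[OF p(1)] n self_le_power[of p n] by linarith
    have "e < d" "p ^ n < d"
      using de pos mult_le_mono1[OF \<open>p ^ n \<ge> 2\<close>, of e] mult_le_mono2[OF \<open>e \<ge> 2\<close>, of "p ^ n"]
      by linarith+
    define U\<^sub>1 U\<^sub>2 where "U\<^sub>1 = {u \<in> U. of_nat (p ^ n) * u \<in> I}" and
      "U\<^sub>2 = {u \<in> U. of_nat e * u \<in> I}"
    have sub: "submod U U\<^sub>1" "submod U U\<^sub>2" unfolding U\<^sub>1_def U\<^sub>2_def
      by (rule submod_vimage_mult[OF U I(1)])+
    have IU: "I \<subseteq> U\<^sub>1" "I \<subseteq> U\<^sub>2" unfolding U\<^sub>1_def U\<^sub>2_def using I submod_of_nat[OF I(1)]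
      by (auto simp del: of_nat_power)
    have UU: "U\<^sub>1 \<subseteq> U" "U\<^sub>2 \<subseteq> U" unfolding U\<^sub>1_def U\<^sub>2_def by auto
    have dU: "of_nat (p ^ n) * (of_nat e * u) \<in> I" if "u \<in> U" for u
      using Pd that unfolding P_def de by (simp add: mult.assoc)
    have "U\<^sub>1 \<noteq> I"
    proof
      assume "U\<^sub>1 = I"
      have "of_nat e * u \<in> U\<^sub>1" if "u \<in> U" for u
        unfolding U\<^sub>1_def using dU that submod_of_nat[OF U that] by blast
      then have "P e" unfolding P_def using pos \<open>U\<^sub>1 = I\<close> by blast
      then show False using min \<open>e < d\<close> by blast
    qed
    have "U\<^sub>2 \<noteq> I"
    proof
      assume "U\<^sub>2 = I"
      have "of_nat (p ^ n) * u \<in> U\<^sub>2" if "u \<in> U" for u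
        unfolding U\<^sub>2_def using dU[OF that] submod_of_nat[OF U that]
        by (auto simp: mult_ac simp del: of_nat_power)
      then have "P (p ^ n)" unfolding P_def using pos \<open>U\<^sub>2 = I\<close> by blast
      then show False using min \<open>p ^ n < d\<close> by blast
    qed
    have mult_A: "of_nat l * a \<in> A" if V: "a \<in> A + V" "\<And>v. v \<in> V \<Longrightarrow> of_nat l * v \<in> I" for l V
    proof -
      obtain \<alpha> v where v: "a = \<alpha> + v" "\<alpha> \<in> A" "v \<in> V" using V(1) by (rule set_plus_elim)
      show ?thesis unfolding v(1) distrib_left
        using submod_of_nat[OF A(1) v(2)] V(2)[OF v(3)] A(2) by (intro submod_add[OF A(1)]) auto
    qed
    have "of_nat (p ^ n) * a \<in> A"
      using near[OF sub(1) _ UU(1)] IU \<open>U\<^sub>1 \<noteq> I\<close> by (intro mult_A[of U\<^sub>1]) (auto simp: U\<^sub>1_def)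
    moreover have "of_nat e * a \<in> A"
      using near[OF sub(2) _ UU(2)] IU \<open>U\<^sub>2 \<noteq> I\<close> by (intro mult_A[of U\<^sub>2]) (auto simp: U\<^sub>2_def)
    moreover have "coprime (int (p ^ n)) (int e)"
      using prime_imp_coprime[OF p(1) e(2)] by (simp add: coprime_int_iff)
    then obtain s t where st: "s * int (p ^ n) + t * int e = 1"
      using bezout_int[of "int (p ^ n)" "int e"] by auto
    ultimately have "of_int s * (of_nat (p ^ n) * a) + of_int t * (of_nat e * a) \<in> A"
      by (intro submod_add[OF A(1)] submod_of_int[OF A(1)])
    moreover have "of_int s * (of_nat (p ^ n) * a) + of_int t * (of_nat e * a)
      = of_int (s * int (p ^ n) + t * int e) * a"
      by (simp add: algebra_simps)
    ultimately show False using a(2) unfolding st by simp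
  qed
  then have "\<forall>u\<in>U. of_int (int p) ^ Suc (n - 1) * u \<in> I" using Pd de n unfolding P_def by simp
  moreover have "Factorial_Ring.prime (int p)" using p(1) by simp
  ultimately show thesis using that by blast
qed

end

section \<open>Transcendental elements and the algebraicity of \<open>A\<close>\<close>

locale critical_prime = critical U I A a G
  for U I A :: "'r::comm_ring_1 set" and a G +
  fixes p :: int and k :: nat
  assumes p: "Factorial_Ring.prime p" and pk: "\<And>u. u \<in> U \<Longrightarrow> of_int p ^ Suc k * u \<in> I"
begin

text \<open>Otherwise all generators are integral over \<int>, and \<open>U / I\<close> is a
  finitely generated abelian group killed by \<open>p ^ Suc k\<close>, hence finite.\<close>

lemma exists_transc: obtains x where "x \<in> U" "transc p I x"
proof (rule ccontr)
  assume "\<not> thesis"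
  then have alg: "\<not> transc p I g" if "g \<in> G" for g
    using G_U \<open>\<And>x. x \<in> U \<Longrightarrow> transc p I x \<Longrightarrow> thesis\<close> that by blast
  have int: "integral_mod {} I g" if "g \<in> G" for g
    using algebraic_imp_integral[OF p U I _ pk alg[OF that]] G_U that by blast
  obtain S where S: "finite S" "S \<subseteq> U" "U = span {} (S \<union> I)"
    by (rule integral_imp_finite_span[OF finite_G, folded U_def, OF I empty_subsetI int])
  have "finite_index (span {} (S \<union> I)) I"
  proof (rule finite_index_span[OF S(1) submod_antimono[OF I(1)], of "p ^ Suc k"])
    show "p ^ Suc k > 0" using p prime_gt_0_int by simp
    show "of_int (p ^ Suc k) * s \<in> I" if "s \<in> S" for s using pk[of s] S(2) that by auto
  qed simp
  then show False using infinite_index S(3) by simp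
qed

text \<open>Stand-ins for the nonzero elements of \<open>(\<int>/p)[x]\<close>, to be used as
  \<Gamma> in \<open>noetherian_separate\<close>. Nonvanishing is asked of the polynomial modulo
  \<open>p\<close>, not of its value.\<close>

definition nonzero_scalars :: "'r \<Rightarrow> 'r set"
  where "nonzero_scalars x = {ipoly q x | q. \<not> [:p:] dvd q}"

lemma nonzero_scalars:
  shows "nonzero_scalars x \<subseteq> span {x} {1}"
    and "r \<in> nonzero_scalars x \<Longrightarrow> r ^ n \<in> nonzero_scalars x"
    and "r \<in> nonzero_scalars x \<Longrightarrow> s \<in> nonzero_scalars x \<Longrightarrow> r * s \<in> nonzero_scalars x"
    and "x \<in> nonzero_scalars x"
    and "s \<in> span {x} {1} \<Longrightarrow> 1 - s * x \<in> nonzero_scalars x"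
proof -
  show "nonzero_scalars x \<subseteq> span {x} {1}" unfolding nonzero_scalars_def span_ipoly by blast
  show "r ^ n \<in> nonzero_scalars x" if "r \<in> nonzero_scalars x" for r
    using that prime_const_dvd_power[OF p] unfolding nonzero_scalars_def
    by (auto simp flip: int_hom.poly_map_power)
  show "r * s \<in> nonzero_scalars x" if "r \<in> nonzero_scalars x" "s \<in> nonzero_scalars x" for r s
    using that prime_const_dvd_mult[OF p] unfolding nonzero_scalars_def
    by (auto simp flip: int_hom.poly_map_mult)
  have "ipoly [:0, 1:] x = x" by (simp add: int_hom.poly_map_pCons)
  then show "x \<in> nonzero_scalars x"
    unfolding nonzero_scalars_def using not_const_dvd_X[OF p]
    by (metis (mono_tags, lifting) mem_Collect_eq)
  show "1 - s * x \<in> nonzero_scalars x" if s: "s \<in> span {x} {1}" for s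
  proof -
    obtain q where q: "s = ipoly q x" using s unfolding span_ipoly by blast
    have "\<not> [:p:] dvd 1 - pCons 0 q"
    proof
      assume "[:p:] dvd 1 - pCons 0 q"
      then have "p dvd coeff (1 - pCons 0 q) 0" unfolding const_poly_dvd_iff by blast
      then show False using p not_prime_unit by auto
    qed
    moreover have "ipoly (1 - pCons 0 q) x = 1 - s * x" unfolding q
      by (simp add: int_hom.poly_map_diff int_hom.poly_map_pCons int_hom.poly_map_1 mult.commute del: map_poly_1)
    ultimately show ?thesis unfolding nonzero_scalars_def
      by (metis (mono_tags, lifting) mem_Collect_eq)
  qed
qed

lemma transc_iff: "transc p I x \<longleftrightarrow> (\<forall>q\<in>nonzero_scalars x. q * x \<notin> I)"
  unfolding transc_def nonzero_scalars_def by (auto simp: mult.commute)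

text \<open>The scalars belonging to the generators are multiplied together, as in
  \<open>torsion_bounded\<close>. Since \<open>x\<close> is transcendental, \<open>C * x\<close>
  lies in the ideal but not in \<open>I\<close>.\<close>

lemma noetherian_ideal:
  assumes x: "x \<in> U" "transc p I x"
  obtains J where "submod U J" "I \<subset> J" "J \<subseteq> U" "noetherian_between {x} I J"
    "\<exists>q\<in>nonzero_scalars x. q * x \<in> J"
proof -
  have "\<exists>c. \<not> [:p:] dvd c \<and> integral_mod {x} {t \<in> U. x * ipoly c x * t \<in> I} g" if "g \<in> G" for g
  proof -
    have "g \<in> U" using G_U that by blast
    then obtain B where B: "x \<in> B" "g \<in> B" "submod B B" "B \<subseteq> U" "submod B (I \<inter> B)"
      "B \<subseteq> subalg {x, g} + (I \<inter> B)" "fin_sep (I \<inter> B) B"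
      using pair_ring[OF x(1), of g] by auto
    have pkB: "of_int p ^ Suc k * b \<in> I \<inter> B" if "b \<in> B" for b
      using pk[of b] submod_of_int[OF B(3) that, of "p ^ Suc k"] that B(4) by auto
    obtain c where "\<not> [:p:] dvd c" "integral_mod {x} {t \<in> B. x * ipoly c x * t \<in> I \<inter> B} g"
      by (rule fin_sep_imp_integral_prime_power[OF p B(7,3,5) _ B(6,1,2) pkB]) simp
    moreover have "{t \<in> B. x * ipoly c x * t \<in> I \<inter> B} \<subseteq> {t \<in> U. x * ipoly c x * t \<in> I}"
      using B(4) by blast
    ultimately show ?thesis using integral_mod_mono by blast
  qed
  then obtain c where c: "\<And>g. g \<in> G \<Longrightarrow> \<not> [:p:] dvd c g"
    "\<And>g. g \<in> G \<Longrightarrow> integral_mod {x} {t \<in> U. x * ipoly (c g) x * t \<in> I} g" by metis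
  define f where "f g = x * ipoly (c g) x" for g
  define C where "C = prod f G"
  have f: "f g \<in> nonzero_scalars x" if "g \<in> G" for g
    unfolding f_def using c(1)[OF that]
    by (intro nonzero_scalars(3,4)) (auto simp: nonzero_scalars_def)
  have one: "1 \<in> nonzero_scalars x"
    using nonzero_scalars(2)[OF nonzero_scalars(4), where n = 0] by simp
  have prod_f: "prod f H \<in> nonzero_scalars x" if "H \<subseteq> G" for H
    using that f by (induction H rule: infinite_finite_induct) (auto simp: one nonzero_scalars(3))
  have C: "C \<in> nonzero_scalars x" unfolding C_def by (rule prod_f) simp
  have xI: "submod {x} I" by (rule submod_antimono[OF I(1)]) (use x in simp)
  have int: "integral_mod {x} {t \<in> U. C * t \<in> I} g" if g: "g \<in> G" for g
  proof (rule integral_mod_mono[OF c(2)[OF g]], safe)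
    fix t assume "t \<in> U" "x * ipoly (c g) x * t \<in> I"
    moreover have "prod f (G - {g}) \<in> span {x} {1}" using prod_f nonzero_scalars(1) by blast
    ultimately have "prod f (G - {g}) * (f g * t) \<in> I"
      unfolding f_def by - (rule span_one_mult[OF _ xI])
    then show "C * t \<in> I" unfolding C_def prod.remove[OF finite_G g] by (simp add: mult_ac)
  qed
  define J where "J = (*) C ` U + I"
  have C1: "C \<in> span {x} {1}" using C nonzero_scalars(1) by blast
  have xU: "{x} \<subseteq> U" using x by simp
  note J = scaled_ideal[OF U order.refl C1 xU, folded J_def]
  have "noetherian_between {x} I J"
    unfolding J_def by (rule integral_generators[OF _ xU int]) simp_all
  moreover have "C * x \<in> J" "C * x \<notin> I" using J(4)[OF x(1)] x(2) C unfolding transc_iff by auto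
  ultimately show thesis using that[OF J(1) _ J(3)] J(2) C by blast
qed

text \<open>For \<open>x\<close> in \<open>A\<close> the intersection with \<open>A\<close> is a
  \<int>[x]-module, so \<open>scalar_kills\<close> yields a nonzero scalar killing \<open>J\<close>.
  But \<open>J\<close> contains a multiple \<open>r * x\<close> with a nonzero scalar
  \<open>r\<close>, and \<open>x\<close> would become algebraic.\<close>

lemma not_transc:
  assumes "x \<in> A" shows "\<not> transc p I x"
proof
  assume tr: "transc p I x"
  have xU: "x \<in> U" using assms A(3) by blast
  obtain J where J: "submod U J" "I \<subset> J" "J \<subseteq> U" "noetherian_between {x} I J"
    "\<exists>q\<in>nonzero_scalars x. q * x \<in> J"
    by (rule noetherian_ideal[OF xU tr])
  have xA: "{x} \<subseteq> A" using assms by simp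
  obtain q where q: "q \<in> nonzero_scalars x" "\<forall>j\<in>J. q * j \<in> I"
    by (rule scalar_kills[OF J(1-4) xA nonzero_scalars(1,2) nonzero_scalars(4,5)])
  obtain r where r: "r \<in> nonzero_scalars x" "r * x \<in> J" using J(5) by blast
  then have "(q * r) * x \<in> I" using q(2) by (auto simp: mult.assoc)
  then show False using tr nonzero_scalars(3)[OF q(1) r(1)] unfolding transc_iff by blast
qed

end

section \<open>A torsion-free ideal\<close>

context critical_prime
begin

lemma torsion_free_ideal:
  assumes x: "x \<in> U" "transc p I x"
  obtains J where "submod U J" "I \<subset> J" "J \<subseteq> U" "noetherian_between {x} I J"
    "\<forall>t\<in>J. of_int p * t \<in> I" "\<forall>t\<in>J. \<forall>q\<in>nonzero_scalars x. q * t \<in> I \<longrightarrow> t \<in> I"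
proof -
  obtain J where J: "submod U J" "I \<subset> J" "J \<subseteq> U" "noetherian_between {x} I J"
    "\<exists>q\<in>nonzero_scalars x. q * x \<in> J"
    by (rule noetherian_ideal[OF x])
  have xU: "{x} \<subseteq> U" using x by simp
  have xJ: "submod {x} J" and xI: "submod {x} I"
    by (rule submod_antimono[OF J(1) xU], rule submod_antimono[OF I(1) xU])
  have scal: "q * t \<in> I" if "q \<in> nonzero_scalars x" "t \<in> I" for q t
    using span_one_mult[OF _ xI that(2)] nonzero_scalars(1) that(1) by blast
  define M where "M q = {t \<in> J. q * t \<in> I}" for q
  have M_sub: "submod {x} (M q)" for q unfolding M_def by (rule submod_vimage_mult[OF xJ xI])
  have M_I: "I \<subseteq> M q" if "q \<in> nonzero_scalars x" for q unfolding M_def using J(2) scal that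
    by blast
  have M_J: "M q \<subseteq> J" for q unfolding M_def by blast
  \<comment> \<open>\<open>M q\<close> consists of the elements killed by \<open>q\<close>. If
    \<open>M q\<^sub>0\<close> is maximal, then
    \<open>M q \<subseteq> M (q * q\<^sub>0) = M q\<^sub>0\<close> for all \<open>q\<close>, so
    \<open>q\<^sub>0\<close> kills all torsion and \<open>q\<^sub>0 J\<close> is torsion-free modulo
    \<open>I\<close>.\<close>
  obtain N where N: "\<exists>q\<in>nonzero_scalars x. N = M q"
    and max: "\<And>N'. submod {x} N' \<Longrightarrow> N \<subset> N' \<Longrightarrow> N' \<subseteq> J \<Longrightarrow> \<not> (\<exists>q\<in>nonzero_scalars x. N' = M q)"
  proof (rule noetherian_maximal[OF J(4) M_sub M_I[OF nonzero_scalars(4)] M_J,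
        of "\<lambda>N. \<exists>q\<in>nonzero_scalars x. N = M q"])
    show "\<exists>q\<in>nonzero_scalars x. M x = M q" using nonzero_scalars(4) by blast
    fix N
    assume "\<exists>q\<in>nonzero_scalars x. N = M q"
      "\<And>N'. submod {x} N' \<Longrightarrow> N \<subset> N' \<Longrightarrow> N' \<subseteq> J \<Longrightarrow> \<not> (\<exists>q\<in>nonzero_scalars x. N' = M q)"
    then show thesis by (rule that)
  qed
  obtain q\<^sub>0 where q0: "q\<^sub>0 \<in> nonzero_scalars x" "N = M q\<^sub>0" using N by blast
  have kill: "q\<^sub>0 * t \<in> I" if t: "t \<in> J" "q \<in> nonzero_scalars x" "q * t \<in> I" for q t
  proof -
    have qq: "q * q\<^sub>0 \<in> nonzero_scalars x" by (rule nonzero_scalars(3)[OF t(2) q0(1)])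
    have "N \<subseteq> M (q * q\<^sub>0)" unfolding q0(2) M_def using scal[OF t(2)] by (auto simp: mult.assoc)
    then have "M (q * q\<^sub>0) = N" using max[OF M_sub _ M_J] qq by blast
    moreover have "t \<in> M (q * q\<^sub>0)"
      unfolding M_def using t scal[OF q0(1) t(3)] by (simp add: mult_ac)
    ultimately show ?thesis unfolding q0(2) M_def by blast
  qed
  define J\<^sub>1 where "J\<^sub>1 = (*) q\<^sub>0 ` J + I"
  have q01: "q\<^sub>0 \<in> span {x} {1}" using q0(1) nonzero_scalars(1) by blast
  have IJ: "I \<subseteq> J" using J(2) by blast
  note J1 = scaled_ideal[OF J(1,3) q01 xU, folded J\<^sub>1_def]
  have tf: "t \<in> I" if t: "t \<in> J\<^sub>1" "q \<in> nonzero_scalars x" "q * t \<in> I" for t q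
  proof -
    obtain j i where j: "t = q\<^sub>0 * j + i" "j \<in> J" "i \<in> I"
      using t(1) unfolding J\<^sub>1_def by (auto elim!: set_plus_elim)
    have "q * t - q * i \<in> I" by (intro submod_diff[OF I(1)] scal t j)
    then have "(q * q\<^sub>0) * j \<in> I" unfolding j(1) by (simp add: algebra_simps)
    then have "q\<^sub>0 * j \<in> I" using kill[OF j(2) nonzero_scalars(3)[OF t(2) q0(1)]] by blast
    then show ?thesis unfolding j(1) using submod_add[OF I(1)] j(3) by blast
  qed
  have "\<not> J\<^sub>1 \<subseteq> I"
  proof
    assume J1I: "J\<^sub>1 \<subseteq> I"
    obtain r where r: "r \<in> nonzero_scalars x" "r * x \<in> J" using J(5) by blast
    have "(q\<^sub>0 * r) * x \<in> I" using J1(4)[OF r(2)] J1I by (auto simp: mult.assoc)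
    then show False using x(2) nonzero_scalars(3)[OF q0(1) r(1)] unfolding transc_iff by blast
  qed
  \<comment> \<open>The last multiple \<open>p ^ l J\<^sub>1\<close> not contained in
    \<open>I\<close> is the ideal sought: it is nonzero modulo \<open>I\<close>, and
    \<open>p\<close> kills it.\<close>
  define P where "P l \<longleftrightarrow> (\<forall>t\<in>J\<^sub>1. of_int p ^ l * t \<in> I)" for l
  have "P (Suc k)" unfolding P_def using pk J1(3) by blast
  moreover have "\<not> P 0" unfolding P_def using \<open>\<not> J\<^sub>1 \<subseteq> I\<close> by auto
  ultimately obtain l where l: "\<not> P l" "P (Suc l)" using dec_induct[of 0 "Suc k" "\<lambda>l. \<not> P l"]
    by auto
  define J\<^sub>2 where "J\<^sub>2 = (*) (of_int (p ^ l)) ` J\<^sub>1 + I"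
  note J2 = scaled_ideal[OF J1(1,3) of_int_mem_span_one[of "p ^ l" "{}"] empty_subsetI, folded J\<^sub>2_def]
  have J2J1: "J\<^sub>2 \<subseteq> J\<^sub>1" by (rule J2(5)[OF J1(2)])
  show thesis
  proof (rule that[OF J2(1) _ J2(3)])
    obtain t where t: "t \<in> J\<^sub>1" "of_int p ^ l * t \<notin> I" using l(1) unfolding P_def by blast
    then have "of_int (p ^ l) * t \<in> J\<^sub>2" "of_int (p ^ l) * t \<notin> I" using J2(4) by auto
    then show "I \<subset> J\<^sub>2" using J2(2) by blast
    have "J\<^sub>2 \<subseteq> J" using J2J1 J1(5)[OF IJ] by blast
    then show "noetherian_between {x} I J\<^sub>2" by (rule noetherian_between_mono[OF J(4)]) simp
    show "\<forall>t\<in>J\<^sub>2. of_int p * t \<in> I"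
    proof
      fix t assume "t \<in> J\<^sub>2"
      then obtain j i where j: "t = of_int (p ^ l) * j + i" "j \<in> J\<^sub>1" "i \<in> I"
        unfolding J\<^sub>2_def by (auto elim!: set_plus_elim)
      have "of_int p ^ Suc l * j \<in> I" using l(2) j(2) unfolding P_def by blast
      from submod_add[OF I(1) this submod_of_int[OF I(1) j(3), of p]]
      show "of_int p * t \<in> I" unfolding j(1) by (simp add: algebra_simps)
    qed
    show "\<forall>t\<in>J\<^sub>2. \<forall>q\<in>nonzero_scalars x. q * t \<in> I \<longrightarrow> t \<in> I" using tf J2J1 by blast
  qed
qed

end

section \<open>Idempotents and the final contradiction\<close>

locale critical_transc = critical_prime U I A a G p k
  for U I A :: "'r::comm_ring_1 set" and a G p k +
  fixes x :: 'r and J :: "'r set"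
  assumes x: "x \<in> U" "transc p I x"
    and J: "submod U J" "I \<subset> J" "J \<subseteq> U"
    and noe: "noetherian_between {x} I J"
    and pJ: "\<And>t. t \<in> J \<Longrightarrow> of_int p * t \<in> I"
    and tf: "\<And>t q. t \<in> J \<Longrightarrow> q \<in> nonzero_scalars x \<Longrightarrow> q * t \<in> I \<Longrightarrow> t \<in> I"
begin

lemma xU: "{x} \<subseteq> U" using x by simp

text \<open>The last nonzero power of a nilpotent element of \<open>J\<close> has square zero and is
  not torsion, so together with \<open>x\<close> it generates a ring of the kind excluded by
  \<open>fin_sep_imp_not_square_zero\<close>.\<close>

lemma reduced: "t \<in> J \<Longrightarrow> t ^ Suc n \<in> I \<Longrightarrow> t \<in> I"
proof (induction n)
  case 0
  then show ?case by simp
next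
  case (Suc n)
  have "t ^ Suc m \<in> J" for m
    using Suc.prems(1) J(3) by (induction m) (auto intro: submod_mult[OF J(1)])
  then have e: "t ^ Suc n \<in> J" .
  \<comment> \<open>The case \<open>n = 0\<close> is apart because \<open>t ^ 0 = 1\<close> need not
    belong to \<open>U\<close>.\<close>
  have "t ^ n * t ^ Suc (Suc n) \<in> I"
  proof (cases n)
    case 0
    then show ?thesis using Suc.prems by simp
  next
    case (Suc m)
    then have "t ^ n \<in> U" using \<open>\<And>m. t ^ Suc m \<in> J\<close> J(3) by blast
    then show ?thesis using Suc.prems(2) by (rule submod_mult[OF I(1)])
  qed
  then have ee: "t ^ Suc n * t ^ Suc n \<in> I" by (simp add: algebra_simps)
  have "t ^ Suc n \<in> I"
  proof (rule ccontr)
    assume nI: "t ^ Suc n \<notin> I"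
    obtain B where B: "x \<in> B" "t ^ Suc n \<in> B" "submod B B" "submod B (I \<inter> B)" "fin_sep (I \<inter> B) B"
      using pair_ring[OF x(1), of "t ^ Suc n"] e J(3) by blast
    have "ipoly q x * t ^ Suc n \<notin> I" if "\<not> [:p:] dvd q" for q
    proof -
      have "ipoly q x \<in> nonzero_scalars x" using that unfolding nonzero_scalars_def by blast
      then show ?thesis using tf[OF e] nI by blast
    qed
    then show False
      using fin_sep_imp_not_square_zero[OF p B(5,3,4) _ B(1,2)] ee submod_mult[OF B(3,2,2)]
      by blast
  qed
  then show ?case using Suc by blast
qed

text \<open>By \<open>not_transc\<close> the element \<alpha> is algebraic, hence integral over
  \<int>. Since \<open>p\<close> kills \<open>J\<close> modulo \<open>I\<close>, it generates a
  finite ring there, and in a finite ring some power is idempotent.\<close>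

lemma power_idempotent:
  assumes \<alpha>: "\<alpha> \<in> A" "\<alpha> \<in> J" "\<alpha> \<notin> I"
  obtains n where "\<alpha> ^ Suc n \<notin> I" "\<alpha> ^ Suc n * \<alpha> ^ Suc n - \<alpha> ^ Suc n \<in> I"
proof -
  have \<alpha>U: "\<alpha> \<in> U" using \<alpha> A(3) by blast
  have int: "integral_mod {} I \<alpha>"
    by (rule algebraic_imp_integral[OF p U I \<alpha>U pk not_transc[OF \<alpha>(1)]])
  obtain S where S: "finite S" "S \<subseteq> range (\<lambda>j. \<alpha> ^ Suc j)" "\<alpha> \<in> span {} (S \<union> I)"
    "\<forall>w\<in>span {} (S \<union> I). \<alpha> * w \<in> span {} (S \<union> I)"
    by (rule integral_mod_stable[OF int submod_mult[OF I(1) \<alpha>U]])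
  define H where "H = span {} (S \<union> I)"
  have H0: "submod {} H" unfolding H_def by (rule submod_span)
  have H: "submod {\<alpha>} H"
    using S(4)[folded H_def] by (intro submodI) (auto intro: submod_0[OF H0] submod_diff[OF H0])
  have "subalg {\<alpha>} \<subseteq> H"
  proof
    fix s assume "s \<in> subalg {\<alpha>}"
    then obtain q where "s = \<alpha> * ipoly q \<alpha>" using subalg_singleton by blast
    then show "s \<in> H" using ipoly_mem[OF H _ S(3)[folded H_def]] by (simp add: mult.commute)
  qed
  moreover have "finite_index H I" unfolding H_def
  proof (rule finite_index_span[of _ _ p])
    show "finite S" by (rule S(1))
    show "submod {} I" by (rule submod_antimono[OF I(1)]) simp
    show "p > 0" using p prime_gt_0_int by simp
    have "\<alpha> ^ Suc j \<in> J" for j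
      using \<alpha>(2) \<alpha>U by (induction j) (auto intro: submod_mult[OF J(1)])
    then show "of_int p * s \<in> I" if "s \<in> S" for s using that pJ S(2) by blast
  qed
  ultimately have fin: "finite_index (subalg {\<alpha>}) I" by - (rule finite_index_subset[OF _ _ I(1)])
  have sub: "subalg {\<alpha>} \<subseteq> U" using \<alpha>U by (intro subalg_minimal[OF U]) simp
  have mem: "\<alpha> \<in> subalg {\<alpha>}" by (rule hull_inc) simp
  obtain m d where md: "m > 0" "d > 0" "\<alpha> ^ (m + d) - \<alpha> ^ m \<in> I"
    by (rule finite_index_powers[OF fin submod_subalg submod_antimono[OF I(1) sub] mem])
  have \<alpha>I: "\<alpha> ^ n * i \<in> I" if "i \<in> I" for n i
    using that by (induction n) (auto simp: mult.assoc intro: submod_mult[OF I(1) \<alpha>U])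
  have period: "\<alpha> ^ (m + l * d) - \<alpha> ^ m \<in> I" for l
  proof (induction l)
    case 0
    then show ?case using submod_0[OF I(1)] by simp
  next
    case (Suc l)
    from submod_add[OF I(1) \<alpha>I[OF Suc, of d] md(3)]
    show ?case by (simp add: algebra_simps power_add)
  qed
  \<comment> \<open>The exponent \<open>m * d\<close> is a multiple of the period \<open>d\<close>
    and at least the preperiod \<open>m\<close>, so this power equals its own square.\<close>
  have "\<alpha> ^ (m * d - m) * (\<alpha> ^ (m + m * d) - \<alpha> ^ m) \<in> I" by (rule \<alpha>I[OF period])
  moreover have "m \<le> m * d" using md(2) by simp
  ultimately have "\<alpha> ^ (m * d) * \<alpha> ^ (m * d) - \<alpha> ^ (m * d) \<in> I"
    by (simp add: right_diff_distrib flip: power_add)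
  moreover obtain n where n: "m * d = Suc n" using md gr0_implies_Suc[of "m * d"] by auto
  moreover have "\<alpha> ^ Suc n \<notin> I" using reduced[OF \<alpha>(2)] \<alpha>(3) by blast
  ultimately show thesis using that by metis
qed

text \<open>Modulo \<open>I\<close>, the ring is the direct sum of \<open>e U\<close> and the
  annihilator \<open>Z\<close> of \<open>e\<close>. If \<open>Z\<close> were nonzero,
  \<open>a\<close> would lie in both \<open>A + Z\<close> and \<open>A + e U\<close>; as
  \<open>e\<close> is in \<open>A\<close>, the first gives \<open>e * a \<in> A\<close> and the
  second \<open>a - e * a \<in> A\<close>, so \<open>a\<close> would be in \<open>A\<close>.\<close>

lemma idempotent_is_identity:
  assumes e: "e \<in> A" "e \<in> J" "e \<notin> I" "e * e - e \<in> I" and u: "u \<in> U"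
  shows "u - e * u \<in> I"
proof -
  have eU: "e \<in> U" using e(2) J(3) by blast
  have ee: "e * u - e * (e * u) \<in> I" if "u \<in> U" for u
    using submod_minus[OF I(1) submod_mult[OF I(1) that e(4)]] by (simp add: algebra_simps)
  define Z where "Z = {u \<in> U. e * u \<in> I}"
  have Z: "submod U Z" unfolding Z_def by (rule submod_vimage_mult[OF U I(1)])
  have ZU: "Z \<subseteq> U" unfolding Z_def by blast
  have IZ: "I \<subseteq> Z" unfolding Z_def using I submod_mult[OF I(1) eU] by blast
  have "Z = I"
  proof (rule ccontr)
    assume "Z \<noteq> I"
    then have "a \<in> A + Z" using IZ by (intro near[OF Z _ ZU]) blast
    then obtain \<alpha> z where z: "a = \<alpha> + z" "\<alpha> \<in> A" "z \<in> Z" by (rule set_plus_elim)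
    have 1: "e * \<alpha> + e * z \<in> A"
      using submod_mult[OF A(1) e(1) z(2)] z(3) A(2) unfolding Z_def
      by (intro submod_add[OF A(1)]) auto
    define V where "V = (*) e ` U + I"
    have eU_sub: "submod U ((*) e ` U)" by (rule submod_image_mult[OF U])
    have V: "submod U V" unfolding V_def by (intro submod_plus eU_sub I)
    have IV: "I \<subseteq> V" unfolding V_def by (rule subset_plusR[OF eU_sub])
    have VU: "V \<subseteq> U" unfolding V_def using submod_mult[OF U eU]
      by (intro plus_minimal[OF U] I) blast
    have "e * e + (- (e * e - e)) \<in> V"
      unfolding V_def using submod_minus[OF I(1) e(4)] eU by (intro set_plus_intro) auto
    then have "e \<in> V" by simp
    then have "a \<in> A + V" using IV e(3) by (intro near[OF V _ VU]) blast
    then obtain \<beta> v i where v: "a = \<beta> + (e * v + i)" "\<beta> \<in> A" "v \<in> U" "i \<in> I"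
      unfolding V_def by (auto elim!: set_plus_elim)
    have "(e * v - e * (e * v)) + (i - e * i) \<in> I"
      by (rule submod_add[OF I(1) ee[OF v(3)] submod_diff[OF I(1) v(4) submod_mult[OF I(1) eU v(4)]]])
    then have "(e * v - e * (e * v)) + (i - e * i) \<in> A" using A(2) by blast
    then have "(\<beta> - e * \<beta>) + ((e * v - e * (e * v)) + (i - e * i)) \<in> A"
      by (rule submod_add[OF A(1) submod_diff[OF A(1) v(2) submod_mult[OF A(1) e(1) v(2)]]])
    moreover have "(\<beta> - e * \<beta>) + ((e * v - e * (e * v)) + (i - e * i)) = a - e * a"
      unfolding v(1) by (simp add: algebra_simps)
    moreover have "e * \<alpha> + e * z = e * a" unfolding z(1) by (simp add: distrib_left)
    ultimately have "e * a + (a - e * a) \<in> A" using 1 by (intro submod_add[OF A(1)]) auto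
    then show False using a(2) by simp
  qed
  moreover have "u - e * u \<in> Z"
    unfolding Z_def using ee[OF u] submod_diff[OF U u submod_mult[OF U eU u]]
    by (simp add: right_diff_distrib)
  ultimately show ?thesis by blast
qed

lemma separate:
  assumes V: "submod U V" "I \<subseteq> V" "V \<subseteq> J" and v: "v \<in> V" "v \<notin> I"
  obtains q where "q \<in> nonzero_scalars x" "v \<notin> I + (*) q ` V"
proof -
  have "noetherian_between {x} I V" by (rule noetherian_between_mono[OF noe V(3)]) simp
  then show thesis
    using noetherian_separate[OF _ submod_antimono[OF I(1) xU] V(2) submod_antimono[OF V(1) xU] v
        nonzero_scalars(1,2,4,5)] that by blast
qed

text \<open>If \<open>A \<inter> V\<close> were zero modulo \<open>I\<close>, take \<open>j\<close>
  in \<open>V\<close> outside \<open>A\<close> and \<open>q\<close> with \<open>j\<close> outside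
  \<open>I + q V\<close>. By torsion-freeness \<open>q V\<close> is nonzero, so minimality puts
  \<open>j\<close> in \<open>A + q V + I\<close>. The component in \<open>A\<close> then lies in
  \<open>V\<close>, so it is zero, and \<open>j\<close> falls into \<open>I + q V\<close>.\<close>

lemma ideal_meets:
  assumes V: "submod U V" "I \<subset> V" "V \<subseteq> J"
  shows "\<not> A \<inter> V \<subseteq> I"
proof
  assume AV: "A \<inter> V \<subseteq> I"
  have VU: "V \<subseteq> U" and IV: "I \<subseteq> V" using V J(3) by auto
  obtain j where j: "j \<in> V" "j \<notin> A"
    "\<forall>I'. submod U I' \<longrightarrow> I \<subset> I' \<longrightarrow> I' \<subseteq> U \<longrightarrow> j \<in> A + I'"
    by (rule near_element[OF V(1,2) VU])
  have "j \<notin> I" using j(2) A(2) by blast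
  obtain q where q: "q \<in> nonzero_scalars x" "j \<notin> I + (*) q ` V"
    by (rule separate[OF V(1) IV V(3) j(1) \<open>j \<notin> I\<close>])
  have q1: "q \<in> span {x} {1}" using q(1) nonzero_scalars(1) by blast
  note W = scaled_ideal[OF V(1) VU q1 xU]
  have "q * j \<notin> I" using tf[OF _ q(1)] j(1) V(3) \<open>j \<notin> I\<close> by blast
  then have "I \<subset> (*) q ` V + I" using W(2) W(4)[OF j(1)] by blast
  then have "j \<in> A + ((*) q ` V + I)" using j(3) W(1,3) by blast
  then obtain \<alpha> w where w: "j = \<alpha> + w" "\<alpha> \<in> A" "w \<in> (*) q ` V + I" by (rule set_plus_elim)
  have "w \<in> V" using w(3) W(5)[OF IV] by blast
  then have "\<alpha> \<in> V" using submod_diff[OF V(1) j(1), of w] w(1) by simp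
  then have "\<alpha> \<in> I" using AV w(2) by blast
  obtain t i where t: "w = q * t + i" "t \<in> V" "i \<in> I" using w(3) by (auto elim!: set_plus_elim)
  have "(\<alpha> + i) + q * t \<in> I + (*) q ` V"
    using submod_add[OF I(1) \<open>\<alpha> \<in> I\<close> t(3)] t(2) by (intro set_plus_intro) auto
  then show False using q(2) w(1) t(1) by (simp add: algebra_simps)
qed

lemma contradiction: False
proof -
  obtain \<alpha> where \<alpha>: "\<alpha> \<in> A" "\<alpha> \<in> J" "\<alpha> \<notin> I" using ideal_meets[OF J(1,2) order.refl] by blast
  have pow: "t ^ Suc n \<in> V" if "t \<in> V" "V \<subseteq> U" "submod V V" for t n V
    using that by (induction n) (auto intro: submod_mult)
  obtain n where n: "\<alpha> ^ Suc n \<notin> I" "\<alpha> ^ Suc n * \<alpha> ^ Suc n - \<alpha> ^ Suc n \<in> I"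
    by (rule power_idempotent[OF \<alpha>])
  define e where "e = \<alpha> ^ Suc n"
  have JJ: "submod J J" by (rule submod_antimono[OF J(1) J(3)])
  have e: "e \<in> A" "e \<in> J" "e \<notin> I" "e * e - e \<in> I"
    unfolding e_def using n pow[OF \<alpha>(1) A(3) A(1)] pow[OF \<alpha>(2) J(3) JJ] by auto
  have UJ: "U \<subseteq> J"
  proof
    fix u assume u: "u \<in> U"
    have "u - e * u \<in> J" using idempotent_is_identity[OF e u] J(2) by blast
    moreover have "u * e \<in> J" by (rule submod_mult[OF J(1) u e(2)])
    ultimately have "(u - e * u) + u * e \<in> J" by (rule submod_add[OF J(1)])
    then show "u \<in> J" by (simp add: mult.commute)
  qed
  have eU: "e \<in> U" using e(2) J(3) by blast
  \<comment> \<open>\<open>J\<close> contains the identity \<open>e\<close> of \<open>U\<close>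
    modulo \<open>I\<close>, so separation is available in all of \<open>U\<close>. The ideal
    \<open>q U + I\<close> avoids \<open>e\<close>, yet it meets \<open>A\<close> in an element with
    an idempotent power, again an identity.\<close>
  obtain q where q: "q \<in> nonzero_scalars x" "e \<notin> I + (*) q ` U"
    by (rule separate[OF U I(2) UJ eU e(3)])
  have q1: "q \<in> span {x} {1}" using q(1) nonzero_scalars(1) by blast
  define W where "W = (*) q ` U + I"
  note W = scaled_ideal[OF U order.refl q1 xU, folded W_def]
  have eW: "e \<notin> W" using q(2) unfolding W_def by (simp add: add.commute)
  have "q * x \<notin> I" using x(2) q(1) unfolding transc_iff by blast
  then have IW: "I \<subset> W" using W(2) W(4)[OF x(1)] by blast
  have WJ: "W \<subseteq> J" using W(3) UJ by blast
  obtain \<beta> where \<beta>: "\<beta> \<in> A" "\<beta> \<in> W" "\<beta> \<notin> I" using ideal_meets[OF W(1) IW WJ] by blast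
  then have "\<beta> \<in> J" using WJ by blast
  obtain l where l: "\<beta> ^ Suc l \<notin> I" "\<beta> ^ Suc l * \<beta> ^ Suc l - \<beta> ^ Suc l \<in> I"
    by (rule power_idempotent[OF \<beta>(1) \<open>\<beta> \<in> J\<close> \<beta>(3)])
  have \<beta>l: "\<beta> ^ Suc l \<in> A" "\<beta> ^ Suc l \<in> J" "\<beta> ^ Suc l \<in> W"
    using pow[OF \<beta>(1) A(3) A(1)] pow[OF \<open>\<beta> \<in> J\<close> J(3) JJ]
      pow[OF \<beta>(2) W(3) submod_antimono[OF W(1) W(3)]] by auto
  have "e - \<beta> ^ Suc l * e \<in> W"
    using idempotent_is_identity[OF \<beta>l(1,2) l eU] IW by blast
  moreover have "e * \<beta> ^ Suc l \<in> W" by (rule submod_mult[OF W(1) eU \<beta>l(3)])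
  ultimately have "(e - \<beta> ^ Suc l * e) + e * \<beta> ^ Suc l \<in> W" by (rule submod_add[OF W(1)])
  then show False using eW by (simp add: mult.commute)
qed

end

section \<open>Noetherian induction\<close>

theorem pairwise_sep_imp_fin_sep:
  assumes G: "finite G" and I: "submod (subalg G) I" "I \<subseteq> subalg G"
    and pw: "pairwise_sep I (subalg G)"
  shows "fin_sep I (subalg G)"
proof (rule ccontr)
  assume nfs: "\<not> fin_sep I (subalg G)"
  define U where "U = subalg G"
  define P where "P N \<longleftrightarrow> submod U N \<and> I \<subseteq> N \<and> \<not> fin_sep N U" for N
  have GU: "G \<subseteq> U" unfolding U_def by (rule hull_subset)
  have U: "submod U U" unfolding U_def by simp
  have noe: "noetherian_between G {0} U" unfolding U_def by (rule noetherian_subalg[OF G])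
  obtain M where M: "M \<subseteq> U" "P M"
    and max: "\<And>N. submod G N \<Longrightarrow> M \<subset> N \<Longrightarrow> N \<subseteq> U \<Longrightarrow> \<not> P N"
  proof (rule noetherian_maximal[OF noe, of I P])
    show "submod G I" by (rule submod_antimono[OF I(1)[folded U_def] GU])
    show "{0} \<subseteq> I" using submod_0[OF I(1)] by simp
    show "I \<subseteq> U" "P I" using I nfs unfolding P_def U_def by simp_all
    fix M
    assume "M \<subseteq> U" "P M" "\<And>N. submod G N \<Longrightarrow> M \<subset> N \<Longrightarrow> N \<subseteq> U \<Longrightarrow> \<not> P N"
    then show thesis by (rule that)
  qed
  have M': "submod U M" "I \<subseteq> M" "\<not> fin_sep M U" using M(2) unfolding P_def by auto
  have sep: "fin_sep N U" if "submod U N" "M \<subset> N" "N \<subseteq> U" for N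
    using max[OF submod_antimono[OF that(1) GU] that(2,3)] that(1,2) M'(2) unfolding P_def
    by blast
  have "\<exists>A. \<exists>a\<in>U. (submod A A \<and> M \<subseteq> A \<and> A \<subseteq> U \<and> a \<notin> A) \<and>
    \<not> (\<exists>Q. submod U Q \<and> M \<subseteq> Q \<and> Q \<subseteq> U \<and> finite_index U Q \<and> a \<notin> A + Q)"
    using M'(3) unfolding fin_sep_def by (simp only: not_all ball_simps not_imp)
  then obtain A a where a: "a \<in> U" "a \<notin> A" and A: "submod A A" "M \<subseteq> A" "A \<subseteq> U"
    and no: "\<not> (\<exists>Q. submod U Q \<and> M \<subseteq> Q \<and> Q \<subseteq> U \<and> finite_index U Q \<and> a \<notin> A + Q)"
    by (elim exE bexE conjE) (rule that)
  have no: "a \<in> A + Q" if "submod U Q" "M \<subseteq> Q" "Q \<subseteq> U" "finite_index U Q" for Q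
    using no that by blast
  interpret critical U M A a G
  proof unfold_locales
    show "finite G" "U = subalg G" by (rule G, rule U_def)
    \<comment> \<open>By maximality of \<open>M\<close> the quotient by \<open>N\<close> is
      separable. An ideal separating \<open>a\<close> from \<open>A + N\<close> there would also
      separate \<open>a\<close> from \<open>A\<close> modulo \<open>M\<close>.\<close>
    show "a \<in> A + N" if N: "submod U N" "M \<subset> N" "N \<subseteq> U" for N
    proof (rule ccontr)
      assume "a \<notin> A + N"
      have AA: "subalg A = A" using A(1) by (rule hull_same)
      note AN = submod_subalg_plus[OF U A(3) N(1,3), unfolded AA]
      obtain Q where Q: "submod U Q" "N \<subseteq> Q" "Q \<subseteq> U" "finite_index U Q" "a \<notin> (A + N) + Q"
        by (rule fin_sepD[OF sep[OF N] AN(2,4,1) a(1) \<open>a \<notin> A + N\<close>])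
      have "a \<in> A + Q" using no[OF Q(1) _ Q(3,4)] N(2) Q(2) by blast
      also have "\<dots> \<subseteq> (A + N) + Q" by (rule set_plus_mono2[OF AN(5) order.refl])
      finally show False using Q(5) by blast
    qed
    show "\<not> finite_index U M"
    proof
      assume "finite_index U M"
      then have "a \<in> A + M" using no[OF M'(1) order.refl M(1)] by blast
      then show False using plus_minimal[OF A(1) order.refl A(2)] a(2) by blast
    qed
    show "\<exists>B. x \<in> B \<and> y \<in> B \<and> submod B B \<and> B \<subseteq> U \<and> submod B (M \<inter> B) \<and>
      B \<subseteq> subalg {x, y} + (M \<inter> B) \<and> fin_sep (M \<inter> B) B" if "x \<in> U" "y \<in> U" for x y
      by (rule pairwise_sep_mono[OF pw[folded U_def] U I(1)[folded U_def] M'(1,2) M(1) that])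
  qed (use M M' A a in auto)
  obtain p :: int and k where p: "Factorial_Ring.prime p" "\<forall>u\<in>U. of_int p ^ Suc k * u \<in> M"
    by (rule prime_power_torsion)
  interpret critical_prime U M A a G p k
    by unfold_locales (use p in auto)
  obtain x where x: "x \<in> U" "transc p M x" by (rule exists_transc)
  obtain J where J: "submod U J" "M \<subset> J" "J \<subseteq> U" "noetherian_between {x} M J"
    "\<forall>t\<in>J. of_int p * t \<in> M" "\<forall>t\<in>J. \<forall>q\<in>nonzero_scalars x. q * t \<in> M \<longrightarrow> t \<in> M"
    by (rule torsion_free_ideal[OF x])
  interpret critical_transc U M A a G p k x J
    by unfold_locales (use x J in auto)
  show False by (rule contradiction)
qed

section \<open>Presentations by polynomial rings\<close>

lemma (in rng) rng_l_null: "x \<in> carrier R \<Longrightarrow> \<zero> \<otimes> x = \<zero>"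
proof -
  assume x: "x \<in> carrier R"
  have "\<zero> \<otimes> x \<oplus> \<zero> \<otimes> x = \<zero> \<otimes> x \<oplus> \<zero>"
    using x rng_l_distr[of \<zero> \<zero> x] by (simp add: rng_m_closed)
  then show ?thesis using x by (simp add: rng_m_closed)
qed

lemma (in rng) rng_r_null: "x \<in> carrier R \<Longrightarrow> x \<otimes> \<zero> = \<zero>"
proof -
  assume x: "x \<in> carrier R"
  have "x \<otimes> \<zero> \<oplus> x \<otimes> \<zero> = x \<otimes> \<zero> \<oplus> \<zero>"
    using x rng_r_distr[of \<zero> \<zero> x] by (simp add: rng_m_closed)
  then show ?thesis using x by (simp add: rng_m_closed)
qed

lemma (in rng) subrngI:
  assumes "H \<subseteq> carrier R" "\<zero> \<in> H" "\<And>x y. x \<in> H \<Longrightarrow> y \<in> H \<Longrightarrow> x \<ominus> y \<in> H"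
    "\<And>x y. x \<in> H \<Longrightarrow> y \<in> H \<Longrightarrow> x \<otimes> y \<in> H"
  shows "subrng H R"
proof (intro subrng.intro subrng_axioms.intro additive_subgroup.intro add.subgroupI)
  have minus: "\<ominus> x \<in> H" if "x \<in> H" for x
    using assms(3)[OF assms(2) that] assms(1) that by (auto simp: a_minus_def)
  then show "\<ominus> x \<in> H" if "x \<in> H" for x using that .
  show "x \<oplus> y \<in> H" if "x \<in> H" "y \<in> H" for x y
    using assms(3)[OF that(1) minus[OF that(2)]] assms(1) that by (auto simp: a_minus_def)
qed (use assms in auto)

lemma (in rng) subrngD:
  assumes "subrng H R"
  shows "H \<subseteq> carrier R" "\<zero> \<in> H" "x \<in> H \<Longrightarrow> y \<in> H \<Longrightarrow> x \<oplus> y \<in> H"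
    "x \<in> H \<Longrightarrow> \<ominus> x \<in> H" "x \<in> H \<Longrightarrow> y \<in> H \<Longrightarrow> x \<ominus> y \<in> H" "x \<in> H \<Longrightarrow> y \<in> H \<Longrightarrow> x \<otimes> y \<in> H"
proof -
  interpret H: subrng H R by fact
  show sub: "H \<subseteq> carrier R" "\<zero> \<in> H" by (auto simp: H.a_subset)
  show add: "x \<oplus> y \<in> H" if "x \<in> H" "y \<in> H" for x y using that by simp
  show minus: "\<ominus> x \<in> H" if "x \<in> H" for x
    using subgroup.m_inv_closed[OF H.a_subgroup] that by (simp add: a_inv_def)
  show "x \<ominus> y \<in> H" if "x \<in> H" "y \<in> H" using add minus that by (simp add: a_minus_def)
  show "x \<otimes> y \<in> H" if "x \<in> H" "y \<in> H" using H.subrng_m_closed that .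
qed

lemma (in rng) subrng_image:
  fixes h :: "'r::comm_ring_1 \<Rightarrow> 'a"
  assumes B: "submod B B" and closed: "\<And>s. s \<in> B \<Longrightarrow> h s \<in> carrier R"
    and add: "\<And>s t. s \<in> B \<Longrightarrow> t \<in> B \<Longrightarrow> h (s + t) = h s \<oplus> h t"
    and mult: "\<And>s t. s \<in> B \<Longrightarrow> t \<in> B \<Longrightarrow> h (s * t) = h s \<otimes> h t"
  shows "subrng (h ` B) R"
proof (rule subrngI)
  show "h ` B \<subseteq> carrier R" using closed by blast
  have "h 0 = \<zero>" using add[of 0 0] submod_0[OF B] closed[of 0] by simp
  then show "\<zero> \<in> h ` B" using submod_0[OF B] by (metis imageI)
  fix x y assume "x \<in> h ` B" "y \<in> h ` B"
  then obtain s t where st: "s \<in> B" "t \<in> B" "x = h s" "y = h t" by blast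
  have d: "s - t \<in> B" by (rule submod_diff[OF B st(1,2)])
  have "h s = h (s - t) \<oplus> h t" using add[OF d st(2)] by simp
  then have "x \<ominus> y = h (s - t)" unfolding st(3,4)
    using closed[OF d] closed[OF st(2)] by (simp add: a_minus_def a_assoc r_neg)
  then show "x \<ominus> y \<in> h ` B" using d by simp
  have "x \<otimes> y = h (s * t)" unfolding st(3,4) using mult[OF st(1,2)] by simp
  then show "x \<otimes> y \<in> h ` B" using submod_mult[OF B st(1,2)] by simp
qed

text \<open>The link between two settings: the record \<open>L\<close>, a ring without identity, is
  a quotient of a subring \<open>B\<close> of a type class ring with identity. The map
  \<open>h\<close> is constrained on \<open>B\<close> only.\<close>

locale presentation = rng L for L (structure) +
  fixes B :: "'r::comm_ring_1 set" and h :: "'r \<Rightarrow> 'a"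
  assumes B: "submod B B"
    and h_add: "\<lbrakk> s \<in> B; t \<in> B \<rbrakk> \<Longrightarrow> h (s + t) = h s \<oplus> h t"
    and h_mult: "\<lbrakk> s \<in> B; t \<in> B \<rbrakk> \<Longrightarrow> h (s * t) = h s \<otimes> h t"
    and h_surj: "h ` B = carrier L"
begin

definition kernel :: "'r set"
  where "kernel = {s \<in> B. h s = \<zero>}"

lemma h_closed: "s \<in> B \<Longrightarrow> h s \<in> carrier L"
  using h_surj by blast

lemma h_0: "h 0 = \<zero>"
  using h_add[of 0 0] submod_0[OF B] h_closed[of 0] by simp

lemma h_diff: "s \<in> B \<Longrightarrow> t \<in> B \<Longrightarrow> h (s - t) = h s \<ominus> h t"
proof -
  assume st: "s \<in> B" "t \<in> B"
  have d: "s - t \<in> B" by (rule submod_diff[OF B st])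
  have "h s = h (s - t) \<oplus> h t" using h_add[OF d st(2)] by simp
  then show ?thesis using h_closed[OF d] h_closed[OF st(2)]
    by (simp add: a_minus_def a_assoc r_neg)
qed

lemma h_eq_iff: "s \<in> B \<Longrightarrow> t \<in> B \<Longrightarrow> h s = h t \<longleftrightarrow> s - t \<in> kernel"
proof -
  assume st: "s \<in> B" "t \<in> B"
  have d: "s - t \<in> B" by (rule submod_diff[OF B st])
  have "h s = h (s - t) \<oplus> h t" using h_add[OF d st(2)] by simp
  then show ?thesis unfolding kernel_def
    using h_diff[OF st] d h_closed[OF st(2)] by (auto simp: a_minus_def r_neg)
qed

lemma kernel: "submod B kernel" "kernel \<subseteq> B"
proof -
  show "kernel \<subseteq> B" unfolding kernel_def by blast
  show "submod B kernel"
    by (rule submodI)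
      (auto simp: kernel_def h_0 h_diff h_mult h_closed rng_r_null a_minus_def
        intro: submod_0[OF B] submod_diff[OF B] submod_mult[OF B])
qed

lemma finitely_separable_imp_fin_sep:
  assumes fs: "finitely_separable L"
  shows "fin_sep kernel B"
  unfolding fin_sep_def
proof (intro allI ballI impI)
  fix A a assume a: "a \<in> B" and A: "submod A A \<and> kernel \<subseteq> A \<and> A \<subseteq> B \<and> a \<notin> A"
  then have A': "submod A A" "kernel \<subseteq> A" "A \<subseteq> B" "a \<notin> A" by auto
  have "subrng (h ` A) L"
    by (rule subrng_image[OF A'(1)]) (use A'(3) in \<open>auto intro: h_closed h_add h_mult\<close>)
  moreover have "h a \<notin> h ` A"
  proof
    assume "h a \<in> h ` A"
    then obtain s where s: "s \<in> A" "h a = h s" by blast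
    then have "a - s \<in> A" using h_eq_iff a A' by blast
    then show False using submod_add[OF A'(1) _ s(1), of "a - s"] A'(4) by simp
  qed
  ultimately obtain F :: "nat ring" and \<phi> where F: "rng F" "finite (carrier F)" "\<phi> \<in> rng_hom L F"
    "\<phi> (h a) \<notin> \<phi> ` h ` A"
    using fs h_closed[OF a] unfolding finitely_separable_def by blast
  interpret F: rng F by fact
  \<comment> \<open>The image of \<open>\<phi> \<circ> h\<close> is again presented by
    \<open>B\<close>, and the kernel of this presentation is the required ideal of finite
    index.\<close>
  interpret \<phi>: presentation "F\<lparr>carrier := \<phi> ` h ` B\<rparr>" B "\<phi> \<circ> h"
  proof -
    have closed: "\<phi> (h s) \<in> carrier F" if "s \<in> B" for s
      using F(3) h_closed[OF that] unfolding rng_hom_def by blast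
    have add: "\<phi> (h (s + t)) = \<phi> (h s) \<oplus>\<^bsub>F\<^esub> \<phi> (h t)"
      and mult: "\<phi> (h (s * t)) = \<phi> (h s) \<otimes>\<^bsub>F\<^esub> \<phi> (h t)" if "s \<in> B" "t \<in> B" for s t
      using F(3) h_closed that unfolding rng_hom_def by (auto simp: h_add h_mult)
    have "subrng ((\<phi> \<circ> h) ` B) F"
      by (rule F.subrng_image[OF B]) (use closed add mult in auto)
    then show "presentation (F\<lparr>carrier := \<phi> ` h ` B\<rparr>) B (\<phi> \<circ> h)"
      by (intro presentation.intro presentation_axioms.intro subrng.rng_restrict F.rng_axioms B)
        (auto simp: add mult image_image)
  qed
  have \<phi>_kernel: "\<phi>.kernel = {s \<in> B. \<phi> (h s) = \<zero>\<^bsub>F\<^esub>}" unfolding \<phi>.kernel_def by simp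
  have "finite_index B \<phi>.kernel"
  proof -
    have "finite ((\<phi> \<circ> h) ` B)"
      using F(2,3) h_closed finite_subset[of "(\<phi> \<circ> h) ` B" "carrier F"] unfolding rng_hom_def
      by auto
    then obtain S where S: "S \<subseteq> B" "finite S" "(\<phi> \<circ> h) ` B = (\<phi> \<circ> h) ` S"
      using finite_subset_image[of "(\<phi> \<circ> h) ` B" "\<phi> \<circ> h" B] by auto
    have "\<exists>s\<in>S. b - s \<in> \<phi>.kernel" if "b \<in> B" for b
    proof -
      have "(\<phi> \<circ> h) b \<in> (\<phi> \<circ> h) ` S" using S(3) that by blast
      then obtain s where "s \<in> S" "(\<phi> \<circ> h) b = (\<phi> \<circ> h) s" by blast
      then show ?thesis using \<phi>.h_eq_iff[OF that, of s] S(1) by blast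
    qed
    then show ?thesis unfolding finite_index_def using S(1,2) by blast
  qed
  moreover have "kernel \<subseteq> \<phi>.kernel"
    unfolding kernel_def \<phi>_kernel using \<phi>.h_0 h_0 by auto
  moreover have "a \<notin> A + \<phi>.kernel"
  proof
    assume "a \<in> A + \<phi>.kernel"
    then obtain s q where sq: "a = s + q" "s \<in> A" "q \<in> \<phi>.kernel" by (rule set_plus_elim)
    then have "a - s \<in> \<phi>.kernel" by simp
    then have "\<phi> (h a) = \<phi> (h s)" using \<phi>.h_eq_iff[OF a, of s] sq(2) A'(3) by auto
    then show False using F(4) sq(2) by blast
  qed
  ultimately show "\<exists>Q. submod B Q \<and> kernel \<subseteq> Q \<and> Q \<subseteq> B \<and> finite_index B Q \<and> a \<notin> A + Q"
    using \<phi>.kernel by blast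
qed

lemma fin_sep_imp_finitely_separable:
  assumes fs: "fin_sep kernel B"
  shows "finitely_separable L"
proof (rule finitely_separableI)
  fix a' A' assume a': "a' \<in> carrier L" "subrng A' L" "a' \<notin> A'"
  define A where "A = {s \<in> B. h s \<in> A'}"
  obtain a where a: "a \<in> B" "h a = a'" using a'(1) h_surj by (metis imageE)
  note A'D = subrngD[OF a'(2)]
  have A: "submod A A"
    by (rule submodI) (auto simp: A_def h_0 h_diff h_mult A'D submod_0[OF B] submod_diff[OF B] submod_mult[OF B])
  have "kernel \<subseteq> A" unfolding kernel_def A_def using A'D(2) by auto
  moreover have "A \<subseteq> B" "a \<notin> A" unfolding A_def using a a'(3) by auto
  ultimately obtain Q where Q: "submod B Q" "kernel \<subseteq> Q" "Q \<subseteq> B" "finite_index B Q" "a \<notin> A + Q"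
    using fin_sepD[OF fs A _ _ a(1)] by metis
  \<comment> \<open>The finite ring \<open>B / Q\<close> is realised on coset representatives.
    \<open>\<rho>\<close> depends only on the coset, because the predicate under \<open>SOME\<close>
    does.\<close>
  define \<rho> where "\<rho> b = (SOME r. r \<in> B \<and> b - r \<in> Q)" for b
  have \<rho>: "\<rho> b \<in> B" "b - \<rho> b \<in> Q" if "b \<in> B" for b
    using someI[of "\<lambda>r. r \<in> B \<and> b - r \<in> Q" b] that submod_0[OF Q(1)] unfolding \<rho>_def by auto
  have \<rho>_eq: "\<rho> b = \<rho> c" if "b - c \<in> Q" for b c
  proof -
    have "b - r \<in> Q \<longleftrightarrow> c - r \<in> Q" for r
      using submod_add[OF Q(1) that, of "c - r"] submod_diff[OF Q(1) _ that, of "b - r"] by auto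
    then show ?thesis unfolding \<rho>_def by simp
  qed
  have \<rho>_iff: "\<rho> b = \<rho> c \<longleftrightarrow> b - c \<in> Q" if "b \<in> B" "c \<in> B" for b c
  proof
    assume "\<rho> b = \<rho> c"
    then show "b - c \<in> Q" using submod_diff[OF Q(1) \<rho>(2)[OF that(1)] \<rho>(2)[OF that(2)]] by simp
  qed (rule \<rho>_eq)
  have \<rho>_add: "\<rho> (\<rho> b + \<rho> c) = \<rho> (b + c)" if "b \<in> B" "c \<in> B" for b c
    using submod_minus[OF Q(1) submod_add[OF Q(1) \<rho>(2)[OF that(1)] \<rho>(2)[OF that(2)]]]
    by (intro \<rho>_eq) (simp add: algebra_simps)
  have \<rho>_mult: "\<rho> (\<rho> b * \<rho> c) = \<rho> (b * c)" if "b \<in> B" "c \<in> B" for b c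
  proof (rule \<rho>_eq)
    have "\<rho> b * (c - \<rho> c) + c * (b - \<rho> b) \<in> Q"
      using that \<rho> by (intro submod_add[OF Q(1)] submod_mult[OF Q(1)])
    from submod_minus[OF Q(1) this] show "\<rho> b * \<rho> c - b * c \<in> Q" by (simp add: algebra_simps)
  qed
  have \<rho>_idem: "\<rho> (\<rho> b) = \<rho> b" if "b \<in> B" for b
    using submod_minus[OF Q(1) \<rho>(2)[OF that]] by (intro \<rho>_eq) simp
  define F :: "'r ring" where "F = \<lparr>carrier = \<rho> ` B, monoid.mult = (\<lambda>x y. \<rho> (x * y)), one = 0,
    ring.zero = \<rho> 0, ring.add = (\<lambda>x y. \<rho> (x + y))\<rparr>"
  have B0: "0 \<in> B" "\<And>b c. b \<in> B \<Longrightarrow> c \<in> B \<Longrightarrow> b + c \<in> B" "\<And>b c. b \<in> B \<Longrightarrow> c \<in> B \<Longrightarrow> b * c \<in> B"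
    "\<And>b. b \<in> B \<Longrightarrow> - b \<in> B"
    using submod_0[OF B] submod_add[OF B] submod_mult[OF B] submod_minus[OF B] by auto
  have F_add: "\<rho> b \<oplus>\<^bsub>F\<^esub> \<rho> c = \<rho> (b + c)" and F_mult: "\<rho> b \<otimes>\<^bsub>F\<^esub> \<rho> c = \<rho> (b * c)"
    if "b \<in> B" "c \<in> B" for b c
    using that by (simp_all add: F_def \<rho>_add \<rho>_mult)
  have F_zero: "\<zero>\<^bsub>F\<^esub> = \<rho> 0" and F_carrier: "carrier F = \<rho> ` B" by (simp_all add: F_def)
  have "rng F"
  proof (intro rng.intro rng_axioms.intro abelian_groupI)
    fix x assume "x \<in> carrier F"
    then obtain b where b: "b \<in> B" "x = \<rho> b" unfolding F_carrier by blast
    then have "\<rho> (- b) \<oplus>\<^bsub>F\<^esub> x = \<zero>\<^bsub>F\<^esub>" using F_add[of "- b" b] B0 F_zero by simp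
    moreover have "\<rho> (- b) \<in> carrier F" unfolding F_carrier using B0(4)[OF b(1)] by (rule imageI)
    ultimately show "\<exists>y\<in>carrier F. y \<oplus>\<^bsub>F\<^esub> x = \<zero>\<^bsub>F\<^esub>" by (rule bexI)
  qed (auto simp: F_carrier F_zero F_add F_mult B0 algebra_simps)
  moreover have "finite (carrier F)"
  proof -
  obtain S where S: "finite S" "\<And>b. b \<in> B \<Longrightarrow> \<exists>s\<in>S. b - s \<in> Q"
    using Q(4) unfolding finite_index_def by blast
  have "\<rho> ` B \<subseteq> \<rho> ` S" using S(2) \<rho>_eq by blast
  then show ?thesis unfolding F_carrier using S(1) finite_surj by blast
  qed
  moreover define \<phi> where "\<phi> l = \<rho> (SOME b. b \<in> B \<and> h b = l)" for l
  have \<phi>_h: "\<phi> (h b) = \<rho> b" if "b \<in> B" for b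
  proof -
  define c where "c = (SOME c. c \<in> B \<and> h c = h b)"
  have "c \<in> B \<and> h c = h b" unfolding c_def by (rule someI[of _ b]) (use that in simp)
  then have "c - b \<in> Q" using h_eq_iff[of c b] that Q(2) by blast
  then show ?thesis unfolding \<phi>_def c_def[symmetric] by (rule \<rho>_eq)
  qed
  have "\<phi> \<in> rng_hom L F"
  proof -
  have "\<phi> (x \<oplus> y) = \<phi> x \<oplus>\<^bsub>F\<^esub> \<phi> y" "\<phi> (x \<otimes> y) = \<phi> x \<otimes>\<^bsub>F\<^esub> \<phi> y"
    if xy: "x \<in> carrier L" "y \<in> carrier L" for x y
  proof -
    obtain s t where st: "s \<in> B" "t \<in> B" "x = h s" "y = h t" using xy h_surj by (metis imageE)
    then show "\<phi> (x \<oplus> y) = \<phi> x \<oplus>\<^bsub>F\<^esub> \<phi> y" "\<phi> (x \<otimes> y) = \<phi> x \<otimes>\<^bsub>F\<^esub> \<phi> y"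
      by (simp_all add: \<phi>_h F_add F_mult B0 flip: h_add h_mult)
  qed
  moreover have "\<phi> \<in> carrier L \<rightarrow> carrier F"
    unfolding F_carrier h_surj[symmetric] using \<phi>_h by auto
  ultimately show ?thesis unfolding rng_hom_def by blast
  qed
  moreover have "\<phi> a' \<notin> \<phi> ` A'"
  proof
  assume "\<phi> a' \<in> \<phi> ` A'"
  then obtain \<alpha>' where \<alpha>': "\<alpha>' \<in> A'" "\<phi> a' = \<phi> \<alpha>'" by blast
  then obtain \<alpha> where \<alpha>: "\<alpha> \<in> B" "h \<alpha> = \<alpha>'" using A'D(1) h_surj by (metis imageE subsetD)
  then have "a - \<alpha> \<in> Q" using \<alpha>'(2) a \<phi>_h \<rho>_iff by metis
  moreover have "\<alpha> \<in> A" unfolding A_def using \<alpha> \<alpha>'(1) by blast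
  ultimately have "\<alpha> + (a - \<alpha>) \<in> A + Q" by (intro set_plus_intro)
  then show False using Q(5) by simp
  qed
  ultimately show "\<exists>(F :: 'r ring) \<phi>. rng F \<and> finite (carrier F) \<and> \<phi> \<in> rng_hom L F \<and>
    \<phi> a' \<notin> \<phi> ` A'"
  by blast
qed

lemma finitely_separable_iff: "finitely_separable L \<longleftrightarrow> fin_sep kernel B"
  using finitely_separable_imp_fin_sep fin_sep_imp_finitely_separable by blast

end

text \<open>The element \<open>None\<close> is an adjoined identity, the value of the empty product.\<close>

definition option_monoid :: "('a, 'm) ring_scheme \<Rightarrow> 'a option monoid"
  where "option_monoid R = \<lparr>carrier = insert None (Some ` carrier R),
  monoid.mult = (\<lambda>u v. case u of None \<Rightarrow> v
    | Some a \<Rightarrow> (case v of None \<Rightarrow> Some a | Some b \<Rightarrow> Some (a \<otimes>\<^bsub>R\<^esub> b))),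
  one = None\<rparr>"

section \<open>Evaluation of polynomials without constant term\<close>

context comm_rng
begin

lemma comm_monoid_option: "comm_monoid (option_monoid R)"
  by (rule comm_monoidI)
  (auto simp: option_monoid_def rng_m_closed rng_m_assoc intro: rng_m_comm)

text \<open>Commutativity makes the product of a list independent of its order. The fold starts from
  the unit of \<open>option_monoid\<close>, which never survives in a nonempty product.\<close>

lemma multiset_product:
  obtains v :: "'a multiset \<Rightarrow> 'a" where
  "\<And>M. M \<noteq> {#} \<Longrightarrow> set_mset M \<subseteq> carrier R \<Longrightarrow> v M \<in> carrier R"
  "\<And>a. a \<in> carrier R \<Longrightarrow> v {#a#} = a"
  "\<And>M N. \<lbrakk> M \<noteq> {#}; N \<noteq> {#}; set_mset M \<subseteq> carrier R; set_mset N \<subseteq> carrier R \<rbrakk>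
    \<Longrightarrow> v (M + N) = v M \<otimes> v N"
proof -
  interpret P: comm_monoid "option_monoid R" by (rule comm_monoid_option)
  define prod where "prod xs
    = foldr (\<otimes>\<^bsub>option_monoid R\<^esub>) (map Some xs) \<one>\<^bsub>option_monoid R\<^esub>" for xs :: "'a list"
  define list where "list M = (SOME xs. mset xs = M)" for M :: "'a multiset"
  have list: "mset (list M) = M" for M unfolding list_def by (rule someI_ex[OF ex_mset])
  have set_list: "set (list M) = set_mset M" for M by (metis list set_mset_mset)
  define v where "v M = the (prod (list M))" for M
  have prod_perm: "prod xs = prod ys" if "mset xs = mset ys" "set xs \<subseteq> carrier R" for xs ys
  unfolding prod_def using that
  by (intro P.multlist_perm_cong) (auto simp: option_monoid_def)
  have prod_carrier: "\<exists>x\<in>carrier R. prod xs = Some x" if "xs \<noteq> []" "set xs \<subseteq> carrier R" for xs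
  using that
  proof (induction xs)
  case (Cons a xs)
  show ?case
  proof (cases xs)
    case Nil
    then show ?thesis using Cons.prems unfolding prod_def by (auto simp: option_monoid_def)
  next
    case (Cons b ys)
    then obtain x where "x \<in> carrier R" "prod xs = Some x" using Cons.IH Cons.prems by auto
    then show ?thesis using Cons.prems unfolding prod_def
      by (auto simp: option_monoid_def intro: rng_m_closed)
  qed
  qed simp
  have prod_append: "prod (xs @ ys) = prod xs \<otimes>\<^bsub>option_monoid R\<^esub> prod ys"
  if "set xs \<subseteq> carrier R" "set ys \<subseteq> carrier R" for xs ys
  using that
  proof (induction xs)
  case Nil
  have "prod ys \<in> carrier (option_monoid R)"
    unfolding prod_def using Nil by (intro P.multlist_closed) (auto simp: option_monoid_def)
  then show ?case unfolding prod_def by simp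
  next
  case (Cons a xs)
  have "prod zs \<in> carrier (option_monoid R)" if "set zs \<subseteq> carrier R" for zs
    unfolding prod_def using that by (intro P.multlist_closed) (auto simp: option_monoid_def)
  moreover have "Some a \<in> carrier (option_monoid R)" using Cons.prems
    by (simp add: option_monoid_def)
  moreover have "prod (z # zs) = Some z \<otimes>\<^bsub>option_monoid R\<^esub> prod zs" for z zs
    unfolding prod_def by simp
  ultimately show ?case using Cons by (simp add: P.m_assoc)
  qed
  show thesis
  proof (rule that)
  fix M assume M: "M \<noteq> {#}" "set_mset M \<subseteq> carrier R"
  then have "list M \<noteq> []" using list[of M] by auto
  then obtain x where "x \<in> carrier R" "prod (list M) = Some x"
    using prod_carrier[of "list M"] M set_list by auto
  then show "v M \<in> carrier R" unfolding v_def by simp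
  next
  fix a assume a: "a \<in> carrier R"
  have "prod (list {#a#}) = prod [a]" using a set_list[of "{#a#}"]
    by (intro prod_perm) (auto simp: list)
  also have "\<dots> = Some a" using a unfolding prod_def by (simp add: option_monoid_def)
  finally show "v {#a#} = a" unfolding v_def by simp
  next
  fix M N assume MN: "M \<noteq> {#}" "N \<noteq> {#}" "set_mset M \<subseteq> carrier R" "set_mset N \<subseteq> carrier R"
  have "list M \<noteq> []" "list N \<noteq> []" using MN list[of M] list[of N] by auto
  then obtain x y where xy: "x \<in> carrier R" "prod (list M) = Some x" "y \<in> carrier R"
    "prod (list N) = Some y"
    using prod_carrier[of "list M"] prod_carrier[of "list N"] MN set_list by metis
  have "prod (list (M + N)) = prod (list M @ list N)"
    using MN by (intro prod_perm) (auto simp: list set_list)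
  also have "\<dots> = Some (x \<otimes> y)"
    using xy MN by (subst prod_append) (auto simp: set_list option_monoid_def)
  finally show "v (M + N) = v M \<otimes> v N" unfolding v_def using xy by simp
  qed
qed

text \<open>Multisets act as commutative monomials with ring elements as variables, so their
  finitely supported integer functions form a polynomial ring. Excluding \<open>{#}\<close> excludes
  constant terms, which could not be evaluated without an identity.\<close>

definition monomials :: "'a multiset set"
  where "monomials = {M. M \<noteq> {#} \<and> set_mset M \<subseteq> carrier R}"

definition polynomials :: "('a multiset \<Rightarrow>\<^sub>0 int) set"
  where "polynomials = {f. Poly_Mapping.keys f \<subseteq> monomials}"

lemma submod_polynomials: "submod polynomials polynomials"
proof (rule submodI)
  show "0 \<in> polynomials" unfolding polynomials_def by simp
  show "f - g \<in> polynomials" if "f \<in> polynomials" "g \<in> polynomials" for f g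
  using that keys_diff[of f g] unfolding polynomials_def by blast
  show "f * g \<in> polynomials" if "f \<in> polynomials" "g \<in> polynomials" for f g
  using that keys_mult[of f g] unfolding polynomials_def monomials_def by fastforce
qed

lemma evaluation:
  obtains h :: "('a multiset \<Rightarrow>\<^sub>0 int) \<Rightarrow> 'a" where
  "\<And>f. f \<in> polynomials \<Longrightarrow> h f \<in> carrier R"
  "\<And>f g. f \<in> polynomials \<Longrightarrow> g \<in> polynomials \<Longrightarrow> h (f + g) = h f \<oplus> h g"
  "\<And>f g. f \<in> polynomials \<Longrightarrow> g \<in> polynomials \<Longrightarrow> h (f * g) = h f \<otimes> h g"
  "\<And>a. a \<in> carrier R \<Longrightarrow> h (frag_of {#a#}) = a"
proof -
  obtain v :: "'a multiset \<Rightarrow> 'a" where v: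
  "\<And>M. M \<noteq> {#} \<Longrightarrow> set_mset M \<subseteq> carrier R \<Longrightarrow> v M \<in> carrier R"
  "\<And>a. a \<in> carrier R \<Longrightarrow> v {#a#} = a"
  "\<And>M N. \<lbrakk> M \<noteq> {#}; N \<noteq> {#}; set_mset M \<subseteq> carrier R; set_mset N \<subseteq> carrier R \<rbrakk>
    \<Longrightarrow> v (M + N) = v M \<otimes> v N"
  by (rule multiset_product) blast
  have "v ` monomials \<subseteq> carrier (add_monoid R)" using v(1) unfolding monomials_def by auto
  \<comment> \<open>Additivity comes from the universal property of the free abelian group on the
    monomials; multiplicativity has to be proved.\<close>
  then obtain h where h: "h \<in> hom (free_Abelian_group monomials) (add_monoid R)"
  "\<And>M. M \<in> monomials \<Longrightarrow> h (frag_of M) = v M"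
  using comm_group.free_Abelian_group_universal[OF a_comm_group] by metis
  have closed: "h f \<in> carrier R" if "f \<in> polynomials" for f
  using h(1) that unfolding hom_def polynomials_def by (auto simp: Pi_iff)
  have add: "h (f + g) = h f \<oplus> h g" if "f \<in> polynomials" "g \<in> polynomials" for f g
  using h(1) that unfolding hom_def polynomials_def by auto
  note P = submod_polynomials
  have diff_eq: "h f = h (f - g) \<oplus> h g" if "f \<in> polynomials" "g \<in> polynomials" for f g
  using add[OF submod_diff[OF P that] that(2)] by simp
  have zero: "h 0 = \<zero>" using add[of 0 0] submod_0[OF P] closed[of 0] by simp
  have mono: "frag_of M \<in> polynomials" if "M \<in> monomials" for M
  using that unfolding polynomials_def by simp
  have mult_diff: "h ((f - g) * t) = h (f - g) \<otimes> h t"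
  if fg: "f \<in> polynomials" "g \<in> polynomials" and t: "t \<in> polynomials"
    and eqs: "h (f * t) = h f \<otimes> h t" "h (g * t) = h g \<otimes> h t" for f g t
  proof -
  have d: "f - g \<in> polynomials" by (rule submod_diff[OF P fg])
  have "h (f * t) = h ((f - g) * t) \<oplus> h (g * t)"
    using diff_eq[OF submod_mult[OF P fg(1) t] submod_mult[OF P fg(2) t]]
    by (simp add: left_diff_distrib)
  moreover have "h (f * t) = h (f - g) \<otimes> h t \<oplus> h (g * t)"
    unfolding eqs using diff_eq[OF fg] rng_l_distr[OF closed[OF d] closed[OF fg(2)] closed[OF t]]
    by simp
  ultimately show ?thesis
    using closed d fg t submod_mult[OF P] by (simp add: rng_m_closed)
  qed
  have mult_mono: "h (frag_of M * frag_of N) = h (frag_of M) \<otimes> h (frag_of N)"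
  if "M \<in> monomials" "N \<in> monomials" for M N
  using that v(3) h(2) unfolding mult_single monomials_def by auto
  \<comment> \<open>Multiplicativity spreads from pairs of monomials one factor at a time;
    commutativity lets the second induction use the first.\<close>
  have mult1: "h (f * frag_of N) = h f \<otimes> h (frag_of N)"
    if f: "f \<in> polynomials" and N: "N \<in> monomials" for f N
  proof -
  have "f \<in> polynomials \<and> h (f * frag_of N) = h f \<otimes> h (frag_of N)"
  proof (rule frag_induction[of f monomials])
    show "Poly_Mapping.keys f \<subseteq> monomials" using f unfolding polynomials_def by simp
  qed (use closed[OF mono[OF N]] submod_0[OF P] submod_diff[OF P] mono mult_mono mult_diff N
      in \<open>auto simp: zero rng_l_null\<close>)
  then show ?thesis ..
  qed
  have mult: "h (f * g) = h f \<otimes> h g" if f: "f \<in> polynomials" and g: "g \<in> polynomials" for f g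
  proof -
  have "f \<in> polynomials \<and> h (f * g) = h f \<otimes> h g"
  proof (rule frag_induction[of f monomials])
    show "Poly_Mapping.keys f \<subseteq> monomials" using f unfolding polynomials_def by simp
    fix M assume M: "M \<in> monomials"
    have "h (frag_of M * g) = h (g * frag_of M)" by (simp add: mult.commute)
    also have "\<dots> = h (frag_of M) \<otimes> h g"
      using mult1[OF g M] rng_m_comm[OF closed[OF g] closed[OF mono[OF M]]] by simp
    finally show "frag_of M \<in> polynomials \<and> h (frag_of M * g) = h (frag_of M) \<otimes> h g"
      using mono[OF M] by simp
  qed (use closed[OF g] submod_0[OF P] submod_diff[OF P] mult_diff g
      in \<open>auto simp: zero rng_l_null\<close>)
  then show ?thesis ..
  qed
  have "h (frag_of {#a#}) = a" if "a \<in> carrier R" for a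
  using h(2)[of "{#a#}"] v(2)[OF that] that unfolding monomials_def by simp
  then show thesis using that[of h] closed add mult by blast
qed

end

section \<open>Transfer to the given ring\<close>

theorem mainTheorem2:
  fixes K :: "('a, 'm) ring_scheme"
  assumes "comm_rng K"
  and "finitely_generated_rng K"
  shows "finitely_separable K \<longleftrightarrow>
  (\<forall>a\<in>carrier K. \<forall>b\<in>carrier K.
    finitely_separable (K\<lparr>carrier := generate_rng K {a, b}\<rparr>))"
proof -
  interpret comm_rng K by fact
  obtain S where S: "finite S" "S \<subseteq> carrier K" "generate_rng K S = carrier K"
    using assms(2) unfolding finitely_generated_rng_def by blast
  obtain h :: "('a multiset \<Rightarrow>\<^sub>0 int) \<Rightarrow> 'a" where h:
    "\<And>f. f \<in> polynomials \<Longrightarrow> h f \<in> carrier K"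
    "\<And>f g. f \<in> polynomials \<Longrightarrow> g \<in> polynomials \<Longrightarrow> h (f + g) = h f \<oplus>\<^bsub>K\<^esub> h g"
    "\<And>f g. f \<in> polynomials \<Longrightarrow> g \<in> polynomials \<Longrightarrow> h (f * g) = h f \<otimes>\<^bsub>K\<^esub> h g"
    "\<And>a. a \<in> carrier K \<Longrightarrow> h (frag_of {#a#}) = a"
    by (rule evaluation) blast
  \<comment> \<open>Only variables for the finite generating set are kept, so that \<open>U\<close>
    is finitely generated and satisfies the chain condition.\<close>
  define G where "G = (\<lambda>s. frag_of {#s#}) ` S"
  define U where "U = subalg G"
  have U: "submod U U" unfolding U_def by simp
  have "G \<subseteq> polynomials" unfolding G_def polynomials_def monomials_def using S(2) by auto
  then have UP: "U \<subseteq> polynomials" unfolding U_def by (rule subalg_minimal[OF submod_polynomials])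
  have image: "subrng (h ` B) K" if "submod B B" "B \<subseteq> U" for B
    by (rule subrng_image[OF that(1)]) (use that(2) UP in \<open>blast intro: h(1-3)\<close>)+
  have "S \<subseteq> h ` U"
  proof
    fix s assume s: "s \<in> S"
    have "frag_of {#s#} \<in> U" unfolding U_def G_def using s by (intro hull_inc) blast
    moreover have "h (frag_of {#s#}) = s" using h(4) S(2) s by blast
    ultimately show "s \<in> h ` U" by (metis imageI)
  qed
  then have "carrier K \<subseteq> h ` U"
    unfolding S(3)[symmetric] generate_rng_def using image[OF U order.refl] by blast
  then have surj: "h ` U = carrier K" using h(1) UP by blast
  interpret U: presentation K U h
    by unfold_locales (use U UP surj in \<open>blast intro: h(2,3)\<close>)+
  \<comment> \<open>The subring generated by \<open>h x\<close> and \<open>h y\<close> is presented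
    by \<open>subalg {x, y}\<close> enlarged by the kernel of \<open>h\<close>, which leaves the
    kernel unchanged.\<close>
  have pair: "finitely_separable (K\<lparr>carrier := generate_rng K {h x, h y}\<rparr>) \<longleftrightarrow>
      fin_sep U.kernel (subalg {x, y} + U.kernel)" if xy: "x \<in> U" "y \<in> U" for x y
  proof -
    define T where "T = generate_rng K {h x, h y}"
    have T: "subrng T K" unfolding T_def using xy
      by (intro subrng_generate_rng) (auto intro: U.h_closed)
    have xyU: "{x, y} \<subseteq> U" using xy by simp
    define B where "B = subalg {x, y} + U.kernel"
    note B = submod_subalg_plus[OF U xyU U.kernel, folded B_def]
    have sub: "submod {s \<in> U. h s \<in> T} {s \<in> U. h s \<in> T}"
      by (rule submodI)
        (auto simp: U.h_0 U.h_diff U.h_mult subrngD[OF T]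
          intro: submod_0[OF U] submod_diff[OF U] submod_mult[OF U])
    have "{h x, h y} \<subseteq> T" unfolding T_def generate_rng_def by blast
    then have "subalg {x, y} \<subseteq> {s \<in> U. h s \<in> T}" using xy by (intro subalg_minimal[OF sub]) auto
    moreover have "U.kernel \<subseteq> {s \<in> U. h s \<in> T}"
      unfolding U.kernel_def using subrngD(2)[OF T] by auto
    ultimately have "B \<subseteq> {s \<in> U. h s \<in> T}" unfolding B_def by (intro plus_minimal[OF sub])
    moreover have "T \<subseteq> h ` B" unfolding T_def generate_rng_def
      using image[OF B(2) B(1)] B(5) by blast
    ultimately have hB: "h ` B = T" by blast
    interpret B: presentation "K\<lparr>carrier := T\<rparr>" B h
    proof (intro presentation.intro presentation_axioms.intro)
      show "rng (K\<lparr>carrier := T\<rparr>)" by (rule subrng.rng_restrict[OF T rng_axioms])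
    qed (use B(1,2) hB in \<open>auto simp: U.h_add U.h_mult subset_iff\<close>)
    have "B.kernel = U.kernel"
      unfolding B.kernel_def U.kernel_def using B(1,4) unfolding U.kernel_def by auto
    then show ?thesis using B.finitely_separable_iff unfolding B_def T_def by simp
  qed
  show ?thesis
  proof
    assume "finitely_separable K"
    then have fs: "fin_sep U.kernel U" using U.finitely_separable_iff by blast
    show "\<forall>a\<in>carrier K. \<forall>b\<in>carrier K.
        finitely_separable (K\<lparr>carrier := generate_rng K {a, b}\<rparr>)"
    proof (intro ballI)
      fix a b assume "a \<in> carrier K" "b \<in> carrier K"
      then obtain x y where xy: "x \<in> U" "y \<in> U" "a = h x" "b = h y" using surj by (metis imageE)
      then have "{x, y} \<subseteq> U" by simp
      note B = submod_subalg_plus[OF U this U.kernel]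
      show "finitely_separable (K\<lparr>carrier := generate_rng K {a, b}\<rparr>)"
        unfolding xy(3,4) pair[OF xy(1,2)] by (rule fin_sep_subset[OF fs B(2,1,4)])
    qed
  next
    assume pairs: "\<forall>a\<in>carrier K. \<forall>b\<in>carrier K.
      finitely_separable (K\<lparr>carrier := generate_rng K {a, b}\<rparr>)"
    have "pairwise_sep U.kernel U"
      unfolding pairwise_sep_def using pair pairs U.h_closed by blast
    moreover have "finite G" unfolding G_def using S(1) by simp
    ultimately have "fin_sep U.kernel U"
      using U.kernel unfolding U_def by (intro pairwise_sep_imp_fin_sep)
    then show "finitely_separable K" using U.finitely_separable_iff by blast
  qed
qed

end
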